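(* Let $q\in\mathbb{C}^*$ be not a root of unity. The fused K-operators $\mathcal{K}^{(j)}(u)\in\mathcal{A}_q((u^{-1}))\otimes\mathrm{End}(\mathbb{C}^{2j+1})$ of the algebra $\mathcal{A}_q$ satisfy, for all $j_1,j_2\in\frac12\mathbb{N}_+$, the reflection equation $$R^{(j_1,j_2)}(u_1/u_2)\,\mathcal{K}^{(j_1)}_1(u_1)\,R^{(j_1,j_2)}(u_1u_2)\,\mathcal{K}^{(j_2)}_2(u_2)=\mathcal{K}^{(j_2)}_2(u_2)\,R^{(j_1,j_2)}(u_1u_2)\,\mathcal{K}^{(j_1)}_1(u_1)\,R^{(j_1,j_2)}(u_1/u_2),$$ where $u_1,u_2$ are formal variables, $R^{(j_1,j_2)}(u)$ are the fused R-matrices, and the subscripts $1,2$ indicate on which factor of $\mathbb{C}^{2j_1+1}\otimes\mathbb{C}^{2j_2+1}$ the matrix acts.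
   Context: $q\in\mathbb{C}^*$ is not a root of unity, a square root $q^{1/2}$ is fixed; $[n]_q=\frac{q^n-q^{-n}}{q-q^{-1}}$, $c(u)=u-u^{-1}$, $\mathbb{N}_+=\{1,2,\dots\}$. Every rational function of $u$ is expanded in powers of $u^{-1}$. **Matrices $\mathcal{E},\mathcal{F}$.** $\mathbb{C}^{2j+1}$ has ordered basis $|j,m\rangle$, $m=j,j-1,\dots,-j$. Put $B_{j,m}=\sqrt{[j+m]_q[j-m+1]_q}$ (fixed choice of roots). For $j\in\frac12\mathbb{N}_+$, $\mathcal{E}^{(j+\frac12)}:\mathbb{C}^{2j+2}\to\mathbb{C}^2\otimes\mathbb{C}^{2j+1}$ is the $(4j+2)\times(2j+2)$ matrix, in the bases $|j+\frac12,m\rangle$ ($m$ decreasing) and $|\uparrow\rangle\otimes|j,j\rangle,\dots,|\uparrow\rangle\otimes|j,-j\rangle,|\downarrow\rangle\otimes|j,j\rangle,\dots,|\downarrow\rangle\otimes|j,-j\rangle$, whose non-zero entries are $\mathcal{E}_{1,1}=1$, $\mathcal{E}_{1+n,1+n}=\prod_{p=0}^{n-1}\frac{B_{j,j-p}}{B_{j+\frac12,j+\frac12-p}}$ ($1\le n\le 2j$), $\mathcal{E}_{2j+1+m,1+m}=[m]_q\frac{\mathcal{E}_{m,m}}{B_{j+\frac12,j+\frac32-m}}$ ($1\le m\le 2j+1$). $\mathcal{F}^{(j+\frac12)}:\mathbb{C}^2\otimes\mathbb{C}^{2j+1}\to\mathbb{C}^{2j+2}$ has non-zero entries $\mathcal{F}_{1,1}=1$,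 $\mathcal{F}_{2j+2,4j+2}=(\mathcal{E}_{4j+2,2j+2})^{-1}$ and, for $2\le n\le 2j+1$, $\mathcal{F}_{n,n+2j}=\frac{\mathcal{E}_{n+2j,n}}{\mathcal{E}_{n,n}^2+\mathcal{E}_{n+2j,n}^2}$, $\mathcal{F}_{n,n}=\frac{1-\mathcal{F}_{n,n+2j}\mathcal{E}_{n+2j,n}}{\mathcal{E}_{n,n}}$. Then $\mathcal{F}^{(j+\frac12)}\mathcal{E}^{(j+\frac12)}=\mathbb{I}_{2j+2}$. A subscript $\langle 12\rangle$ (resp. $\langle 23\rangle$) indicates which two tensor factors $\mathcal{E},\mathcal{F}$ fuse. **Fused R-matrices.** In the basis $\uparrow\uparrow,\uparrow\downarrow,\downarrow\uparrow,\downarrow\downarrow$, $$R^{(\frac12,\frac12)}(u)=\begin{pmatrix}c(uq)&0&0&0\\0&c(u)&c(q)&0\\0&c(q)&c(u)&0\\0&0&0&c(uq)\end{pmatrix}.$$ For $j\in\frac12\mathbb{N}_+$: $R^{(\frac12,j+\frac12)}(u)=\mathcal{F}^{(j+\frac12)}_{\langle23\rangle}R_{13}^{(\frac12,j)}(uq^{-\frac12})R_{12}^{(\frac12,\frac12)}(uq^{j})\mathcal{E}^{(j+\frac12)}_{\langle23\rangle}$ on $\mathbb{C}^2\otimes\mathbb{C}^{2j+2}$; and for $j_1\ge1$: $R^{(j_1,j_2)}(u)=\mathcal{F}^{(j_1)}_{\langle12\rangle}R_{13}^{(\frac12,j_2)}(uq^{-j_1+\frac12})R_{23}^{(j_1-\frac12,j_2)}(uq^{\frac12})\mathcal{E}^{(j_1)}_{\langle12\rangle}$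 on $\mathbb{C}^{2j_1+1}\otimes\mathbb{C}^{2j_2+1}$. **The algebra $\mathcal{A}_q$.** Fix $k_\pm\in\mathbb{C}^*$ and $\rho=k_+k_-(q+q^{-1})^2$. $\mathcal{A}_q$ is the unital associative $\mathbb{C}$-algebra generated by $\mathsf{W}_{-k},\mathsf{W}_{k+1},\mathsf{G}_{k+1},\tilde{\mathsf{G}}_{k+1}$ ($k\in\mathbb{N}$) with defining relations obtained as follows. Let $U=(qu^2+q^{-1}u^{-2})/(q+q^{-1})$, $\mathcal{W}_+(u)=\sum_{k\ge0}\mathsf{W}_{-k}U^{-k-1}$, $\mathcal{W}_-(u)=\sum_{k\ge0}\mathsf{W}_{k+1}U^{-k-1}$, $\mathcal{G}_+(u)=\sum_{k\ge0}\mathsf{G}_{k+1}U^{-k-1}$, $\mathcal{G}_-(u)=\sum_{k\ge0}\tilde{\mathsf{G}}_{k+1}U^{-k-1}$ and $$\mathcal{K}^{(\frac12)}(u)=\begin{pmatrix}uq\mathcal{W}_+(u)-u^{-1}q^{-1}\mathcal{W}_-(u)&\frac{1}{k_-(q+q^{-1})}\mathcal{G}_+(u)+\frac{k_+(q+q^{-1})}{q-q^{-1}}\\ \frac{1}{k_+(q+q^{-1})}\mathcal{G}_-(u)+\frac{k_-(q+q^{-1})}{q-q^{-1}}&uq\mathcal{W}_-(u)-u^{-1}q^{-1}\mathcal{W}_+(u)\end{pmatrix}.$$ The defining relations are those obtained by equating coefficients in $R^{(\frac12,\frac12)}(u/v)\mathcal{K}_1^{(\frac12)}(u)R^{(\frac12,\frac12)}(uv)\mathcal{K}_2^{(\frac12)}(v)=\mathcal{K}_2^{(\frac12)}(v)R^{(\frac12,\frac12)}(uv)\mathcal{K}_1^{(\frac12)}(u)R^{(\frac12,\frac12)}(u/v)$.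 **Fused K-operators.** For $j\in\frac12\mathbb{N}_+$, $$\mathcal{K}^{(j+\frac12)}(u)=\mathcal{F}^{(j+\frac12)}_{\langle12\rangle}\,\mathcal{K}_1^{(\frac12)}(uq^{-j})\,R^{(\frac12,j)}(u^2q^{-j+\frac12})\,\mathcal{K}_2^{(j)}(uq^{\frac12})\,\mathcal{E}^{(j+\frac12)}_{\langle12\rangle}.$$
   Formalization: In the fixed choice of roots, the root B_{1/2,1/2} of [1]_q[1]_q = 1 is taken to be 1 (all other roots are arbitrary); with the choice -1 the fused operators for spin 1 use the antisymmetric combination and the reflection equation fails. *)

theory Defs
  imports
    "HOL-Library.Poly_Mapping"
    "HOL-Computational_Algebra.Formal_Laurent_Series"
    "HOL-Algebra.Algebraic_Closure_Type"
    "HOL-Algebra.QuotRing"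
    "Jordan_Normal_Form.Matrix"
begin

text \<open>
  Conventions. Spins are doubled: a natural number \<open>n \<ge> 1\<close> stands for the spin \<open>n/2\<close>, so
  \<open>j \<in> (1/2)\<nat>\<^sub>+\<close> is \<open>n = 2j \<ge> 1\<close> and the spin space has dimension \<open>n + 1\<close>; the clauses for \<open>n = 0\<close>
  in the recursions below are never reached from \<open>n \<ge> 1\<close>. Matrix rows and columns are counted
  from 0. The parameter \<open>s\<close> is the chosen square root of \<open>q\<close>.

  A formal Laurent series in the library variable \<open>X\<close> is read as a series in \<open>u\<^sup>-\<^sup>1\<close>: the variable
  \<open>u\<close> is \<^term>\<open>fls_X_inv\<close>, and coefficient \<open>n\<close> belongs to \<open>u\<^sup>-\<^sup>n\<close>.
\<close>

section \<open>Formal series\<close>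

definition fls_map :: "('a::zero \<Rightarrow> 'b::zero) \<Rightarrow> 'a fls \<Rightarrow> 'b fls" where
  "fls_map f g = Abs_fls (\<lambda>n. f (fls_nth g n))"

lemma fls_nth_fls_map:
  assumes "f 0 = 0"
  shows "fls_nth (fls_map f g) n = f (fls_nth g n)"
  unfolding fls_map_def
  by (rule nth_Abs_fls_lower_bound[of "fls_subdegree g"]) (simp add: assms)


section \<open>Tensor products of matrices\<close>

definition tensor_mat :: "'a::times mat \<Rightarrow> 'a mat \<Rightarrow> 'a mat"  (infixl \<open>\<otimes>\<^sub>m\<close> 75) where
  "A \<otimes>\<^sub>m B = mat (dim_row A * dim_row B) (dim_col A * dim_col B)
     (\<lambda>(r, c). A $$ (r div dim_row B, c div dim_col B) * B $$ (r mod dim_row B, c mod dim_col B))"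

text \<open>The action of \<open>M\<close> on the first and third factor of a tensor product of three spaces of
  dimensions \<open>a\<close>, \<open>b\<close>, \<open>d\<close>.\<close>

definition act13 :: "nat \<Rightarrow> nat \<Rightarrow> nat \<Rightarrow> 'a::zero mat \<Rightarrow> 'a mat" where
  "act13 a b d M = mat (a * b * d) (a * b * d)
     (\<lambda>(r, c). if r div d mod b = c div d mod b
               then M $$ (r div (b * d) * d + r mod d, c div (b * d) * d + c mod d) else 0)"


section \<open>The matrices fusing spin \<open>1/2\<close> and spin \<open>j\<close>\<close>

definition qint :: "complex \<Rightarrow> nat \<Rightarrow> complex" where
  "qint q n = (q ^ n - inverse q ^ n) / (q - inverse q)"

text \<open>
  \<open>B n p\<close> is the chosen root \<open>B\<^bsub>j,m\<^esub>\<close> of \<open>[j+m]\<^sub>q [j-m+1]\<^sub>q\<close> with \<open>n = 2j\<close> and \<open>m = j - p\<close>. Any choice of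
  roots is allowed, except that the root \<open>B\<^bsub>1/2,1/2\<^esub>\<close> of \<open>[1]\<^sub>q [1]\<^sub>q = 1\<close> is \<open>1\<close>: with \<open>-1\<close> the first
  fusion would map into the antisymmetric combination of the spin \<open>1/2\<close> basis vectors.
\<close>

definition root_choice :: "complex \<Rightarrow> (nat \<Rightarrow> nat \<Rightarrow> complex) \<Rightarrow> bool" where
  "root_choice q B \<longleftrightarrow>
     (\<forall>n p. p \<le> n \<longrightarrow> (B n p)\<^sup>2 = qint q (n - p) * qint q (p + 1)) \<and> B 1 0 = 1"

text \<open>For \<open>n = 2j\<close>, \<open>fuse_E q B n\<close> and \<open>fuse_F q B n\<close> are the matrices with superscript \<open>j + 1/2\<close>.\<close>

definition fuse_E :: "complex \<Rightarrow> (nat \<Rightarrow> nat \<Rightarrow> complex) \<Rightarrow> nat \<Rightarrow> complex mat" where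
  "fuse_E q B n =
     (let e = (\<lambda>k. \<Prod>p<k. B n p / B (n + 1) p)
      in mat (2 * n + 2) (n + 2)
        (\<lambda>(r, c). if r = c \<and> r \<le> n then e c
                  else if r = n + c \<and> 1 \<le> c then qint q c * e (c - 1) / B (n + 1) (c - 1)
                  else 0))"

definition fuse_F :: "complex \<Rightarrow> (nat \<Rightarrow> nat \<Rightarrow> complex) \<Rightarrow> nat \<Rightarrow> complex mat" where
  "fuse_F q B n =
     (let E = fuse_E q B n;
          f = (\<lambda>k. E $$ (k + n, k) / ((E $$ (k, k))\<^sup>2 + (E $$ (k + n, k))\<^sup>2))
      in mat (n + 2) (2 * n + 2)
        (\<lambda>(r, c). if r = 0 \<and> c = 0 then 1
                  else if r = n + 1 \<and> c = 2 * n + 1 then inverse (E $$ (2 * n + 1, n + 1))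
                  else if 1 \<le> r \<and> r \<le> n \<and> c = r + n then f r
                  else if 1 \<le> r \<and> r \<le> n \<and> c = r then (1 - f r * E $$ (r + n, r)) / E $$ (r, r)
                  else 0))"


section \<open>Fused R-matrices\<close>

text \<open>The entries of the R-matrices are Laurent polynomials in the spectral parameter. They are
  evaluated at a non-zero element \<open>x\<close> of a field containing the complex numbers via \<open>\<iota>\<close>.\<close>

definition cfun :: "'b::field \<Rightarrow> 'b" where
  "cfun x = x - inverse x"

definition R_fund :: "(complex \<Rightarrow> 'b::field) \<Rightarrow> complex \<Rightarrow> 'b \<Rightarrow> 'b mat" where
  "R_fund \<iota> q x = mat_of_rows_list 4
     [[cfun (x * \<iota> q), 0, 0, 0],
      [0, cfun x, \<iota> (cfun q), 0],
      [0, \<iota> (cfun q), cfun x, 0],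
      [0, 0, 0, cfun (x * \<iota> q)]]"

text \<open>\<open>R_half \<iota> q s B n x\<close> is \<open>R\<^bsup>(1/2,n/2)\<^esup>(x)\<close>; the recursive clause is the fusion with \<open>2j = n + 1\<close>.\<close>

fun R_half :: "(complex \<Rightarrow> 'b::field) \<Rightarrow> complex \<Rightarrow> complex \<Rightarrow> (nat \<Rightarrow> nat \<Rightarrow> complex) \<Rightarrow> nat \<Rightarrow> 'b \<Rightarrow> 'b mat"
where
  "R_half \<iota> q s B 0 x = 1\<^sub>m 2"
| "R_half \<iota> q s B (Suc 0) x = R_fund \<iota> q x"
| "R_half \<iota> q s B (Suc (Suc n)) x =
     (1\<^sub>m 2 \<otimes>\<^sub>m map_mat \<iota> (fuse_F q B (n + 1)))
     * act13 2 2 (n + 2) (R_half \<iota> q s B (Suc n) (x * \<iota> (inverse s)))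
     * (R_fund \<iota> q (x * \<iota> (s ^ (n + 1))) \<otimes>\<^sub>m 1\<^sub>m (n + 2))
     * (1\<^sub>m 2 \<otimes>\<^sub>m map_mat \<iota> (fuse_E q B (n + 1)))"

text \<open>\<open>R_fused \<iota> q s B m n x\<close> is \<open>R\<^bsup>(m/2,n/2)\<^esup>(x)\<close>; in the recursive clause \<open>j\<^sub>1 = (m + 2)/2\<close>.\<close>

fun R_fused ::
  "(complex \<Rightarrow> 'b::field) \<Rightarrow> complex \<Rightarrow> complex \<Rightarrow> (nat \<Rightarrow> nat \<Rightarrow> complex) \<Rightarrow> nat \<Rightarrow> nat \<Rightarrow> 'b \<Rightarrow> 'b mat"
where
  "R_fused \<iota> q s B 0 n x = 1\<^sub>m (n + 1)"
| "R_fused \<iota> q s B (Suc 0) n x = R_half \<iota> q s B n x"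
| "R_fused \<iota> q s B (Suc (Suc m)) n x =
     (map_mat \<iota> (fuse_F q B (m + 1)) \<otimes>\<^sub>m 1\<^sub>m (n + 1))
     * act13 2 (m + 2) (n + 1) (R_half \<iota> q s B n (x * \<iota> (inverse s ^ (m + 1))))
     * (1\<^sub>m 2 \<otimes>\<^sub>m R_fused \<iota> q s B (Suc m) n (x * \<iota> s))
     * (map_mat \<iota> (fuse_E q B (m + 1)) \<otimes>\<^sub>m 1\<^sub>m (n + 1))"


section \<open>The free algebra on the generators\<close>

text \<open>\<open>gW_neg k\<close>, \<open>gW_pos k\<close>, \<open>gG k\<close>, \<open>gG_tilde k\<close> are \<open>W\<^bsub>-k\<^esub>\<close>, \<open>W\<^bsub>k+1\<^esub>\<close>, \<open>G\<^bsub>k+1\<^esub>\<close> and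
  \<open>G\<close>-tilde\<open>\<^bsub>k+1\<^esub>\<close>.\<close>

datatype generator = gW_neg nat | gW_pos nat | gG nat | gG_tilde nat

text \<open>Words under concatenation, written additively so that \<open>'g word \<Rightarrow>\<^sub>0 complex\<close> with the
  convolution product of the library is the free unital algebra.\<close>

datatype 'g word = Word "'g list"

instantiation word :: (type) monoid_add
begin

definition zero_word :: "'a word" where
  "zero_word = Word []"

fun plus_word :: "'a word \<Rightarrow> 'a word \<Rightarrow> 'a word" where
  "plus_word (Word xs) (Word ys) = Word (xs @ ys)"

instance
proof
  fix a b c :: "'a word"
  show "a + b + c = a + (b + c)" by (cases a; cases b; cases c) simp
  show "0 + a = a" by (cases a) (simp add: zero_word_def)
  show "a + 0 = a" by (cases a) (simp add: zero_word_def)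
qed

end

type_synonym free_alg = "generator word \<Rightarrow>\<^sub>0 complex"

definition scal :: "complex \<Rightarrow> free_alg" where
  "scal c = Poly_Mapping.single 0 c"

definition gen :: "generator \<Rightarrow> free_alg" where
  "gen g = Poly_Mapping.single (Word [g]) 1"


section \<open>K-operators\<close>

definition U_fun :: "complex \<Rightarrow> complex fls" where
  "U_fun q = (fls_const q * fls_X_inv ^ 2 + fls_const (inverse q) * inverse fls_X_inv ^ 2)
             / fls_const (q + inverse q)"

text \<open>The series \<open>\<Sum>k\<ge>0. g\<^sub>k U\<^sup>-\<^sup>k\<^sup>-\<^sup>1\<close>, with \<open>U\<^sup>-\<^sup>1\<close> expanded in powers of \<open>u\<^sup>-\<^sup>1\<close>. As \<open>U\<^sup>-\<^sup>k\<^sup>-\<^sup>1\<close> starts at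
  \<open>u\<^sup>-\<^sup>2\<^sup>k\<^sup>-\<^sup>2\<close>, only summands with \<open>k \<le> n\<close> contribute to the coefficient of \<open>u\<^sup>-\<^sup>n\<close>.\<close>

definition gen_series :: "complex \<Rightarrow> (nat \<Rightarrow> generator) \<Rightarrow> free_alg fls" where
  "gen_series q g =
     Abs_fls (\<lambda>n. \<Sum>k\<le>nat n. gen (g k) * scal (fls_nth (inverse (U_fun q) ^ (k + 1)) n))"

lemma fls_nth_gen_series:
  "fls_nth (gen_series q g) n =
     (\<Sum>k\<le>nat n. gen (g k) * scal (fls_nth (inverse (U_fun q) ^ (k + 1)) n))"
  unfolding gen_series_def
  by (rule nth_Abs_fls_lower_bound[of "min 0 (fls_subdegree (inverse (U_fun q)))"])
     (simp add: scal_def)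

text \<open>The substitution \<open>u \<mapsto> c u\<close>, and the inclusion of the scalar series.\<close>

definition rescale :: "complex \<Rightarrow> free_alg fls \<Rightarrow> free_alg fls" where
  "rescale c f = Abs_fls (\<lambda>n. scal (c powi (- n)) * fls_nth f n)"

lemma fls_nth_rescale: "fls_nth (rescale c f) n = scal (c powi (- n)) * fls_nth f n"
  unfolding rescale_def
  by (rule nth_Abs_fls_lower_bound[of "fls_subdegree f"]) simp

definition scal_series :: "complex fls \<Rightarrow> free_alg fls" where
  "scal_series = fls_map scal"

definition K_fund :: "complex \<Rightarrow> complex \<Rightarrow> complex \<Rightarrow> free_alg fls mat" where
  "K_fund q kp km =
     (let Wp = gen_series q gW_neg; Wm = gen_series q gW_pos;
          Gp = gen_series q gG; Gm = gen_series q gG_tilde;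
          x = scal_series (fls_X_inv * fls_const q);
          y = scal_series (inverse (fls_X_inv * fls_const q));
          const = (\<lambda>c. scal_series (fls_const c))
      in mat_of_rows_list 2
        [[x * Wp - y * Wm,
          const (1 / (km * (q + inverse q))) * Gp + const (kp * (q + inverse q) / (q - inverse q))],
         [const (1 / (kp * (q + inverse q))) * Gm + const (km * (q + inverse q) / (q - inverse q)),
          x * Wm - y * Wp]])"

text \<open>\<open>K_fused q s B kp km n\<close> is the K-operator of spin \<open>n/2\<close>; the recursive clause is the fusion
  with \<open>2j = n + 1\<close>.\<close>

fun K_fused ::
  "complex \<Rightarrow> complex \<Rightarrow> (nat \<Rightarrow> nat \<Rightarrow> complex) \<Rightarrow> complex \<Rightarrow> complex \<Rightarrow> nat \<Rightarrow> free_alg fls mat"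
where
  "K_fused q s B kp km 0 = 1\<^sub>m 1"
| "K_fused q s B kp km (Suc 0) = K_fund q kp km"
| "K_fused q s B kp km (Suc (Suc n)) =
     map_mat (scal_series \<circ> fls_const) (fuse_F q B (n + 1))
     * (map_mat (rescale (inverse s ^ (n + 1))) (K_fund q kp km) \<otimes>\<^sub>m 1\<^sub>m (n + 2))
     * map_mat scal_series
         (R_half fls_const q s B (Suc n) (fls_X_inv ^ 2 * fls_const (inverse s ^ n)))
     * (1\<^sub>m 2 \<otimes>\<^sub>m map_mat (rescale s) (K_fused q s B kp km (Suc n)))
     * map_mat (scal_series \<circ> fls_const) (fuse_E q B (n + 1))"


section \<open>Two formal variables\<close>

text \<open>Identities in \<open>u\<^sub>1, u\<^sub>2\<close> are stated in the iterated Laurent series, the outer variable being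
  \<open>u\<^sub>1\<^sup>-\<^sup>1\<close> and the inner one \<open>u\<^sub>2\<^sup>-\<^sup>1\<close>.\<close>

definition var1 :: "complex fls fls" where
  "var1 = fls_X_inv"

definition var2 :: "complex fls fls" where
  "var2 = fls_const fls_X_inv"

definition in_var1 :: "free_alg fls mat \<Rightarrow> free_alg fls fls mat" where
  "in_var1 = map_mat (fls_map fls_const)"

definition in_var2 :: "free_alg fls mat \<Rightarrow> free_alg fls fls mat" where
  "in_var2 = map_mat fls_const"

definition R_at ::
  "complex \<Rightarrow> complex \<Rightarrow> (nat \<Rightarrow> nat \<Rightarrow> complex) \<Rightarrow> nat \<Rightarrow> nat \<Rightarrow> complex fls fls \<Rightarrow> free_alg fls fls mat"
where
  "R_at q s B m n x =
     map_mat (fls_map scal_series) (R_fused (fls_const \<circ> fls_const) q s B m n x)"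


section \<open>The algebra \<open>A\<^sub>q\<close>\<close>

text \<open>\<open>A\<^sub>q\<close> is the quotient of the free algebra by the two-sided ideal generated by the coefficients
  of the entries of the difference of both sides of the reflection equation for spins \<open>1/2, 1/2\<close>.
  Its elements are the cosets.\<close>

definition Aq_relators :: "complex \<Rightarrow> complex \<Rightarrow> complex \<Rightarrow> free_alg set" where
  "Aq_relators q kp km =
     (let R = (\<lambda>x. map_mat (fls_map scal_series) (R_fund (fls_const \<circ> fls_const) q x));
          K1 = in_var1 (K_fund q kp km) \<otimes>\<^sub>m 1\<^sub>m 2;
          K2 = 1\<^sub>m 2 \<otimes>\<^sub>m in_var2 (K_fund q kp km);
          D = R (var1 / var2) * K1 * R (var1 * var2) * K2 - K2 * R (var1 * var2) * K1 * R (var1 / var2)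
      in {fls_nth (fls_nth (D $$ (i, j)) a) b | i j a b. i < 4 \<and> j < 4})"

definition Aq_ideal :: "complex \<Rightarrow> complex \<Rightarrow> complex \<Rightarrow> free_alg set" where
  "Aq_ideal q kp km = genideal ring_of_type_algebra (Aq_relators q kp km)"

definition Aq :: "complex \<Rightarrow> complex \<Rightarrow> complex \<Rightarrow> free_alg set ring" where
  "Aq q kp km = ring_of_type_algebra Quot Aq_ideal q kp km"

definition to_Aq :: "complex \<Rightarrow> complex \<Rightarrow> complex \<Rightarrow> free_alg \<Rightarrow> free_alg set" where
  "to_Aq q kp km a = Aq_ideal q kp km +>\<^bsub>ring_of_type_algebra\<^esub> a"

lemma ring_free_alg: "ring (ring_of_type_algebra :: free_alg ring)"
proof -
  have "\<exists>y. x + y = 0" for x :: free_alg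
    using add.right_inverse by blast
  then show ?thesis
    unfolding ring_of_type_algebra_def
    by unfold_locales (auto simp: algebra_simps Units_def)
qed

lemma ideal_Aq_ideal: "ideal (Aq_ideal q kp km) ring_of_type_algebra"
  unfolding Aq_ideal_def
  by (rule ring.genideal_ideal[OF ring_free_alg]) (simp add: ring_of_type_algebra_def)

lemma ring_Aq: "ring (Aq q kp km)"
  unfolding Aq_def by (rule ideal.quotient_is_ring[OF ideal_Aq_ideal])

lemma to_Aq_hom: "to_Aq q kp km \<in> Ring.ring_hom ring_of_type_algebra (Aq q kp km)"
  unfolding Aq_def to_Aq_def[abs_def] by (rule ideal.rcos_ring_hom[OF ideal_Aq_ideal])

text \<open>The matrix over the two-variable series with coefficients in \<open>A\<^sub>q\<close>, each entry being given by
  its family of coefficients.\<close>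

definition over_Aq ::
  "complex \<Rightarrow> complex \<Rightarrow> complex \<Rightarrow> free_alg fls fls mat \<Rightarrow> (int \<Rightarrow> int \<Rightarrow> free_alg set) mat"
where
  "over_Aq q kp km = map_mat (\<lambda>f a b. to_Aq q kp km (fls_nth (fls_nth f a) b))"

end

theory Submission
  imports Defs
begin

text \<open>
  All operators are matrices with entries in a ring of Laurent series, and the defining relations hold
  modulo the ideal of series with coefficients in the ideal of relators. The proof is the fusion
  procedure. At the point \<open>q\<^sup>-\<^sup>j\<^sup>-\<^sup>1\<^sup>/\<^sup>2\<close> the R-matrix of spins \<open>1/2, j\<close> degenerates and its kernel is the
  image of the fusing matrix. If a product \<open>P\<close> of R- and K-operators satisfies a Yang-Baxter or reflection
  equation at that point, then \<open>P\<close> maps this image into itself, so that \<open>E F P E = P E\<close> although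
  \<open>E F\<close> is not the identity. All fused operators can therefore be expanded behind \<open>E\<close>, where the equation for
  spins \<open>j + 1/2\<close> becomes a word identity that follows from those for the spins \<open>1/2\<close> and \<open>j\<close>.

  Two facts need the explicit form of the R-matrix of spins \<open>1/2, j\<close>: the description of its kernel, and
  the equality of its two fusions \<open>R\<^sub>1\<^sub>3 R\<^sub>1\<^sub>2\<close> and \<open>R\<^sub>1\<^sub>2 R\<^sub>1\<^sub>3\<close>, both of which occur because \<open>u\<^sub>2\<close>
  enters \<open>R(u\<^sub>1 / u\<^sub>2)\<close> and \<open>R(u\<^sub>1 u\<^sub>2)\<close> with opposite exponents. The fusion of the K-operators uses the
  reflection equation with proportional arguments \<open>u\<^sub>1, u\<^sub>2\<close>; it comes from the defining relations by
  setting the two variables equal.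
\<close>

text \<open>Operators act on functions of all coordinates, so products on different factors need no
  rebracketing. The price is that fusion changes dimensions but not positions: the fused space of
  dimension \<open>n + 2\<close> is spread over two positions of dimensions 1 and
  \<open>n + 2\<close>. Each fusion brings in a fresh auxiliary position, and
  \<open>E_cancel\<close> removes it again, by F E = 1.

  All computations stay in the free algebra, and equality in the quotient is congruence modulo a
  two-sided ideal. A statement about a kernel must then be an exact identity: \<open>w\<close>
  differs from E F w by left multiples of entries of R w (\<open>E_F_complement\<close>), which
  makes sense modulo every ideal. The zero ideal gives the equalities between R-matrices.

  Each fusion shifts spectral parameters by powers of \<open>s\<close>. The inductions therefore
  speak of all multiples c u of a variable at once, and the substitutions u -> c u supply them from
  the defining relations. The square roots in E and F are absorbed by a diagonal change of basis;
  what remains are rational identities checked in finitely many cases.\<close>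

section \<open>Local operators on tensor products\<close>

text \<open>A basis vector of a tensor product is a function \<open>i\<close> giving the number \<open>i p\<close> of the basis vector in
  each position \<open>p\<close>; dimensions are not part of the index.\<close>

type_synonym 'r tensor = "(nat \<Rightarrow> nat) \<Rightarrow> 'r"

text \<open>Entries multiply from the left, so composing operators multiplies matrices in the
  written order also over a noncommutative ring.\<close>

definition op1 :: "nat \<Rightarrow> nat \<Rightarrow> (nat \<Rightarrow> nat \<Rightarrow> 'r::ring_1) \<Rightarrow> 'r tensor \<Rightarrow> 'r tensor" where
  "op1 d p M v = (\<lambda>i. \<Sum>a<d. M (i p) a * v (i(p := a)))"

definition op2 :: "nat \<Rightarrow> nat \<Rightarrow> nat \<Rightarrow> nat \<Rightarrow> (nat \<Rightarrow> nat \<Rightarrow> nat \<Rightarrow> nat \<Rightarrow> 'r::ring_1)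
    \<Rightarrow> 'r tensor \<Rightarrow> 'r tensor" where
  "op2 d e p q M v = (\<lambda>i. \<Sum>a<d. \<Sum>b<e. M (i p) (i q) a b * v (i(p := a, q := b)))"

text \<open>Acting on disjoint positions is not enough: the entries have to commute as well.
  K-operators on different factors violate this, and only operators with central entries are moved
  past others below.\<close>

lemma op2_op2_commute:
  assumes "p \<noteq> r" "p \<noteq> t" "q \<noteq> r" "q \<noteq> t"
    and comm: "\<And>a b a' b' c d c' d'. M a b a' b' * N c d c' d' = N c d c' d' * M a b a' b'"
  shows "op2 d e p q M (op2 d' e' r t N v) = op2 d' e' r t N (op2 d e p q M v)"
proof
  fix i :: "nat \<Rightarrow> nat"
  have upd: "i(p := a, q := b, r := c, t := f) = i(r := c, t := f, p := a, q := b)" for a b c f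
    using assms(1-4) by (auto simp: fun_eq_iff)
  have "op2 d e p q M (op2 d' e' r t N v) i
     = (\<Sum>a<d. \<Sum>b<e. \<Sum>c<d'. \<Sum>f<e'. M (i p) (i q) a b * N (i r) (i t) c f * v (i(p := a, q := b, r := c, t := f)))"
    using assms(1-4) by (simp add: op2_def sum_distrib_left mult.assoc)
  also have "\<dots> = (\<Sum>a<d. \<Sum>c<d'. \<Sum>b<e. \<Sum>f<e'. N (i r) (i t) c f * M (i p) (i q) a b * v (i(r := c, t := f, p := a, q := b)))"
    unfolding upd comm by (intro sum.cong refl sum.swap)
  also have "\<dots> = (\<Sum>c<d'. \<Sum>a<d. \<Sum>f<e'. \<Sum>b<e. N (i r) (i t) c f * M (i p) (i q) a b * v (i(r := c, t := f, p := a, q := b)))"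
    by (subst sum.swap) (intro sum.cong refl sum.swap)
  also have "\<dots> = (\<Sum>c<d'. \<Sum>f<e'. \<Sum>a<d. \<Sum>b<e. N (i r) (i t) c f * M (i p) (i q) a b * v (i(r := c, t := f, p := a, q := b)))"
    by (intro sum.cong refl sum.swap)
  also have "\<dots> = op2 d' e' r t N (op2 d e p q M v) i"
    using assms(1-4) by (simp add: op2_def sum_distrib_left mult.assoc)
  finally show "op2 d e p q M (op2 d' e' r t N v) i = op2 d' e' r t N (op2 d e p q M v) i" .
qed

lemma op1_op2_commute:
  assumes "p \<noteq> r" "p \<noteq> t"
    and comm: "\<And>a a' b c b' c'. M a a' * N b c b' c' = N b c b' c' * M a a'"
  shows "op1 d p M (op2 d' e' r t N v) = op2 d' e' r t N (op1 d p M v)"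
proof
  fix i :: "nat \<Rightarrow> nat"
  have upd: "i(p := a, r := c, t := f) = i(r := c, t := f, p := a)" for a c f
    using assms(1-2) by (auto simp: fun_eq_iff)
  have "op1 d p M (op2 d' e' r t N v) i
     = (\<Sum>a<d. \<Sum>c<d'. \<Sum>f<e'. M (i p) a * N (i r) (i t) c f * v (i(p := a, r := c, t := f)))"
    using assms(1-2) by (simp add: op2_def op1_def sum_distrib_left mult.assoc)
  also have "\<dots> = (\<Sum>c<d'. \<Sum>a<d. \<Sum>f<e'. N (i r) (i t) c f * M (i p) a * v (i(r := c, t := f, p := a)))"
    unfolding upd comm by (rule sum.swap)
  also have "\<dots> = (\<Sum>c<d'. \<Sum>f<e'. \<Sum>a<d. N (i r) (i t) c f * M (i p) a * v (i(r := c, t := f, p := a)))"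
    by (intro sum.cong refl sum.swap)
  also have "\<dots> = op2 d' e' r t N (op1 d p M v) i"
    using assms(1-2) by (simp add: op2_def op1_def sum_distrib_left mult.assoc)
  finally show "op1 d p M (op2 d' e' r t N v) i = op2 d' e' r t N (op1 d p M v) i" .
qed

text \<open>Freezing a coordinate on which the operator does not act. This leads from an arbitrary
  value of an auxiliary coordinate to the value 0, at which the fusion identities hold.\<close>

lemma op2_upd:
  "x \<noteq> p \<Longrightarrow> x \<noteq> q \<Longrightarrow> op2 d e p q M (\<lambda>i. v (i(x := c))) = (\<lambda>i. op2 d e p q M v (i(x := c)))"
  by (auto simp: op2_def fun_eq_iff fun_upd_twist intro!: sum.cong)

lemma op1_upd:
  "x \<noteq> p \<Longrightarrow> op1 d p M (\<lambda>i. v (i(x := c))) = (\<lambda>i. op1 d p M v (i(x := c)))"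
  by (auto simp: op1_def fun_eq_iff fun_upd_twist intro!: sum.cong)

lemma op2_cong:
  assumes "\<And>a b. a < d \<Longrightarrow> b < e \<Longrightarrow> v (i(p := a, q := b)) = w (i(p := a, q := b))"
  shows "op2 d e p q M v i = op2 d e p q M w i"
  unfolding op2_def by (intro sum.cong refl) (simp add: assms)

subsection \<open>Congruence modulo a two-sided ideal\<close>

definition two_sided_ideal :: "'r::ring_1 set \<Rightarrow> bool" where
  "two_sided_ideal J \<longleftrightarrow> 0 \<in> J \<and> (\<forall>x\<in>J. \<forall>y\<in>J. x + y \<in> J) \<and> (\<forall>x\<in>J. \<forall>r. r * x \<in> J \<and> x * r \<in> J)"

lemma two_sided_idealD:
  assumes "two_sided_ideal J"
  shows "0 \<in> J" "x \<in> J \<Longrightarrow> y \<in> J \<Longrightarrow> x + y \<in> J" "x \<in> J \<Longrightarrow> r * x \<in> J" "x \<in> J \<Longrightarrow> x * r \<in> J"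
    "x \<in> J \<Longrightarrow> - x \<in> J" "x \<in> J \<Longrightarrow> y \<in> J \<Longrightarrow> x - y \<in> J"
proof -
  show minus: "x \<in> J \<Longrightarrow> - x \<in> J" for x
    using assms unfolding two_sided_ideal_def by (metis mult_minus1)
  show "x \<in> J \<Longrightarrow> y \<in> J \<Longrightarrow> x - y \<in> J"
    using assms minus unfolding two_sided_ideal_def by (metis uminus_add_conv_diff add.commute)
qed (use assms in \<open>auto simp: two_sided_ideal_def\<close>)

lemma two_sided_ideal_sum:
  assumes "two_sided_ideal J" "\<And>a. a \<in> A \<Longrightarrow> f a \<in> J"
  shows "sum f A \<in> J"
  using assms(2) by (induction A rule: infinite_finite_induct) (auto simp: two_sided_idealD[OF assms(1)])

text \<open>All indices count, also those outside the ranges of the dimensions; hence the support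
  lemmas for the operators below.\<close>

definition vec_cong :: "'r::ring_1 set \<Rightarrow> 'r tensor \<Rightarrow> 'r tensor \<Rightarrow> bool" where
  "vec_cong J v w \<longleftrightarrow> (\<forall>i. v i - w i \<in> J)"

lemma vec_cong_sym: "two_sided_ideal J \<Longrightarrow> vec_cong J v w \<Longrightarrow> vec_cong J w v"
  unfolding vec_cong_def by (metis minus_diff_eq two_sided_idealD(5))

lemma vec_cong_trans: "two_sided_ideal J \<Longrightarrow> vec_cong J u v \<Longrightarrow> vec_cong J v w \<Longrightarrow> vec_cong J u w"
  unfolding vec_cong_def by (metis diff_add_cancel add_diff_eq two_sided_idealD(2))

lemma vec_cong_op2:
  assumes J: "two_sided_ideal J" and "vec_cong J v w"
  shows "vec_cong J (op2 d e p q M v) (op2 d e p q M w)"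
  unfolding vec_cong_def op2_def
proof
  fix i :: "nat \<Rightarrow> nat"
  have "(\<Sum>a<d. \<Sum>b<e. M (i p) (i q) a b * v (i(p := a, q := b)))
      - (\<Sum>a<d. \<Sum>b<e. M (i p) (i q) a b * w (i(p := a, q := b)))
     = (\<Sum>a<d. \<Sum>b<e. M (i p) (i q) a b * (v (i(p := a, q := b)) - w (i(p := a, q := b))))"
    by (simp add: sum_subtractf right_diff_distrib)
  also have "\<dots> \<in> J"
    using assms by (intro two_sided_ideal_sum two_sided_idealD(3)) (auto simp: vec_cong_def)
  finally show "(\<Sum>a<d. \<Sum>b<e. M (i p) (i q) a b * v (i(p := a, q := b)))
      - (\<Sum>a<d. \<Sum>b<e. M (i p) (i q) a b * w (i(p := a, q := b))) \<in> J" .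
qed

lemma vec_cong_op1:
  assumes J: "two_sided_ideal J" and "vec_cong J v w"
  shows "vec_cong J (op1 d p M v) (op1 d p M w)"
  unfolding vec_cong_def op1_def
proof
  fix i :: "nat \<Rightarrow> nat"
  have "(\<Sum>a<d. M (i p) a * v (i(p := a))) - (\<Sum>a<d. M (i p) a * w (i(p := a)))
     = (\<Sum>a<d. M (i p) a * (v (i(p := a)) - w (i(p := a))))"
    by (simp add: sum_subtractf right_diff_distrib)
  also have "\<dots> \<in> J"
    using assms by (intro two_sided_ideal_sum two_sided_idealD(3)) (auto simp: vec_cong_def)
  finally show "(\<Sum>a<d. M (i p) a * v (i(p := a))) - (\<Sum>a<d. M (i p) a * w (i(p := a))) \<in> J" .
qed


subsection \<open>Matrices as local operators\<close>

definition ker1 :: "nat \<Rightarrow> 'r::ring_1 mat \<Rightarrow> nat \<Rightarrow> nat \<Rightarrow> 'r" where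
  "ker1 d M a a' = (if a < d then M $$ (a, a') else 0)"

text \<open>Source and target may have different second dimensions, \<open>e'\<close> and
  \<open>e\<close>, as for the fusing matrices. Rows out of range are set to 0, so that results of
  operators vanish there.\<close>

definition ker2 :: "nat \<Rightarrow> nat \<Rightarrow> nat \<Rightarrow> 'r::ring_1 mat \<Rightarrow> nat \<Rightarrow> nat \<Rightarrow> nat \<Rightarrow> nat \<Rightarrow> 'r" where
  "ker2 d e e' M a b a' b' = (if a < d \<and> b < e then M $$ (a * e + b, a' * e' + b') else 0)"

definition mat_action :: "'r::ring_1 mat \<Rightarrow> (nat \<Rightarrow> 'r) \<Rightarrow> nat \<Rightarrow> 'r" where
  "mat_action M w r = (\<Sum>c<dim_col M. M $$ (r, c) * w c)"

lemma mat_action_mult: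
  assumes "r < dim_row A" "dim_col A = dim_row B"
  shows "mat_action (A * B) w r = mat_action A (mat_action B w) r"
proof -
  have "mat_action (A * B) w r = (\<Sum>c<dim_col B. \<Sum>k<dim_row B. A $$ (r, k) * B $$ (k, c) * w c)"
    using assms by (simp add: mat_action_def scalar_prod_def sum_distrib_right atLeast0LessThan)
  also have "\<dots> = mat_action A (mat_action B w) r"
    by (subst sum.swap) (simp add: mat_action_def assms(2) sum_distrib_left mult.assoc)
  finally show ?thesis .
qed

section \<open>Lexicographic coordinates\<close>

lemma sum_lessThan_mult:
  fixes f :: "nat \<Rightarrow> 'r::comm_monoid_add"
  shows "(\<Sum>c<d * e. f c) = (\<Sum>a<d. \<Sum>b<e. f (a * e + b))"
proof -
  have "(\<Sum>b<e. f (a * e + b)) = sum f {a * e..<a * e + e}" for a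
    using sum.shift_bounds_nat_ivl[of f 0 "a * e" e] by (simp add: add.commute atLeast0LessThan)
  then show ?thesis by (simp add: sum.nat_group)
qed

lemma digit_less: "a * e + b < d * e" if "a < d" "b < e" for a b d e :: nat
proof -
  have "a * e + b < Suc a * e" using that by simp
  also have "\<dots> \<le> d * e" using that by (intro mult_right_mono) auto
  finally show ?thesis .
qed

lemma digit_div: "b < e \<Longrightarrow> (a * e + b) div e = a" and digit_mod: "b < e \<Longrightarrow> (a * e + b) mod e = b"
  for a b e :: nat
  by auto

text \<open>A vector \<open>w\<close> with coordinates in the lexicographic order of a matrix agrees with the vector \<open>v\<close> near \<open>i\<close>.\<close>

definition flat2 :: "nat \<Rightarrow> nat \<Rightarrow> nat \<Rightarrow> nat \<Rightarrow> (nat \<Rightarrow> nat) \<Rightarrow> (nat \<Rightarrow> 'r) \<Rightarrow> 'r tensor \<Rightarrow> bool" where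
  "flat2 d e p q i w v \<longleftrightarrow> (\<forall>a<d. \<forall>b<e. w (a * e + b) = v (i(p := a, q := b)))"

definition flat3 :: "nat \<Rightarrow> nat \<Rightarrow> nat \<Rightarrow> nat \<Rightarrow> nat \<Rightarrow> nat \<Rightarrow> (nat \<Rightarrow> nat) \<Rightarrow> (nat \<Rightarrow> 'r)
    \<Rightarrow> 'r tensor \<Rightarrow> bool" where
  "flat3 d e f p q r i w v \<longleftrightarrow>
     (\<forall>a<d. \<forall>b<e. \<forall>c<f. w ((a * e + b) * f + c) = v (i(p := a, q := b, r := c)))"

lemma flat2_exists: "\<exists>w. flat2 d e p q i w v"
  by (rule exI[of _ "\<lambda>c. v (i(p := c div e, q := c mod e))"]) (auto simp: flat2_def)

lemma flat2_mat:
  assumes "M \<in> carrier_mat (d * e) (d' * e')" "p \<noteq> q" "flat2 d' e' p q i w v"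
  shows "flat2 d e p q i (mat_action M w) (op2 d' e' p q (ker2 d e e' M) v)"
  using assms unfolding flat2_def
  by (auto simp: mat_action_def op2_def ker2_def sum_lessThan_mult fun_upd_twist intro!: sum.cong)

lemma flat2_tensor_left:
  assumes "M \<in> carrier_mat d d" "p \<noteq> q" "flat2 d e p q i w v"
  shows "flat2 d e p q i (mat_action (M \<otimes>\<^sub>m 1\<^sub>m e) w) (op1 d p (ker1 d M) v)"
proof -
  have "mat_action (M \<otimes>\<^sub>m 1\<^sub>m e) w (a * e + b) = op1 d p (ker1 d M) v (i(p := a, q := b))"
    if ab: "a < d" "b < e" for a b
  proof -
    have "mat_action (M \<otimes>\<^sub>m 1\<^sub>m e) w (a * e + b)
       = (\<Sum>a'<d. \<Sum>b'<e. M $$ (a, a') * (if b = b' then 1 else 0) * w (a' * e + b'))"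
      using assms(1) ab
      by (auto simp: mat_action_def sum_lessThan_mult tensor_mat_def digit_less intro!: sum.cong)
    also have "\<dots> = (\<Sum>a'<d. \<Sum>b'<e. if b = b' then M $$ (a, a') * v (i(p := a', q := b)) else 0)"
      using assms(3) by (intro sum.cong refl) (auto simp: flat2_def)
    also have "\<dots> = op1 d p (ker1 d M) v (i(p := a, q := b))"
      using ab assms(2) by (simp add: op1_def ker1_def fun_upd_twist)
    finally show ?thesis .
  qed
  then show ?thesis by (simp add: flat2_def)
qed

lemma flat2_tensor_right:
  assumes "M \<in> carrier_mat e e" "p \<noteq> q" "flat2 d e p q i w v"
  shows "flat2 d e p q i (mat_action (1\<^sub>m d \<otimes>\<^sub>m M) w) (op1 e q (ker1 e M) v)"
proof -
  have "mat_action (1\<^sub>m d \<otimes>\<^sub>m M) w (a * e + b) = op1 e q (ker1 e M) v (i(p := a, q := b))"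
    if ab: "a < d" "b < e" for a b
  proof -
    have "mat_action (1\<^sub>m d \<otimes>\<^sub>m M) w (a * e + b)
       = (\<Sum>a'<d. \<Sum>b'<e. (if a = a' then 1 else 0) * M $$ (b, b') * w (a' * e + b'))"
      using assms(1) ab
      by (auto simp: mat_action_def sum_lessThan_mult tensor_mat_def digit_less intro!: sum.cong)
    also have "\<dots> = (\<Sum>a'<d. if a = a' then (\<Sum>b'<e. M $$ (b, b') * v (i(p := a, q := b'))) else 0)"
      using assms(3) by (intro sum.cong refl) (auto simp: flat2_def)
    also have "\<dots> = op1 e q (ker1 e M) v (i(p := a, q := b))"
      using ab assms(2) by (simp add: op1_def ker1_def)
    finally show ?thesis .
  qed
  then show ?thesis by (simp add: flat2_def)
qed

text \<open>Chaining lemmas of this shape turns a product of matrices into a composition of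
  operators without computing the product. Dimensions may change on the way.\<close>

lemma flat3_tensor_right:
  assumes "M \<in> carrier_mat (e * f) (e' * f')" "p \<noteq> q" "p \<noteq> r" "q \<noteq> r" "flat3 d e' f' p q r i w v"
  shows "flat3 d e f p q r i (mat_action (1\<^sub>m d \<otimes>\<^sub>m M) w) (op2 e' f' q r (ker2 e f f' M) v)"
proof -
  have "mat_action (1\<^sub>m d \<otimes>\<^sub>m M) w ((a * e + b) * f + c) = op2 e' f' q r (ker2 e f f' M) v (i(p := a, q := b, r := c))"
    if ab: "a < d" "b < e" "c < f" for a b c
  proof -
    have r: "(a * e + b) * f + c = a * (e * f) + (b * f + c)" "b * f + c < e * f" "a * (e * f) + (b * f + c) < d * (e * f)"
      using ab digit_less[of b e c f] digit_less[of a d "b * f + c" "e * f"] by (auto simp: algebra_simps)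
    have "mat_action (1\<^sub>m d \<otimes>\<^sub>m M) w ((a * e + b) * f + c)
       = (\<Sum>a'<d. \<Sum>x<e' * f'. (if a = a' then 1 else 0) * M $$ (b * f + c, x) * w (a' * (e' * f') + x))"
      unfolding r(1) using assms(1) ab r(2,3)
      by (auto simp: mat_action_def sum_lessThan_mult[of _ d] tensor_mat_def digit_less
          digit_div digit_mod simp del: div_mult_self1 div_mult_self2 div_mult_self3 div_mult_self4 intro!: sum.cong)
    also have "\<dots> = (\<Sum>a'<d. if a = a' then (\<Sum>x<e' * f'. M $$ (b * f + c, x) * w (a * (e' * f') + x)) else 0)"
      by (intro sum.cong refl) auto
    also have "\<dots> = (\<Sum>b'<e'. \<Sum>c'<f'. M $$ (b * f + c, b' * f' + c') * w ((a * e' + b') * f' + c'))"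
      using ab by (simp add: sum_lessThan_mult[of _ e'] algebra_simps)
    also have "\<dots> = (\<Sum>b'<e'. \<Sum>c'<f'. M $$ (b * f + c, b' * f' + c') * v (i(p := a, q := b', r := c')))"
      using assms(5) ab by (intro sum.cong refl) (auto simp: flat3_def)
    also have "\<dots> = op2 e' f' q r (ker2 e f f' M) v (i(p := a, q := b, r := c))"
      using ab assms(2-4) by (simp add: op2_def ker2_def fun_upd_twist)
    finally show ?thesis .
  qed
  then show ?thesis by (simp add: flat3_def)
qed

lemma flat3_tensor_left:
  assumes "M \<in> carrier_mat (d * e) (d' * e')" "p \<noteq> q" "p \<noteq> r" "q \<noteq> r" "flat3 d' e' f p q r i w v"
  shows "flat3 d e f p q r i (mat_action (M \<otimes>\<^sub>m 1\<^sub>m f) w) (op2 d' e' p q (ker2 d e e' M) v)"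
proof -
  have "mat_action (M \<otimes>\<^sub>m 1\<^sub>m f) w ((a * e + b) * f + c) = op2 d' e' p q (ker2 d e e' M) v (i(p := a, q := b, r := c))"
    if ab: "a < d" "b < e" "c < f" for a b c
  proof -
    have r: "a * e + b < d * e" using ab digit_less by simp
    have upd: "i(p := a', q := b', r := c) = i(r := c, p := a', q := b')" for a' b'
      using assms(2-4) by (auto simp: fun_eq_iff)
    have "mat_action (M \<otimes>\<^sub>m 1\<^sub>m f) w ((a * e + b) * f + c)
       = (\<Sum>x<d' * e'. \<Sum>c'<f. M $$ (a * e + b, x) * (if c = c' then 1 else 0) * w (x * f + c'))"
      using assms(1) ab r
      by (auto simp: mat_action_def sum_lessThan_mult[of _ "d' * e'"] tensor_mat_def digit_less intro!: sum.cong)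
    also have "\<dots> = (\<Sum>x<d' * e'. \<Sum>c'<f. if c = c' then M $$ (a * e + b, x) * w (x * f + c) else 0)"
      by (intro sum.cong refl) auto
    also have "\<dots> = (\<Sum>a'<d'. \<Sum>b'<e'. M $$ (a * e + b, a' * e' + b') * w ((a' * e' + b') * f + c))"
      using ab by (simp add: sum_lessThan_mult[of _ d'])
    also have "\<dots> = (\<Sum>a'<d'. \<Sum>b'<e'. M $$ (a * e + b, a' * e' + b') * v (i(p := a', q := b', r := c)))"
      using assms(5) ab by (intro sum.cong refl) (auto simp: flat3_def)
    also have "\<dots> = op2 d' e' p q (ker2 d e e' M) v (i(p := a, q := b, r := c))"
      using ab assms(2-4) by (simp add: op2_def ker2_def upd)
    finally show ?thesis .
  qed
  then show ?thesis by (simp add: flat3_def)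
qed

lemma flat3_act13:
  assumes "M \<in> carrier_mat (d * f) (d * f)" "p \<noteq> q" "p \<noteq> r" "q \<noteq> r" "flat3 d e f p q r i w v"
  shows "flat3 d e f p q r i (mat_action (act13 d e f M) w) (op2 d f p r (ker2 d f f M) v)"
proof -
  have "mat_action (act13 d e f M) w ((a * e + b) * f + c) = op2 d f p r (ker2 d f f M) v (i(p := a, q := b, r := c))"
    if ab: "a < d" "b < e" "c < f" for a b c
  proof -
    have upd: "i(p := a', q := b, r := c') = i(q := b, p := a', r := c')" for a' c'
      using assms(2-4) by (auto simp: fun_eq_iff)
    have r: "(a' * e + b') * f + c' < d * e * f" "((a' * e + b') * f + c') div f = a' * e + b'"
        "((a' * e + b') * f + c') mod f = c'" "((a' * e + b') * f + c') div (e * f) = a'"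
      if "a' < d" "b' < e" "c' < f" for a' b' c'
    proof -
      show "(a' * e + b') * f + c' < d * e * f"
        using that by (intro digit_less)
      show 1: "((a' * e + b') * f + c') div f = a' * e + b'" using that by simp
      show "((a' * e + b') * f + c') mod f = c'" using that by simp
      show "((a' * e + b') * f + c') div (e * f) = a'"
        using that by (subst mult.commute[of e f], subst div_mult2_eq, subst 1) simp
    qed
    have "mat_action (act13 d e f M) w ((a * e + b) * f + c)
       = (\<Sum>a'<d. \<Sum>b'<e. \<Sum>c'<f. (if b = b' then M $$ (a * f + c, a' * f + c') else 0) * w ((a' * e + b') * f + c'))"
      unfolding mat_action_def using ab r[of a b c]
      by (simp add: sum_lessThan_mult[of _ "d * e"] sum_lessThan_mult[of _ d] act13_def)
         (intro sum.cong refl, simp add: r)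
    also have "\<dots> = (\<Sum>a'<d. \<Sum>b'<e. if b = b' then (\<Sum>c'<f. M $$ (a * f + c, a' * f + c') * w ((a' * e + b) * f + c')) else 0)"
      by (intro sum.cong refl) auto
    also have "\<dots> = (\<Sum>a'<d. \<Sum>c'<f. M $$ (a * f + c, a' * f + c') * w ((a' * e + b) * f + c'))"
      using ab by simp
    also have "\<dots> = (\<Sum>a'<d. \<Sum>c'<f. M $$ (a * f + c, a' * f + c') * v (i(p := a', q := b, r := c')))"
      using assms(5) ab by (intro sum.cong refl) (auto simp: flat3_def)
    also have "\<dots> = op2 d f p r (ker2 d f f M) v (i(p := a, q := b, r := c))"
      using ab assms(2-4) by (simp add: op2_def ker2_def upd)
    finally show ?thesis .
  qed
  then show ?thesis by (simp add: flat3_def)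
qed

section \<open>R-matrices as local operators\<close>

lemma map_mat_tensor:
  assumes "semiring_hom h"
  shows "map_mat h (A \<otimes>\<^sub>m B) = map_mat h A \<otimes>\<^sub>m map_mat h B"
proof -
  interpret semiring_hom h by fact
  have "r div b < a" "r mod b < b" if "r < a * b" for r a b :: nat
    using that by (auto simp: less_mult_imp_div_less) (metis mod_less_divisor mult_is_0 neq0_conv not_less0)
  then show ?thesis
    by (intro eq_matI) (auto simp: tensor_mat_def hom_distribs)
qed

lemma map_mat_act13:
  assumes "semiring_hom h" "M \<in> carrier_mat (a * d) (a * d)"
  shows "map_mat h (act13 a b d M) = act13 a b d (map_mat h M)"
proof -
  interpret semiring_hom h by fact
  have "r div (b * d) * d + r mod d < a * d" if "r < a * b * d" for r :: nat
  proof (intro digit_less)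
    show "r div (b * d) < a" using that by (intro less_mult_imp_div_less) (simp add: mult.assoc)
    show "r mod d < d" using that by (cases "d = 0") auto
  qed
  then show ?thesis using assms(2)
    by (intro eq_matI) (auto simp: act13_def)
qed

lemma dim_tensor_mat [simp]:
  "dim_row (A \<otimes>\<^sub>m B) = dim_row A * dim_row B" "dim_col (A \<otimes>\<^sub>m B) = dim_col A * dim_col B"
  by (auto simp: tensor_mat_def)

lemma tensor_mat_carrier [intro]:
  "A \<in> carrier_mat a b \<Longrightarrow> B \<in> carrier_mat c d \<Longrightarrow> A \<otimes>\<^sub>m B \<in> carrier_mat (a * c) (b * d)"
  by auto

lemma fuse_E_carrier: "fuse_E q B n \<in> carrier_mat (2 * (n + 1)) (n + 2)"
  by (auto simp: fuse_E_def Let_def)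

lemma fuse_F_carrier: "fuse_F q B n \<in> carrier_mat (n + 2) (2 * (n + 1))"
  by (auto simp: fuse_F_def Let_def)

lemma R_fund_carrier: "R_fund \<iota> q x \<in> carrier_mat 4 4"
  by (auto simp: R_fund_def mat_of_rows_list_def)

lemma R_half_carrier: "R_half \<iota> q s B n x \<in> carrier_mat (2 * (n + 1)) (2 * (n + 1))"
proof (induction \<iota> q s B n x rule: R_half.induct)
  case (3 \<iota> q s B n x)
  show ?case
    by (auto simp: fuse_F_def fuse_E_def Let_def intro!: carrier_matI)
qed (auto simp: R_fund_def mat_of_rows_list_def)

lemma R_fused_carrier: "R_fused \<iota> q s B m n x \<in> carrier_mat ((m + 1) * (n + 1)) ((m + 1) * (n + 1))"
proof (induction \<iota> q s B m n x rule: R_fused.induct)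
  case (3 \<iota> q s B m n x)
  show ?case
    by (auto simp: fuse_F_def fuse_E_def Let_def intro!: carrier_matI)
next
  case (2 \<iota> q s B n x)
  show ?case using R_half_carrier[of \<iota> q s B n x] by (simp add: mult_2)
qed auto

text \<open>The field of scalar functions contains the complex numbers via \<open>\<iota>\<close> and is mapped to the centre of
  the ring of coefficients by \<open>\<sigma>\<close>.\<close>

locale fusion =
  fixes \<iota> :: "complex \<Rightarrow> 'b::field" and \<sigma> :: "'b \<Rightarrow> 'r::ring_1"
    and q s :: complex and B :: "nat \<Rightarrow> nat \<Rightarrow> complex"
  assumes \<iota>: "field_hom \<iota>" and \<sigma>: "semiring_hom \<sigma>"
    and central: "\<sigma> x * y = y * \<sigma> x"
    and q_nz: "q \<noteq> 0" and q_root: "\<And>n. n > 0 \<Longrightarrow> q ^ n \<noteq> 1"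
    and s_sq: "s\<^sup>2 = q" and root_choice: "root_choice q B"
begin

sublocale \<iota>: field_hom \<iota> by (rule \<iota>)
sublocale \<sigma>: semiring_hom \<sigma> by (rule \<sigma>)

definition S :: 'b where "S = \<iota> s"

lemma s_nz: "s \<noteq> 0" using s_sq q_nz by auto
lemma S_nz: "S \<noteq> 0" by (simp add: S_def s_nz)
lemma \<iota>_q: "\<iota> q = S\<^sup>2" by (simp add: S_def s_sq[symmetric] \<iota>.hom_power)

definition E :: "nat \<Rightarrow> nat \<Rightarrow> nat \<Rightarrow> 'r tensor \<Rightarrow> 'r tensor" where
  "E n p t = op2 1 (n + 2) p t (ker2 2 (n + 1) (n + 2) (map_mat (\<sigma> \<circ> \<iota>) (fuse_E q B n)))"

definition F :: "nat \<Rightarrow> nat \<Rightarrow> nat \<Rightarrow> 'r tensor \<Rightarrow> 'r tensor" where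
  "F n p t = op2 2 (n + 1) p t (ker2 1 (n + 2) (n + 1) (map_mat (\<sigma> \<circ> \<iota>) (fuse_F q B n)))"

definition R :: "nat \<Rightarrow> nat \<Rightarrow> nat \<Rightarrow> nat \<Rightarrow> 'b \<Rightarrow> 'r tensor \<Rightarrow> 'r tensor" where
  "R m n p t x = op2 (m + 1) (n + 1) p t (ker2 (m + 1) (n + 1) (n + 1) (map_mat \<sigma> (R_fused \<iota> q s B m n x)))"

lemma map_mat_\<sigma>\<iota>: "map_mat \<sigma> (map_mat \<iota> M) = map_mat (\<sigma> \<circ> \<iota>) M"
  by (intro eq_matI) auto

text \<open>A fused tensor factor occupies the two positions \<open>p, t\<close> with dimensions \<open>1\<close> and \<open>n + 2\<close>.\<close>

lemma R_half_fusion: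
  assumes "distinct [r, p, t]" "i p = 0" "n \<ge> 1"
  shows "R 1 (n + 1) r t x v i = F n p t (R 1 n r t (x / S) (R 1 1 r p (x * S ^ n) (E n p t v))) i"
proof -
  from \<open>n \<ge> 1\<close> obtain m where m: "n = Suc m" by (cases n) auto
  obtain w where w: "flat2 2 (n + 2) r t i w v" using flat2_exists by blast
  let ?R = "R_half \<iota> q s B (n + 1) x"
  let ?A = "1\<^sub>m 2 \<otimes>\<^sub>m map_mat (\<sigma> \<circ> \<iota>) (fuse_F q B n)"
  let ?B = "act13 2 2 (n + 1) (map_mat \<sigma> (R_half \<iota> q s B n (x / S)))"
  let ?C = "map_mat \<sigma> (R_fund \<iota> q (x * S ^ n)) \<otimes>\<^sub>m 1\<^sub>m (n + 1)"
  let ?D = "1\<^sub>m 2 \<otimes>\<^sub>m map_mat (\<sigma> \<circ> \<iota>) (fuse_E q B n)"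
  have carr: "1\<^sub>m 2 \<otimes>\<^sub>m map_mat \<iota> (fuse_F q B n) \<in> carrier_mat (2 * (n + 2)) (2 * 2 * (n + 1))"
      "1\<^sub>m 2 \<otimes>\<^sub>m map_mat \<iota> (fuse_E q B n) \<in> carrier_mat (2 * 2 * (n + 1)) (2 * (n + 2))"
      "R_fund \<iota> q y \<otimes>\<^sub>m 1\<^sub>m (n + 1) \<in> carrier_mat (2 * 2 * (n + 1)) (2 * 2 * (n + 1))"
      "act13 2 2 (n + 1) M \<in> carrier_mat (2 * 2 * (n + 1)) (2 * 2 * (n + 1))" for y M
    using fuse_F_carrier[of q B n] fuse_E_carrier[of q B n] R_fund_carrier[of \<iota> q y] by (auto simp: act13_def)
  have R: "?R = (1\<^sub>m 2 \<otimes>\<^sub>m map_mat \<iota> (fuse_F q B n)) * act13 2 2 (n + 1) (R_half \<iota> q s B n (x / S))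
     * (R_fund \<iota> q (x * S ^ n) \<otimes>\<^sub>m 1\<^sub>m (n + 1)) * (1\<^sub>m 2 \<otimes>\<^sub>m map_mat \<iota> (fuse_E q B n))"
    by (simp add: m S_def \<iota>.hom_power \<iota>.hom_inverse divide_inverse \<iota>.hom_mult)
  have \<sigma>R: "map_mat \<sigma> ?R = ?A * ?B * ?C * ?D"
    unfolding R
    apply (subst \<sigma>.mat_hom_mult[OF _ carr(2)], (rule mult_carrier_mat carr)+)
    apply (subst \<sigma>.mat_hom_mult[OF _ carr(3)], (rule mult_carrier_mat carr)+)
    apply (subst \<sigma>.mat_hom_mult[OF carr(1) carr(4)])
    apply (simp add: map_mat_tensor[OF \<sigma>] \<sigma>.mat_hom_one map_mat_\<sigma>\<iota>)
    apply (use map_mat_act13[OF \<sigma> R_half_carrier[of \<iota> q s B n "x / S"], of 2] in simp)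
    done
  have dims: "dim_col ?A = dim_row ?B" "dim_col ?B = dim_row ?C" "dim_col ?C = dim_row ?D" "dim_row ?A = 2 * (n + 2)"
    using fuse_F_carrier[of q B n] fuse_E_carrier[of q B n] R_fund_carrier[of \<iota> q "x * S ^ n"] by (auto simp: act13_def)
  have act: "mat_action (map_mat \<sigma> ?R) w c = mat_action ?A (mat_action ?B (mat_action ?C (mat_action ?D w))) c"
    if "c < 2 * (n + 2)" for c
    unfolding \<sigma>R using that dims by (simp add: mat_action_mult)
  \<comment> \<open>Position \<open>p\<close> has dimension 1 and \<open>i p = 0\<close>, so
    coordinates for two factors are also coordinates for three.\<close>
  have w3: "flat3 2 1 (n + 2) r p t i w v"
    using w assms(1,2) by (auto simp: flat2_def flat3_def fun_upd_twist fun_upd_idem)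
  have neq: "r \<noteq> p" "r \<noteq> t" "p \<noteq> t" using assms(1) by auto
  note flat = flat3_tensor_right[OF _ neq, of "map_mat (\<sigma> \<circ> \<iota>) (fuse_E q B n)" 2 "n + 1" 1 "n + 2"]
    flat3_tensor_left[OF _ neq, of "map_mat \<sigma> (R_fund \<iota> q (x * S ^ n))" 2 2 2 2 "n + 1"]
    flat3_act13[OF _ neq, of "map_mat \<sigma> (R_half \<iota> q s B n (x / S))" 2 "n + 1" 2]
    flat3_tensor_right[OF _ neq, of "map_mat (\<sigma> \<circ> \<iota>) (fuse_F q B n)" 1 "n + 2" 2 "n + 1"]
  have "flat3 2 1 (n + 2) r p t i (mat_action ?A (mat_action ?B (mat_action ?C (mat_action ?D w))))
      (F n p t (R 1 n r t (x / S) (R 1 1 r p (x * S ^ n) (E n p t v))))"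
    using flat(4)[OF _ flat(3)[OF _ flat(2)[OF _ flat(1)[OF _ w3]]]]
      fuse_F_carrier[of q B n] fuse_E_carrier[of q B n] R_half_carrier[of \<iota> q s B 1 "x * S ^ n"]
      R_half_carrier[of \<iota> q s B n "x / S"]
    by (simp add: E_def F_def R_def numeral_2_eq_2)
  moreover have "flat2 2 (n + 2) r t i (mat_action (map_mat \<sigma> ?R) w) (R 1 (n + 1) r t x v)"
    using flat2_mat[OF _ neq(2) w, of "map_mat \<sigma> ?R" 2 "n + 2"] R_half_carrier[of \<iota> q s B "n + 1" x]
    by (simp add: R_def numeral_2_eq_2)
  ultimately have eq: "R 1 (n + 1) r t x v i = F n p t (R 1 n r t (x / S) (R 1 1 r p (x * S ^ n) (E n p t v))) i"
    if "i r < 2" "i t < n + 2"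
    using that act[of "i r * (n + 2) + i t"] digit_less[of "i r" 2 "i t" "n + 2"] assms(2)
    by (fastforce simp: flat2_def flat3_def fun_upd_idem)
  show ?thesis
  proof (cases "i r < 2 \<and> i t < n + 2")
    case False
    then show ?thesis using neq by (auto simp: R_def F_def op2_def ker2_def)
  qed (use eq in auto)
qed

text \<open>The left side does not touch the auxiliary position \<open>p\<close>, while the right
  side passes through it. They can agree only at the single index 0 of a space of dimension
  1.\<close>

lemma R_fused_fusion:
  assumes "distinct [p, t, r]" "i p = 0" "m \<ge> 1"
  shows "R (m + 1) n t r x v i = F m p t (R 1 n p r (x / S ^ m) (R m n t r (x * S) (E m p t v))) i"
proof -
  from \<open>m \<ge> 1\<close> obtain l where l: "m = Suc l" by (cases m) auto
  obtain w where w: "flat2 (m + 2) (n + 1) t r i w v" using flat2_exists by blast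
  let ?R = "R_fused \<iota> q s B (m + 1) n x"
  let ?A = "map_mat (\<sigma> \<circ> \<iota>) (fuse_F q B m) \<otimes>\<^sub>m 1\<^sub>m (n + 1)"
  let ?B = "act13 2 (m + 1) (n + 1) (map_mat \<sigma> (R_half \<iota> q s B n (x / S ^ m)))"
  let ?C = "1\<^sub>m 2 \<otimes>\<^sub>m map_mat \<sigma> (R_fused \<iota> q s B m n (x * S))"
  let ?D = "map_mat (\<sigma> \<circ> \<iota>) (fuse_E q B m) \<otimes>\<^sub>m 1\<^sub>m (n + 1)"
  have carr: "map_mat \<iota> (fuse_F q B m) \<otimes>\<^sub>m 1\<^sub>m (n + 1) \<in> carrier_mat ((m + 2) * (n + 1)) (2 * (m + 1) * (n + 1))"
      "map_mat \<iota> (fuse_E q B m) \<otimes>\<^sub>m 1\<^sub>m (n + 1) \<in> carrier_mat (2 * (m + 1) * (n + 1)) ((m + 2) * (n + 1))"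
      "1\<^sub>m 2 \<otimes>\<^sub>m R_fused \<iota> q s B m n y \<in> carrier_mat (2 * (m + 1) * (n + 1)) (2 * (m + 1) * (n + 1))"
      "act13 2 (m + 1) (n + 1) M \<in> carrier_mat (2 * (m + 1) * (n + 1)) (2 * (m + 1) * (n + 1))" for y M
    using fuse_F_carrier[of q B m] fuse_E_carrier[of q B m] R_fused_carrier[of \<iota> q s B m n y]
    by (auto simp: act13_def algebra_simps)
  have R: "?R = (map_mat \<iota> (fuse_F q B m) \<otimes>\<^sub>m 1\<^sub>m (n + 1)) * act13 2 (m + 1) (n + 1) (R_half \<iota> q s B n (x / S ^ m))
     * (1\<^sub>m 2 \<otimes>\<^sub>m R_fused \<iota> q s B m n (x * S)) * (map_mat \<iota> (fuse_E q B m) \<otimes>\<^sub>m 1\<^sub>m (n + 1))"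
    by (simp add: l S_def \<iota>.hom_power \<iota>.hom_inverse divide_inverse power_inverse \<iota>.hom_mult)
  have \<sigma>R: "map_mat \<sigma> ?R = ?A * ?B * ?C * ?D"
    unfolding R
    apply (subst \<sigma>.mat_hom_mult[OF _ carr(2)], (rule mult_carrier_mat carr)+)
    apply (subst \<sigma>.mat_hom_mult[OF _ carr(3)], (rule mult_carrier_mat carr)+)
    apply (subst \<sigma>.mat_hom_mult[OF carr(1) carr(4)])
    apply (simp add: map_mat_tensor[OF \<sigma>] \<sigma>.mat_hom_one map_mat_\<sigma>\<iota>)
    apply (use map_mat_act13[OF \<sigma> R_half_carrier[of \<iota> q s B n "x / S ^ m"], of "m + 1"] in simp)
    done
  have dims: "dim_col ?A = dim_row ?B" "dim_col ?B = dim_row ?C" "dim_col ?C = dim_row ?D"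
      "dim_row ?A = (m + 2) * (n + 1)"
    using fuse_F_carrier[of q B m] fuse_E_carrier[of q B m] R_fused_carrier[of \<iota> q s B m n "x * S"]
    by (auto simp: act13_def algebra_simps)
  have act: "mat_action (map_mat \<sigma> ?R) w c = mat_action ?A (mat_action ?B (mat_action ?C (mat_action ?D w))) c"
    if "c < (m + 2) * (n + 1)" for c
    unfolding \<sigma>R using that dims by (simp add: mat_action_mult)
  have w3: "flat3 1 (m + 2) (n + 1) p t r i w v"
    using w assms(1,2) by (auto simp: flat2_def flat3_def fun_upd_twist fun_upd_idem)
  have neq: "p \<noteq> t" "p \<noteq> r" "t \<noteq> r" using assms(1) by auto
  note flat = flat3_tensor_left[OF _ neq, of "map_mat (\<sigma> \<circ> \<iota>) (fuse_E q B m)" 2 "m + 1" 1 "m + 2"]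
    flat3_tensor_right[OF _ neq, of "map_mat \<sigma> (R_fused \<iota> q s B m n (x * S))" "m + 1" "n + 1" "m + 1" "n + 1"]
    flat3_act13[OF _ neq, of "map_mat \<sigma> (R_half \<iota> q s B n (x / S ^ m))" 2 "n + 1" "m + 1"]
    flat3_tensor_left[OF _ neq, of "map_mat (\<sigma> \<circ> \<iota>) (fuse_F q B m)" 1 "m + 2" 2 "m + 1"]
  have "flat3 1 (m + 2) (n + 1) p t r i (mat_action ?A (mat_action ?B (mat_action ?C (mat_action ?D w))))
      (F m p t (R 1 n p r (x / S ^ m) (R m n t r (x * S) (E m p t v))))"
    using flat(4)[OF _ flat(3)[OF _ flat(2)[OF _ flat(1)[OF _ w3]]]]
      fuse_F_carrier[of q B m] fuse_E_carrier[of q B m] R_fused_carrier[of \<iota> q s B m n "x * S"]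
      R_half_carrier[of \<iota> q s B n "x / S ^ m"]
    by (simp add: E_def F_def R_def numeral_2_eq_2)
  moreover have "flat2 (m + 2) (n + 1) t r i (mat_action (map_mat \<sigma> ?R) w) (R (m + 1) n t r x v)"
    using flat2_mat[OF _ neq(3) w, of "map_mat \<sigma> ?R" "m + 2" "n + 1"] R_fused_carrier[of \<iota> q s B "m + 1" n x]
    by (simp add: R_def)
  ultimately have eq: "R (m + 1) n t r x v i = F m p t (R 1 n p r (x / S ^ m) (R m n t r (x * S) (E m p t v))) i"
    if "i t < m + 2" "i r < n + 1"
    using that act[of "i t * (n + 1) + i r"] digit_less[of "i t" "m + 2" "i r" "n + 1"] assms(2)
    by (fastforce simp: flat2_def flat3_def fun_upd_idem)
  show ?thesis
  proof (cases "i t < m + 2 \<and> i r < n + 1")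
    case False
    then show ?thesis using neq by (auto simp: R_def F_def op2_def ker2_def)
  qed (use eq in auto)
qed

end

lemma cfun_1 [simp]: "cfun 1 = 0"
  by (simp add: cfun_def)

context fusion
begin

subsection \<open>The fusing matrices in a rescaled basis\<close>

lemma qint_nz: "qint q (Suc n) \<noteq> 0"
proof
  assume "qint q (Suc n) = 0"
  then consider "q ^ Suc n = inverse q ^ Suc n" | "q = inverse q"
    by (auto simp: qint_def)
  then show False
  proof cases
    case 1
    then have "q ^ Suc n * q ^ Suc n = 1" using q_nz by (simp add: field_simps)
    then have "q ^ (Suc n + Suc n) = 1" by (simp only: power_add)
    then show False using q_root[of "Suc n + Suc n"] by simp
  next
    case 2
    then show False using q_nz q_root[of 2] by (simp add: field_simps power2_eq_square)
  qed
qed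

text \<open>The bound is sharp: \<open>B n n\<close> squares to [0] [n + 1] = 0, because lowering
  stops at the last basis vector.\<close>

lemma B_nz: "p < n \<Longrightarrow> B n p \<noteq> 0"
  using root_choice qint_nz[of "n - p - 1"] qint_nz[of p]
  unfolding root_choice_def by (metis Suc_diff_Suc Suc_eq_plus1 diff_diff_left less_imp_le mult_eq_0_iff zero_power2)

text \<open>If the basis of the space of spin \<open>n/2\<close> is rescaled by \<open>dscale n\<close>, the roots disappear: the fusing matrix
  becomes \<open>v(a + b)\<close> for the entry \<open>(a, b)\<close>, and the off-diagonal entries of the R-matrix become
  \<open>q\<^sup>k - q\<^sup>-\<^sup>k\<close>.\<close>

definition dscale :: "nat \<Rightarrow> nat \<Rightarrow> complex" where
  "dscale n k = (\<Prod>j<k. B n j / qint q (j + 1))"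

lemma dscale_nz: "k \<le> n \<Longrightarrow> dscale n k \<noteq> 0"
  using B_nz qint_nz by (auto simp: dscale_def)

lemma dscale_Suc: "dscale n (Suc k) = dscale n k * B n k / qint q (Suc k)"
  by (simp add: dscale_def)

lemma dscale_0 [simp]: "dscale n 0 = 1"
  by (simp add: dscale_def)

lemma qint_1: "qint q (Suc 0) = 1"
proof -
  have "q \<noteq> inverse q" using q_nz q_root[of 2] by (simp add: field_simps power2_eq_square)
  then show ?thesis by (simp add: qint_def)
qed

text \<open>The normalisation \<open>B 1 0 = 1\<close> enters here. The spin 1/2 basis stays as it
  is, which starts the induction for the explicit R-matrix.\<close>

lemma dscale_1: "k \<le> 1 \<Longrightarrow> dscale 1 k = 1"
  using root_choice by (cases k) (auto simp: dscale_Suc qint_1 root_choice_def)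

text \<open>Fusion preserves weights, hence the condition \<open>a + b = k\<close>. The q-integers
  in \<open>dscale\<close> cancel in the upper block and absorb the factor \<open>qint q c\<close>
  in the lower one.\<close>

lemma fuse_E_entry:
  assumes "n \<ge> 1" "a < 2" "b \<le> n" "k \<le> n + 1"
  shows "fuse_E q B n $$ (a * (n + 1) + b, k) = (if a + b = k then dscale n b / dscale (n + 1) k else 0)"
proof -
  have e: "(\<Prod>p<j. B n p / B (n + 1) p) = dscale n j / dscale (n + 1) j" for j
  proof -
    have "(\<Prod>p<j. B n p / B (n + 1) p) = (\<Prod>p<j. (B n p / qint q (p + 1)) / (B (n + 1) p / qint q (p + 1)))"
      using qint_nz by (intro prod.cong) (simp_all del: mult_eq_0_iff)
    then show ?thesis by (simp only: prod_dividef dscale_def)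
  qed
  consider "a = 0" | "a = 1" using assms(2) by linarith
  then show ?thesis
  proof cases
    case 1
    then show ?thesis using assms by (auto simp: fuse_E_def Let_def e[simplified])
  next
    case 2
    then show ?thesis
      using assms dscale_nz[of k "n + 1"] qint_nz[of b] by (auto simp: fuse_E_def Let_def e[simplified] dscale_Suc)
  qed
qed

definition fF :: "nat \<Rightarrow> nat \<Rightarrow> nat \<Rightarrow> complex" where
  "fF n a k = (if a \<le> k \<and> k - a \<le> n then fuse_F q B n $$ (k, a * (n + 1) + (k - a)) else 0)"

lemma fuse_F_entry:
  assumes "n \<ge> 1" "a < 2" "b \<le> n" "k \<le> n + 1"
  shows "fuse_F q B n $$ (k, a * (n + 1) + b) = (if a + b = k then fF n a k else 0)"
proof -
  consider "a = 0" | "a = 1" using assms(2) by linarith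
  then show ?thesis
    using assms by cases (auto simp: fF_def fuse_F_def Let_def)
qed

text \<open>This is F E = 1 in the weight space of index \<open>k\<close>. At both ends that space
  has dimension 1 and the entries are inverse to each other; in between, the diagonal entry of F is
  defined by solving this equation.\<close>

lemma fF_dscale:
  assumes "n \<ge> 1" "k \<le> n + 1"
  shows "(\<Sum>a<2. if a \<le> k \<and> k - a \<le> n then fF n a k * (dscale n (k - a) / dscale (n + 1) k) else 0) = 1"
proof -
  consider "k = 0" | "k = n + 1" | "1 \<le> k" "k \<le> n" using assms(2) by linarith
  then show ?thesis
  proof cases
    case 1
    then show ?thesis using assms by (simp add: numeral_2_eq_2 fF_def fuse_F_def Let_def)
  next
    case 2
    then show ?thesis using assms fuse_E_entry[of n 1 n "n + 1"] dscale_nz[of n n] dscale_nz[of "n + 1" "n + 1"]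
      by (simp add: numeral_2_eq_2 fF_def fuse_F_def Let_def)
  next
    case 3
    then obtain j where j: "k = Suc j" by (cases k) auto
    have E: "fuse_E q B n $$ (k, k) = dscale n k / dscale (n + 1) k"
        "fuse_E q B n $$ (k + n, k) = dscale n (k - 1) / dscale (n + 1) k"
      using fuse_E_entry[of n 0 k k] fuse_E_entry[of n 1 j k] 3 assms(1) by (auto simp: j algebra_simps)
    have "fF n 1 k * fuse_E q B n $$ (k + n, k) + fF n 0 k * fuse_E q B n $$ (k, k) = 1"
    proof -
      have "fuse_E q B n $$ (k, k) \<noteq> 0" using 3 dscale_nz[of k n] dscale_nz[of k "n + 1"] by (simp add: E)
      moreover have "1 * (n + 1) + (k - 1) = k + n" using 3 by simp
      ultimately show ?thesis using 3 by (simp add: fF_def fuse_F_def Let_def del: One_nat_def)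
    qed
    then show ?thesis using 3 by (auto simp add: numeral_2_eq_2 E add.commute)
  qed
qed

lemma E_apply:
  assumes "n \<ge> 1"
  shows "E n p t v i = (if i p < 2 \<and> i t \<le> n
     then \<sigma> (\<iota> (dscale n (i t) / dscale (n + 1) (i p + i t))) * v (i(p := 0, t := i p + i t)) else 0)"
proof (cases "i p < 2 \<and> i t \<le> n")
  case True
  have "i p * (n + 1) + i t < 2 * (n + 1)" using True digit_less[of "i p" 2 "i t" "n + 1"] by simp
  then have "E n p t v i = (\<Sum>k<n + 2. \<sigma> (\<iota> (fuse_E q B n $$ (i p * (n + 1) + i t, k))) * v (i(p := 0, t := k)))"
    unfolding E_def op2_def ker2_def using True fuse_E_carrier[of q B n] by (auto intro!: sum.cong)
  also have "\<dots> = (\<Sum>k<n + 2. if i p + i t = k then \<sigma> (\<iota> (dscale n (i t) / dscale (n + 1) k)) * v (i(p := 0, t := k)) else 0)"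
    using True assms by (intro sum.cong refl) (auto simp: fuse_E_entry[simplified])
  also have "\<dots> = \<sigma> (\<iota> (dscale n (i t) / dscale (n + 1) (i p + i t))) * v (i(p := 0, t := i p + i t))"
    using True by simp
  finally show ?thesis using True by simp
qed (auto simp: E_def op2_def ker2_def)

lemma F_apply:
  assumes "n \<ge> 1"
  shows "F n p t w i = (if i p = 0 \<and> i t \<le> n + 1
     then \<Sum>a<2. if a \<le> i t \<and> i t - a \<le> n then \<sigma> (\<iota> (fF n a (i t))) * w (i(p := a, t := i t - a)) else 0 else 0)"
proof (cases "i p = 0 \<and> i t \<le> n + 1")
  case True
  have "F n p t w i = (\<Sum>a<2. \<Sum>b<n + 1. \<sigma> (\<iota> (fuse_F q B n $$ (i t, a * (n + 1) + b))) * w (i(p := a, t := b)))"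
    unfolding F_def op2_def ker2_def using True fuse_F_carrier[of q B n] digit_less[of _ 2 _ "n + 1"]
    by (auto intro!: sum.cong)
  also have "\<dots> = (\<Sum>a<2. \<Sum>b<n + 1. if a \<le> i t \<and> b = i t - a then \<sigma> (\<iota> (fF n a (i t))) * w (i(p := a, t := i t - a)) else 0)"
    using True assms by (intro sum.cong refl) (auto simp: fuse_F_entry[simplified])
  also have "\<dots> = (\<Sum>a<2. if a \<le> i t \<and> i t - a \<le> n then \<sigma> (\<iota> (fF n a (i t))) * w (i(p := a, t := i t - a)) else 0)"
    by (intro sum.cong refl) auto
  finally show ?thesis using True by simp
qed (auto simp: F_def op2_def ker2_def)

lemma FE_apply:
  assumes "n \<ge> 1" "p \<noteq> t"
  shows "F n p t (E n p t v) i = (if i p = 0 \<and> i t \<le> n + 1 then v i else 0)"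
proof (cases "i p = 0 \<and> i t \<le> n + 1")
  case True
  have v: "v (i(p := 0, t := i t)) = v i" using True by (simp add: fun_upd_idem)
  have "F n p t (E n p t v) i = (\<Sum>a<2. \<sigma> (\<iota> (if a \<le> i t \<and> i t - a \<le> n
      then fF n a (i t) * (dscale n (i t - a) / dscale (n + 1) (i t)) else 0)) * v i)"
    using True assms 
    by (simp add: F_apply[OF assms(1)], intro sum.cong refl)
      (auto simp: E_apply[OF assms(1)] \<iota>.hom_mult \<sigma>.hom_mult mult.assoc fun_upd_twist v
      simp del: times_divide_eq_right times_divide_eq_left)
  also have "\<dots> = v i"
    using fF_dscale[of n "i t"] True assms(1)
    by (simp flip: sum_distrib_right \<sigma>.hom_sum \<iota>.hom_sum)
  finally show ?thesis using True by simp
qed (use assms in \<open>auto simp: F_apply\<close>)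


subsection \<open>The spin-(1/2, j) R-matrix in the rescaled basis\<close>

text \<open>For \<open>N = S ^ n\<close>, \<open>Z = S ^ (2 * k)\<close> and m = n/2 - k these are
  the entries c(x q^(1/2+m)), c(x q^(1/2-m)), q^k - q^-k and q^(n-k) - q^(k-n) of the L-operator of
  quantum sl(2). Free variables \<open>N\<close> and \<open>Z\<close> make the identities below
  rational, without symbolic exponents.\<close>

definition ell :: "'b \<Rightarrow> 'b \<Rightarrow> 'b \<Rightarrow> nat \<Rightarrow> nat \<Rightarrow> 'b" where
  "ell x N Z a a' = (if a = 0 then if a' = 0 then cfun (x * S * N / Z) else cfun Z
     else if a' = 0 then cfun (N\<^sup>2 / Z) else cfun (x * S * Z / N))"

definition RH :: "nat \<Rightarrow> nat \<Rightarrow> nat \<Rightarrow> 'b \<Rightarrow> 'r tensor \<Rightarrow> 'r tensor" where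
  "RH n p t x v i = (if i p < 2 \<and> i t \<le> n
     then \<Sum>a<2. \<sigma> (ell x (S ^ n) (S ^ (2 * i t)) (i p) a) * v (i(p := a, t := i p + i t - a)) else 0)"

definition Eh :: "nat \<Rightarrow> nat \<Rightarrow> nat \<Rightarrow> 'r tensor \<Rightarrow> 'r tensor" where
  "Eh n p t v i = (if i p < 2 \<and> i t \<le> n then v (i(p := 0, t := i p + i t)) else 0)"

text \<open>The coefficients of \<open>RH\<close> vanish on the transitions that would leave the index range.\<close>

lemma ell_boundary:
  assumes "a < 2" "b < 2" "k \<le> n" "\<not> (b \<le> a + k \<and> a + k - b \<le> n)"
  shows "ell x (S ^ n) (S ^ (2 * k)) a b = 0"
proof -
  consider "a = 0" "b = 1" "k = 0" | "a = 1" "b = 0" "k = n"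
    using assms by linarith
  then show ?thesis
    by cases (auto simp: ell_def S_nz mult.commute[of n 2] simp flip: power_mult)
qed

text \<open>Values of \<open>v\<close> outside the range carry the coefficient 0 by
  \<open>ell_boundary\<close>, so \<open>v\<close> may be replaced by a formula \<open>g\<close>
  that is correct only inside.\<close>

lemma RH_eqI:
  assumes "i p < 2" "i t \<le> n"
    and "\<And>a. a < 2 \<Longrightarrow> a \<le> i p + i t \<Longrightarrow> i p + i t - a \<le> n \<Longrightarrow> v (i(p := a, t := i p + i t - a)) = g a"
  shows "RH n p t x v i = (\<Sum>a<2. \<sigma> (ell x (S ^ n) (S ^ (2 * i t)) (i p) a) * g a)"
proof -
  have "\<sigma> (ell x (S ^ n) (S ^ (2 * i t)) (i p) a) * v (i(p := a, t := i p + i t - a))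
      = \<sigma> (ell x (S ^ n) (S ^ (2 * i t)) (i p) a) * g a" if "a < 2" for a
    using that assms ell_boundary[of "i p" a "i t" n x] by (cases "a \<le> i p + i t \<and> i p + i t - a \<le> n") auto
  then show ?thesis using assms(1,2) by (simp add: RH_def)
qed

lemma less_2_cases_nat: "a < 2 \<Longrightarrow> (a = 0 \<Longrightarrow> P) \<Longrightarrow> (a = 1 \<Longrightarrow> P) \<Longrightarrow> P" for a :: nat
  by linarith

lemma sum_less_2: "(\<Sum>a<2. f a) = f 0 + f 1" for f :: "nat \<Rightarrow> 'c::comm_monoid_add"
  by (simp add: numeral_2_eq_2)


text \<open>The coordinate of the fused space is the sum of the coordinates of its parts, hence the
  argument \<open>Z * S ^ (2 * b)\<close>. The scalar on the right becomes one factor of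
  \<open>pref\<close>.\<close>

lemma ell_fusion_left:
  assumes "x \<noteq> 0" "N \<noteq> 0" "Z \<noteq> 0" "a < 2" "b < 2" "a' < 2"
  shows "(\<Sum>c<2. ell (x / S) N Z a c * ell (x * N) S (S ^ (2 * b)) c a')
     = cfun (x * N) * ell x (N * S) (Z * S ^ (2 * b)) a a'"
  using assms(4-6) assms(1-3) S_nz
  by (auto elim!: less_2_cases_nat simp: sum_less_2 ell_def cfun_def field_simps power2_eq_square)

text \<open>The opposite order gives the same coefficients with a different scalar;
  \<open>pref_Suc_right\<close> reconciles the two.\<close>

lemma ell_fusion_right:
  assumes "x \<noteq> 0" "N \<noteq> 0" "Z \<noteq> 0" "a < 2" "b < 2" "a' < 2"
  shows "(\<Sum>c<2. ell (x / N) S (S ^ (2 * b)) a c * ell (x * S) N Z c a')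
     = cfun (x * S\<^sup>2 / N) * ell x (N * S) (Z * S ^ (2 * b)) a a'"
  using assms(4-6) assms(1-3) S_nz
  by (auto elim!: less_2_cases_nat simp: sum_less_2 ell_def cfun_def field_simps power2_eq_square)

lemma cancel_inverse: "x \<noteq> 0 \<Longrightarrow> x * (inverse x * w) = w" "x \<noteq> 0 \<Longrightarrow> inverse x * (x * w) = w"
  for x w :: 'b
  by (simp_all flip: mult.assoc)
text \<open>The Yang-Baxter equation for spins 1/2, 1/2, n/2 as a matrix element from
  \<open>(a', b')\<close> to \<open>(a, b)\<close>. The state of the third factor follows from
  conservation of the total index, which explains the shifts of \<open>Z\<close>. There are sixteen
  rational identities.\<close>

lemma ell_YBE1:
  assumes "x \<noteq> 0" "y \<noteq> 0" "N \<noteq> 0" "Z \<noteq> 0" "a < 2" "b < 2" "a' < 2" "b' < 2"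
  shows "(\<Sum>c<2. \<Sum>d<2. (if c + d = a + b then ell x S (S ^ (2 * b)) a c else 0) *
       (ell (x * y) N Z c a' * ell y N (Z * S ^ (2 * c) / S ^ (2 * a')) d b'))
     = (\<Sum>d<2. \<Sum>c<2. ell y N Z b d * (ell (x * y) N (Z * S ^ (2 * b) / S ^ (2 * d)) a c *
       (if a' + b' = c + d then ell x S (S ^ (2 * d)) c a' else 0)))"
  using assms(5-8) assms(1-4) S_nz
  apply (elim less_2_cases_nat)
  apply (simp_all add: sum_less_2 ell_def cfun_def divide_inverse power2_eq_square)
  apply (simp_all add: algebra_simps cancel_inverse)
  apply (simp_all add: field_simps)
  done

text \<open>This is the shape that the equation takes when R(1/y) on the last two factors is moved
  to the other side, R(y) R(1/y) being a scalar.\<close>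

lemma ell_YBE2:
  assumes "x \<noteq> 0" "y \<noteq> 0" "N \<noteq> 0" "Z \<noteq> 0" "a < 2" "b < 2" "a' < 2" "b' < 2"
  shows "(\<Sum>d<2. ell y N Z b d * (\<Sum>c<2. \<Sum>d'<2. (if c + d' = a + d then ell x S (S ^ (2 * d)) a c else 0) *
       (if d' = b' then ell (x / y) N (Z * S ^ (2 * b) / S ^ (2 * d)) c a' else 0)))
     = (\<Sum>c<2. ell (x / y) N Z a c * (\<Sum>a''<2. \<Sum>d<2. (if a'' + d = c + b then ell x S (S ^ (2 * b)) c a'' else 0) *
       (if a'' = a' then ell y N (Z * S ^ (2 * a) / S ^ (2 * c)) d b' else 0)))"
  using assms(5-8) assms(1-4) S_nz
  apply (elim less_2_cases_nat)
  apply (simp_all add: sum_less_2 ell_def cfun_def divide_inverse power2_eq_square)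
  apply (simp_all add: algebra_simps cancel_inverse)
  apply (simp_all add: field_simps)
  done


subsection \<open>Fusion and Yang-Baxter equations in the rescaled basis\<close>

lemma \<sigma>_commute: "\<sigma> x * \<sigma> y = \<sigma> y * \<sigma> x" "\<sigma> x * (\<sigma> y * w) = \<sigma> y * (\<sigma> x * w)"
  using central[of x "\<sigma> y"] by (simp_all flip: mult.assoc)

lemma RH_fusion_left:
  assumes "distinct [r, p, t]" "x \<noteq> 0"
  shows "RH n r t (x / S) (RH 1 r p (x * S ^ n) (Eh n p t u))
    = (\<lambda>i. \<sigma> (cfun (x * S ^ n)) * Eh n p t (RH (n + 1) r t x u) i)"
proof
  fix i :: "nat \<Rightarrow> nat"
  show "RH n r t (x / S) (RH 1 r p (x * S ^ n) (Eh n p t u)) i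
    = \<sigma> (cfun (x * S ^ n)) * Eh n p t (RH (n + 1) r t x u) i"
  proof (cases "i r < 2 \<and> i p < 2 \<and> i t \<le> n")
    case False
    then show ?thesis using assms(1) by (auto simp: RH_def Eh_def)
  next
    case True
    \<comment> \<open>Conservation of the total index leaves one free variable, the value
      \<open>c\<close> in position \<open>r\<close>.\<close>
    define h where "h c = u (i(r := c, p := 0, t := i r + i p + i t - c))" for c
    have inner: "RH 1 r p (x * S ^ n) (Eh n p t u) (i(r := a, t := i r + i t - a))
        = (\<Sum>c<2. \<sigma> (ell (x * S ^ n) S (S ^ (2 * i p)) a c) * h c)"
      if a: "a < 2" "a \<le> i r + i t" "i r + i t - a \<le> n" for a
      using True a assms(1)
      by (subst RH_eqI[where g = h])
        (auto simp: Eh_def h_def fun_eq_iff intro!: arg_cong[of _ _ u])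
    have "RH n r t (x / S) (RH 1 r p (x * S ^ n) (Eh n p t u)) i
        = (\<Sum>a<2. \<sigma> (ell (x / S) (S ^ n) (S ^ (2 * i t)) (i r) a)
            * (\<Sum>c<2. \<sigma> (ell (x * S ^ n) S (S ^ (2 * i p)) a c) * h c))"
      using True inner by (intro RH_eqI) auto
    also have "\<dots> = (\<Sum>c<2. \<sigma> (\<Sum>a<2. ell (x / S) (S ^ n) (S ^ (2 * i t)) (i r) a
          * ell (x * S ^ n) S (S ^ (2 * i p)) a c) * h c)"
      by (simp add: sum_less_2 \<sigma>.hom_add \<sigma>.hom_mult algebra_simps \<sigma>_commute)
    also have "\<dots> = (\<Sum>c<2. \<sigma> (cfun (x * S ^ n)) * (\<sigma> (ell x (S ^ (n + 1)) (S ^ (2 * (i p + i t))) (i r) c) * h c))"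
      using True assms(2) S_nz
      by (intro sum.cong refl, subst ell_fusion_left)
        (auto simp: \<sigma>.hom_mult mult.assoc power_add algebra_simps)
    also have "(\<Sum>c<2. \<sigma> (ell x (S ^ (n + 1)) (S ^ (2 * (i p + i t))) (i r) c) * h c)
        = RH (n + 1) r t x u (i(p := 0, t := i p + i t))"
      using True assms(1)
      by (subst RH_eqI[where g = h]) (auto simp: h_def fun_eq_iff intro!: arg_cong[of _ _ u])
    ultimately show ?thesis using True by (simp add: Eh_def flip: sum_distrib_left)
  qed
qed

lemma RH_fusion_right:
  assumes "distinct [r, p, t]" "x \<noteq> 0"
  shows "RH 1 r p (x / S ^ n) (RH n r t (x * S) (Eh n p t u))
    = (\<lambda>i. \<sigma> (cfun (x * S\<^sup>2 / S ^ n)) * Eh n p t (RH (n + 1) r t x u) i)"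
proof
  fix i :: "nat \<Rightarrow> nat"
  show "RH 1 r p (x / S ^ n) (RH n r t (x * S) (Eh n p t u)) i
    = \<sigma> (cfun (x * S\<^sup>2 / S ^ n)) * Eh n p t (RH (n + 1) r t x u) i"
  proof (cases "i r < 2 \<and> i p < 2 \<and> i t \<le> n")
    case False
    then show ?thesis using assms(1) by (auto simp: RH_def Eh_def)
  next
    case True
    define h where "h c = u (i(r := c, p := 0, t := i r + i p + i t - c))" for c
    have inner: "RH n r t (x * S) (Eh n p t u) (i(r := a, p := i r + i p - a))
        = (\<Sum>c<2. \<sigma> (ell (x * S) (S ^ n) (S ^ (2 * i t)) a c) * h c)"
      if a: "a < 2" "a \<le> i r + i p" "i r + i p - a \<le> 1" for a
      using True a assms(1)
      by (subst RH_eqI[where g = h])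
        (auto simp: Eh_def h_def fun_eq_iff intro!: arg_cong[of _ _ u])
    have "RH 1 r p (x / S ^ n) (RH n r t (x * S) (Eh n p t u)) i
        = (\<Sum>a<2. \<sigma> (ell (x / S ^ n) (S ^ 1) (S ^ (2 * i p)) (i r) a)
            * (\<Sum>c<2. \<sigma> (ell (x * S) (S ^ n) (S ^ (2 * i t)) a c) * h c))"
      using True inner by (intro RH_eqI) auto
    also have "\<dots> = (\<Sum>c<2. \<sigma> (\<Sum>a<2. ell (x / S ^ n) S (S ^ (2 * i p)) (i r) a
          * ell (x * S) (S ^ n) (S ^ (2 * i t)) a c) * h c)"
      by (simp add: sum_less_2 \<sigma>.hom_add \<sigma>.hom_mult algebra_simps \<sigma>_commute)
    also have "\<dots> = (\<Sum>c<2. \<sigma> (cfun (x * S\<^sup>2 / S ^ n)) * (\<sigma> (ell x (S ^ (n + 1)) (S ^ (2 * (i p + i t))) (i r) c) * h c))"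
      using True assms(2) S_nz
      by (intro sum.cong refl, subst ell_fusion_right)
        (auto simp: \<sigma>.hom_mult mult.assoc power_add algebra_simps)
    also have "(\<Sum>c<2. \<sigma> (ell x (S ^ (n + 1)) (S ^ (2 * (i p + i t))) (i r) c) * h c)
        = RH (n + 1) r t x u (i(p := 0, t := i p + i t))"
      using True assms(1)
      by (subst RH_eqI[where g = h]) (auto simp: h_def fun_eq_iff intro!: arg_cong[of _ _ u])
    ultimately show ?thesis using True by (simp add: Eh_def flip: sum_distrib_left)
  qed
qed

text \<open>A double sum with an indicator is free of truncated differences and matches the shape of
  \<open>ell_YBE1\<close> and \<open>ell_YBE2\<close>.\<close>

lemma RH_1_sum:
  assumes "i p < 2" "i t < 2"
  shows "RH 1 p t x v i = (\<Sum>c<2. \<Sum>d<2.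
     \<sigma> (if c + d = i p + i t then ell x S (S ^ (2 * i t)) (i p) c else 0) * v (i(p := c, t := d)))"
proof -
  have "RH 1 p t x v i = (\<Sum>c<2. \<sigma> (ell x (S ^ 1) (S ^ (2 * i t)) (i p) c)
      * (\<Sum>d<2. if c + d = i p + i t then v (i(p := c, t := d)) else 0))"
  proof (rule RH_eqI)
    fix a assume "a < 2" "a \<le> i p + i t" "i p + i t - a \<le> 1"
    then have "a + d = i p + i t \<longleftrightarrow> i p + i t - a = d" "i p + i t - a < 2" for d by auto
    then show "v (i(p := a, t := i p + i t - a)) = (\<Sum>d<2. if a + d = i p + i t then v (i(p := a, t := d)) else 0)"
      by simp
  qed (use assms in auto)
  then show ?thesis by (auto simp: sum_distrib_left intro!: sum.cong)
qed

lemma S_power_diff: "b \<le> a \<Longrightarrow> S ^ (2 * (a - b)) = S ^ (2 * a) / S ^ (2 * b)"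
  using S_nz by (simp add: power_diff diff_mult_distrib2)

lemma RH_YBE1:
  assumes "distinct [p, t, r]" "x \<noteq> 0" "y \<noteq> 0"
  shows "RH 1 p t x (RH n p r (x * y) (RH n t r y v)) = RH n t r y (RH n p r (x * y) (RH 1 p t x v))"
proof
  fix i :: "nat \<Rightarrow> nat"
  show "RH 1 p t x (RH n p r (x * y) (RH n t r y v)) i = RH n t r y (RH n p r (x * y) (RH 1 p t x v)) i"
  proof (cases "i p < 2 \<and> i t < 2 \<and> i r \<le> n")
    case False
    then show ?thesis using assms(1) by (auto simp: RH_def)
  next
    case True
    let ?N = "S ^ n" and ?Z = "S ^ (2 * i r)"
    \<comment> \<open>Only the values at \<open>p\<close> and \<open>t\<close> are free; the one at
      \<open>r\<close> is fixed by the conserved total.\<close>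
    define h where "h a b = v (i(p := a, t := b, r := i p + i t + i r - a - b))" for a b
    have L: "RH n p r (x * y) (RH n t r y v) (i(p := c, t := d))
        = (\<Sum>a<2. \<sigma> (ell (x * y) ?N ?Z c a) *
            (\<Sum>b<2. \<sigma> (ell y ?N (?Z * S ^ (2 * c) / S ^ (2 * a)) d b) * h a b))"
      if c: "c < 2" "d < 2" "c + d = i p + i t" for c d
    proof -
      have "RH n t r y v (i(p := a, t := d, r := c + i r - a))
          = (\<Sum>b<2. \<sigma> (ell y ?N (?Z * S ^ (2 * c) / S ^ (2 * a)) d b) * h a b)"
        if a: "a < 2" "a \<le> c + i r" "c + i r - a \<le> n" for a
        using True c a assms(1)
        by (subst RH_eqI[where g = "h a"])
          (auto simp: h_def fun_eq_iff S_power_diff distrib_left power_add mult.commute intro!: arg_cong[of _ _ v])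
      then show ?thesis
        using True c assms(1) by (subst RH_eqI) (auto simp: fun_upd_twist)
    qed
    have R: "RH n p r (x * y) (RH 1 p t x v) (i(t := d, r := i t + i r - d))
        = (\<Sum>c<2. \<sigma> (ell (x * y) ?N (?Z * S ^ (2 * i t) / S ^ (2 * d)) (i p) c) *
            (\<Sum>a<2. \<Sum>b<2. \<sigma> (if a + b = c + d then ell x S (S ^ (2 * d)) c a else 0) * h a b))"
      if d: "d < 2" "d \<le> i t + i r" "i t + i r - d \<le> n" for d
    proof -
      have "RH 1 p t x v (i(t := d, p := c, r := i p + (i t + i r - d) - c))
          = (\<Sum>a<2. \<Sum>b<2. \<sigma> (if a + b = c + d then ell x S (S ^ (2 * d)) c a else 0) * h a b)"
        if c: "c < 2" "c \<le> i p + (i t + i r - d)" for c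
        using True c d assms(1)
        by (subst RH_1_sum)
          (auto simp: h_def intro!: sum.cong, (intro arg_cong2[of _ _ _ _ times] refl arg_cong[of _ _ v], auto simp: fun_eq_iff)+)
      then show ?thesis
        using True d assms(1)
        by (subst RH_eqI) (auto simp: fun_upd_twist S_power_diff distrib_left power_add mult.commute)
    qed
    have "RH 1 p t x (RH n p r (x * y) (RH n t r y v)) i
        = (\<Sum>c<2. \<Sum>d<2. \<sigma> (if c + d = i p + i t then ell x S (S ^ (2 * i t)) (i p) c else 0) *
           (\<Sum>a<2. \<sigma> (ell (x * y) ?N ?Z c a) *
            (\<Sum>b<2. \<sigma> (ell y ?N (?Z * S ^ (2 * c) / S ^ (2 * a)) d b) * h a b)))"
      using True by (subst RH_1_sum) (auto simp: L intro!: sum.cong)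
    \<comment> \<open>Collecting the central coefficients of each \<open>h a b\<close> reduces the
      claim to a scalar identity.\<close>
    also have "\<dots> = (\<Sum>a<2. \<Sum>b<2. \<sigma> (\<Sum>c<2. \<Sum>d<2. (if c + d = i p + i t then ell x S (S ^ (2 * i t)) (i p) c else 0) *
       (ell (x * y) ?N ?Z c a * ell y ?N (?Z * S ^ (2 * c) / S ^ (2 * a)) d b)) * h a b)"
      by (simp only: sum_less_2 \<sigma>.hom_add \<sigma>.hom_mult algebra_simps \<sigma>_commute)
    also have "\<dots> = (\<Sum>a<2. \<Sum>b<2. \<sigma> (\<Sum>d<2. \<Sum>c<2. ell y ?N ?Z (i t) d * (ell (x * y) ?N (?Z * S ^ (2 * i t) / S ^ (2 * d)) (i p) c *
       (if a + b = c + d then ell x S (S ^ (2 * d)) c a else 0))) * h a b)"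
      using True assms(2,3) S_nz by (intro sum.cong refl, subst ell_YBE1) auto
    also have "\<dots> = (\<Sum>d<2. \<sigma> (ell y ?N ?Z (i t) d) *
        (\<Sum>c<2. \<sigma> (ell (x * y) ?N (?Z * S ^ (2 * i t) / S ^ (2 * d)) (i p) c) *
            (\<Sum>a<2. \<Sum>b<2. \<sigma> (if a + b = c + d then ell x S (S ^ (2 * d)) c a else 0) * h a b)))"
      by (simp only: sum_less_2 \<sigma>.hom_add \<sigma>.hom_mult algebra_simps \<sigma>_commute)
    also have "\<dots> = RH n t r y (RH n p r (x * y) (RH 1 p t x v)) i"
      using True R by (intro RH_eqI[symmetric]) auto
    finally show ?thesis .
  qed
qed

lemma RH_YBE2:
  assumes "distinct [p, t, r]" "x \<noteq> 0" "y \<noteq> 0"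
  shows "RH n t r y (RH 1 p t x (RH n p r (x / y) v)) = RH n p r (x / y) (RH 1 p t x (RH n t r y v))"
proof
  fix i :: "nat \<Rightarrow> nat"
  show "RH n t r y (RH 1 p t x (RH n p r (x / y) v)) i = RH n p r (x / y) (RH 1 p t x (RH n t r y v)) i"
  proof (cases "i p < 2 \<and> i t < 2 \<and> i r \<le> n")
    case False
    then show ?thesis using assms(1) by (auto simp: RH_def)
  next
    case True
    let ?N = "S ^ n" and ?Z = "S ^ (2 * i r)"
    define h where "h a b = v (i(p := a, t := b, r := i p + i t + i r - a - b))" for a b
    have L: "RH 1 p t x (RH n p r (x / y) v) (i(t := d, r := i t + i r - d))
        = (\<Sum>c<2. \<Sum>b<2. \<sigma> (if c + b = i p + d then ell x S (S ^ (2 * d)) (i p) c else 0) *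
            (\<Sum>a<2. \<sigma> (ell (x / y) ?N (?Z * S ^ (2 * i t) / S ^ (2 * d)) c a) * h a b))"
      if d: "d < 2" "d \<le> i t + i r" "i t + i r - d \<le> n" for d
    proof -
      have "RH n p r (x / y) v (i(t := b, p := c, r := i t + i r - d))
          = (\<Sum>a<2. \<sigma> (ell (x / y) ?N (?Z * S ^ (2 * i t) / S ^ (2 * d)) c a) * h a b)"
        if c: "c < 2" "b < 2" "c + b = i p + d" for c b
        using True c d assms(1)
        by (subst RH_eqI[where g = "\<lambda>a. h a b"])
          (auto simp: h_def fun_eq_iff S_power_diff distrib_left power_add mult.commute intro!: arg_cong[of _ _ v])
      then show ?thesis
        using True d assms(1) by (subst RH_1_sum) (auto simp: fun_upd_twist intro!: sum.cong)
    qed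
    have R: "RH 1 p t x (RH n t r y v) (i(p := c, r := i p + i r - c))
        = (\<Sum>a<2. \<Sum>d<2. \<sigma> (if a + d = c + i t then ell x S (S ^ (2 * i t)) c a else 0) *
            (\<Sum>b<2. \<sigma> (ell y ?N (?Z * S ^ (2 * i p) / S ^ (2 * c)) d b) * h a b))"
      if c: "c < 2" "c \<le> i p + i r" "i p + i r - c \<le> n" for c
    proof -
      have "RH n t r y v (i(p := a, t := d, r := i p + i r - c))
          = (\<Sum>b<2. \<sigma> (ell y ?N (?Z * S ^ (2 * i p) / S ^ (2 * c)) d b) * h a b)"
        if a: "a < 2" "d < 2" "a + d = c + i t" for a d
        using True c a assms(1)
        by (subst RH_eqI[where g = "h a"])
          (auto simp: h_def fun_eq_iff S_power_diff distrib_left power_add mult.commute intro!: arg_cong[of _ _ v])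
      then show ?thesis
        using True c assms(1) by (subst RH_1_sum) (auto simp: fun_upd_twist intro!: sum.cong)
    qed
    have "RH n t r y (RH 1 p t x (RH n p r (x / y) v)) i
        = (\<Sum>d<2. \<sigma> (ell y ?N ?Z (i t) d) *
           (\<Sum>c<2. \<Sum>b<2. \<sigma> (if c + b = i p + d then ell x S (S ^ (2 * d)) (i p) c else 0) *
            (\<Sum>a<2. \<sigma> (ell (x / y) ?N (?Z * S ^ (2 * i t) / S ^ (2 * d)) c a) * h a b)))"
      using True L by (intro RH_eqI) auto
    also have "\<dots> = (\<Sum>a<2. \<Sum>b<2. \<sigma> (\<Sum>d<2. ell y ?N ?Z (i t) d * (\<Sum>c<2. \<Sum>d'<2.
         (if c + d' = i p + d then ell x S (S ^ (2 * d)) (i p) c else 0) *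
         (if d' = b then ell (x / y) ?N (?Z * S ^ (2 * i t) / S ^ (2 * d)) c a else 0))) * h a b)"
      by (simp add: sum_less_2 \<sigma>.hom_add \<sigma>.hom_mult algebra_simps \<sigma>_commute del: power_Suc)
    also have "\<dots> = (\<Sum>a<2. \<Sum>b<2. \<sigma> (\<Sum>c<2. ell (x / y) ?N ?Z (i p) c * (\<Sum>a''<2. \<Sum>d<2.
         (if a'' + d = c + i t then ell x S (S ^ (2 * i t)) c a'' else 0) *
         (if a'' = a then ell y ?N (?Z * S ^ (2 * i p) / S ^ (2 * c)) d b else 0))) * h a b)"
      using True assms(2,3) S_nz by (intro sum.cong refl, subst ell_YBE2) auto
    also have "\<dots> = (\<Sum>c<2. \<sigma> (ell (x / y) ?N ?Z (i p) c) *
        (\<Sum>a<2. \<Sum>d<2. \<sigma> (if a + d = c + i t then ell x S (S ^ (2 * i t)) c a else 0) *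
            (\<Sum>b<2. \<sigma> (ell y ?N (?Z * S ^ (2 * i p) / S ^ (2 * c)) d b) * h a b)))"
      by (simp add: sum_less_2 \<sigma>.hom_add \<sigma>.hom_mult algebra_simps \<sigma>_commute del: power_Suc)
    also have "\<dots> = RH n p r (x / y) (RH 1 p t x (RH n t r y v)) i"
      using True R by (intro RH_eqI[symmetric]) auto
    finally show ?thesis .
  qed
qed


subsection \<open>Explicit form of the spin-(1/2, j) R-matrix\<close>

text \<open>The scalar by which the fused R-matrix exceeds \<open>RH\<close>: the product of c(x
  q^((n-1)/2 - k)) over 0 <= k <= n - 2. The recursion splits off the factor with the highest power
  of q, \<open>pref_Suc_right\<close> the one with the lowest.\<close>

fun pref :: "nat \<Rightarrow> 'b \<Rightarrow> 'b" where
  "pref 0 x = 1"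
| "pref (Suc n) x = (if n = 0 then 1 else cfun (x * S ^ n) * pref n (x / S))"

lemma pref_Suc_right: "n \<ge> 1 \<Longrightarrow> pref (Suc n) x = cfun (x * S\<^sup>2 / S ^ n) * pref n (x * S)"
proof (induction n arbitrary: x)
  case (Suc n)
  show ?case
  proof (cases "n = 0")
    case True
    then show ?thesis using S_nz by (simp add: power2_eq_square)
  next
    case False
    have "pref (Suc n) (x / S) = cfun (x / S * S\<^sup>2 / S ^ n) * pref n (x / S * S)"
      using False by (intro Suc.IH) simp
    then show ?thesis using False S_nz by (simp add: power2_eq_square mult_ac)
  qed
qed simp

lemma cfun_eq_0_iff: "x \<noteq> 0 \<Longrightarrow> cfun x = 0 \<longleftrightarrow> x\<^sup>2 = 1" for x :: 'b
  by (auto simp: cfun_def field_simps power2_eq_square)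

lemma S_power_ne_1: "n > 0 \<Longrightarrow> S ^ (2 * n) \<noteq> 1"
proof
  assume "n > 0" "S ^ (2 * n) = 1"
  then have "\<iota> (q ^ n) = \<iota> 1"
    by (simp add: power_mult \<iota>.hom_power \<iota>_q)
  then show False using q_root[OF \<open>n > 0\<close>] by simp
qed

lemma cfun_S_power_nz: "n > 0 \<Longrightarrow> cfun (1 / S ^ n) \<noteq> 0" "n > 0 \<Longrightarrow> cfun (S ^ n) \<noteq> 0"
  using S_nz S_power_ne_1[of n]
  by (auto simp: cfun_eq_0_iff power_divide power_mult[symmetric] mult.commute)

text \<open>All factors are c(S^-l) with l > 0, which is non-zero because q is not a root of unity.
  For \<open>m = n + 1\<close> this says that at the degenerate point the kernel of the R-matrix is
  that of \<open>RH\<close>.\<close>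

lemma pref_nz: "n < m \<Longrightarrow> pref n (1 / S ^ m) \<noteq> 0"
proof (induction n arbitrary: m)
  case (Suc n)
  have "S ^ n / S ^ m = 1 / S ^ (m - n)"
    using Suc.prems S_nz by (simp add: power_diff)
  moreover have "1 / S ^ m / S = 1 / S ^ Suc m" by (simp add: mult.commute)
  ultimately show ?case
    using Suc.IH[of "Suc m"] Suc.prems cfun_S_power_nz(1)[of "m - n"] by (simp add: mult.commute)
qed simp

section \<open>Diagonal changes of basis\<close>

definition scl :: "((nat \<Rightarrow> nat) \<Rightarrow> 'b) \<Rightarrow> 'r tensor \<Rightarrow> 'r tensor" where
  "scl g v i = \<sigma> (g i) * v i"

lemma scl_scl: "scl g (scl h v) = scl (\<lambda>i. g i * h i) v"
  by (auto simp: scl_def \<sigma>.hom_mult mult.assoc)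

lemma op2_scl:
  assumes "\<And>i a b. g (i(p := a, t := b)) = g i"
  shows "op2 d e p t M (scl g v) = scl g (op2 d e p t M v)"
proof
  fix i
  have "M a b c f * (\<sigma> x * y) = \<sigma> x * (M a b c f * y)" for a b c f x y
    by (metis central mult.assoc)
  then show "op2 d e p t M (scl g v) i = scl g (op2 d e p t M v) i"
    by (simp add: op2_def scl_def assms sum_distrib_left)
qed

lemma RH_scl:
  assumes "\<And>i a b. g (i(p := a, t := b)) = g i"
  shows "RH n p t x (scl g v) = scl g (RH n p t x v)"
  by (rule ext) (simp add: RH_def scl_def assms sum_distrib_left \<sigma>_commute)

lemma R_scl: "(\<And>i a b. g (i(p := a, t := b)) = g i) \<Longrightarrow> R m n p t x (scl g v) = scl g (R m n p t x v)"
  unfolding R_def by (rule op2_scl)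

lemma R_upd: "z \<noteq> p \<Longrightarrow> z \<noteq> t \<Longrightarrow> R m n p t x (\<lambda>i. v (i(z := c))) = (\<lambda>i. R m n p t x v (i(z := c)))"
  unfolding R_def by (rule op2_upd)

abbreviation dg :: "nat \<Rightarrow> nat \<Rightarrow> (nat \<Rightarrow> nat) \<Rightarrow> 'b" where
  "dg n t \<equiv> \<lambda>i. \<iota> (dscale n (i t))"

abbreviation dg_inv :: "nat \<Rightarrow> nat \<Rightarrow> (nat \<Rightarrow> nat) \<Rightarrow> 'b" where
  "dg_inv n t \<equiv> \<lambda>i. \<iota> (inverse (dscale n (i t)))"

text \<open>The range matters: \<open>dscale n k\<close> contains the factor
  \<open>B n n = 0\<close> as soon as \<open>k > n\<close>.\<close>

lemma dg_dg_inv: "i t \<le> n \<Longrightarrow> scl (dg n t) (scl (dg_inv n t) v) i = v i"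
  using dscale_nz[of "i t" n]
  by (simp add: scl_def flip: mult.assoc \<sigma>.hom_mult \<iota>.hom_mult)

lemma R_rescale: "p \<noteq> t \<Longrightarrow> R m n p t x (scl (dg n t) (scl (dg_inv n t) v)) = R m n p t x v"
  unfolding R_def by (rule ext, rule op2_cong, rule dg_dg_inv) auto

lemma E_rescale: "p \<noteq> t \<Longrightarrow> E n p t (scl (dg (n + 1) t) (scl (dg_inv (n + 1) t) v)) = E n p t v"
  unfolding E_def by (rule ext, rule op2_cong, rule dg_dg_inv) auto

lemma E_scl_dg:
  assumes "n \<ge> 1" "p \<noteq> t"
  shows "E n p t (scl (dg (n + 1) t) u) = scl (dg n t) (Eh n p t u)"
proof
  fix i
  have "\<sigma> (\<iota> (dscale n (i t) / dscale (n + 1) (i p + i t))) * (\<sigma> (\<iota> (dscale (n + 1) (i p + i t))) * w) = \<sigma> (\<iota> (dscale n (i t))) * w"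
    if "i p < 2" "i t \<le> n" for w
    using that dscale_nz[of "i p + i t" "n + 1"] by (simp flip: mult.assoc \<sigma>.hom_mult \<iota>.hom_mult)
  then show "E n p t (scl (dg (n + 1) t) u) i = scl (dg n t) (Eh n p t u) i"
    using assms by (simp add: E_apply[OF assms(1)] Eh_def scl_def)
qed

lemma R_fund_entry:
  assumes "a < 2" "b < 2" "c < 2" "d < 2"
  shows "R_fund \<iota> q x $$ (a * 2 + b, c * 2 + d) = (if c + d = a + b then ell x S (S ^ (2 * b)) a c else 0)"
  using assms S_nz
  by (elim less_2_cases_nat)
    (simp_all add: R_fund_def mat_of_rows_list_def ell_def cfun_def \<iota>_q \<iota>.hom_inverse hom_distribs power2_eq_square
      field_simps)

lemma R_1_1:
  assumes "p \<noteq> t" "x \<noteq> 0"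
  shows "R 1 1 p t x v = RH 1 p t x v"
proof
  fix i
  show "R 1 1 p t x v i = RH 1 p t x v i"
  proof (cases "i p < 2 \<and> i t < 2")
    case False
    then show ?thesis by (auto simp: R_def RH_def op2_def ker2_def)
  next
    case True
    have "i p * 2 + i t < 4" "c * 2 + d < 4" if "c < 2" "d < 2" for c d :: nat
      using True that by auto
    then show ?thesis
      using True R_fund_carrier[of \<iota> q x] unfolding RH_1_sum[where i = i, OF conjunct1[OF True] conjunct2[OF True]]
      by (auto simp: R_def op2_def ker2_def numeral_2_eq_2[symmetric] R_fund_entry intro!: sum.cong)
  qed
qed

text \<open>The product in front of E is already of the form E times a vector, so no projection is
  involved. The explicit form for spin n/2 is a hypothesis here, because the lemma serves both
  inside the induction for \<open>R_explicit\<close> and after it.\<close>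

lemma R_fusion_left_step:
  assumes IH: "\<And>x u. x \<noteq> 0 \<Longrightarrow> R 1 n r t x (scl (dg n t) u) = scl (\<lambda>i. pref n x * dg n t i) (RH n r t x u)"
    and n: "n \<ge> 1" and d: "distinct [r, p, t]" and x: "x \<noteq> 0"
  shows "R 1 n r t (x / S) (R 1 1 r p (x * S ^ n) (E n p t (scl (dg (n + 1) t) u)))
    = E n p t (scl (\<lambda>i. pref (n + 1) x * dg (n + 1) t i) (RH (n + 1) r t x u))"
proof -
  have neq: "r \<noteq> t" "r \<noteq> p" "p \<noteq> t" using d by auto
  have "R 1 n r t (x / S) (R 1 1 r p (x * S ^ n) (E n p t (scl (dg (n + 1) t) u)))
      = R 1 n r t (x / S) (scl (dg n t) (RH 1 r p (x * S ^ n) (Eh n p t u)))"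
    using n neq x S_nz E_scl_dg[of n p t u] by (simp add: R_1_1[simplified] RH_scl)
  also have "\<dots> = scl (\<lambda>i. pref n (x / S) * dg n t i) (RH n r t (x / S) (RH 1 r p (x * S ^ n) (Eh n p t u)))"
    using x S_nz by (intro IH) auto
  also have "\<dots> = scl (\<lambda>i. pref n (x / S) * dg n t i) (scl (\<lambda>_. cfun (x * S ^ n)) (Eh n p t (RH (n + 1) r t x u)))"
    using RH_fusion_left[OF d x] by (simp add: scl_def fun_eq_iff)
  also have "\<dots> = scl (\<lambda>i. pref (n + 1) x) (scl (dg n t) (Eh n p t (RH (n + 1) r t x u)))"
    using n by (simp add: scl_scl mult_ac)
  also have "\<dots> = scl (\<lambda>i. pref (n + 1) x) (E n p t (scl (dg (n + 1) t) (RH (n + 1) r t x u)))"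
    using n neq by (subst E_scl_dg) auto
  also have "\<dots> = E n p t (scl (\<lambda>i. pref (n + 1) x * dg (n + 1) t i) (RH (n + 1) r t x u))"
    unfolding E_def by (simp add: op2_scl flip: scl_scl)
  finally show ?thesis .
qed

text \<open>In the induction step the unprojected product lies in the image of E, and F merely
  undoes E.\<close>

lemma R_explicit:
  assumes "n \<ge> 1" "r \<noteq> t" "x \<noteq> 0"
  shows "R 1 n r t x (scl (dg n t) u) = scl (\<lambda>i. pref n x * dg n t i) (RH n r t x u)"
  using assms
proof (induction n arbitrary: x u rule: nat_induct_at_least)
  case base
  have "R 1 1 r t x (scl (dg 1 t) u) i = scl (\<lambda>i. pref 1 x * dg 1 t i) (RH 1 r t x u) i" for i
  proof (cases "i t \<le> 1")
    case True
    have "R 1 1 r t x (scl (dg 1 t) u) i = R 1 1 r t x u i"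
      unfolding R_def using base by (intro op2_cong) (simp add: scl_def dscale_1[simplified] less_Suc_eq_le)
    then show ?thesis using True base by (simp add: R_1_1[simplified] scl_def dscale_1[simplified])
  qed (auto simp: R_def op2_def ker2_def scl_def RH_def)
  then show ?case by auto
next
  case (Suc n)
  \<comment> \<open>Any position other than \<open>r\<close> and \<open>t\<close> can be the
    auxiliary one.\<close>
  define p where "p = r + t + 1"
  have d: "distinct [r, p, t]" using Suc.prems by (auto simp: p_def)
  then have neq: "r \<noteq> p" "p \<noteq> t" by auto
  have at0: "R 1 (n + 1) r t x (scl (dg (n + 1) t) u) i
      = scl (\<lambda>i. pref (n + 1) x * dg (n + 1) t i) (RH (n + 1) r t x u) i" if "i p = 0" for u i
  proof -
    have "R 1 (n + 1) r t x (scl (dg (n + 1) t) u) i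
        = F n p t (R 1 n r t (x / S) (R 1 1 r p (x * S ^ n) (E n p t (scl (dg (n + 1) t) u)))) i"
      using R_half_fusion[of r p t i n x "scl (dg (n + 1) t) u"] that d neq Suc by simp
    also have "\<dots> = F n p t (E n p t (scl (\<lambda>i. pref (n + 1) x * dg (n + 1) t i) (RH (n + 1) r t x u))) i"
      using R_fusion_left_step[OF Suc.IH[OF Suc.prems(1)] Suc.hyps d Suc.prems(2), of u] by simp
    finally show ?thesis using that neq Suc.hyps by (simp add: FE_apply scl_def RH_def)
  qed
  have "R 1 (n + 1) r t x (scl (dg (n + 1) t) u) i
      = scl (\<lambda>i. pref (n + 1) x * dg (n + 1) t i) (RH (n + 1) r t x u) i" for i
  proof -
    \<comment> \<open>Neither side acts on \<open>p\<close>, so the claim at \<open>i p = 0\<close>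
      extends to all indices by freezing that coordinate.\<close>
    let ?u = "\<lambda>j. u (j(p := i p))"
    have "R 1 (n + 1) r t x (scl (dg (n + 1) t) u) i
        = R 1 (n + 1) r t x (\<lambda>j. scl (dg (n + 1) t) u (j(p := i p))) (i(p := 0))"
      using neq Suc.prems by (subst R_upd) auto
    also have "(\<lambda>j. scl (dg (n + 1) t) u (j(p := i p))) = scl (dg (n + 1) t) ?u"
      using neq by (auto simp: scl_def)
    also have "R 1 (n + 1) r t x (scl (dg (n + 1) t) ?u) (i(p := 0))
        = scl (\<lambda>i. pref (n + 1) x * dg (n + 1) t i) (RH (n + 1) r t x ?u) (i(p := 0))"
      by (intro at0) simp
    also have "\<dots> = scl (\<lambda>i. pref (n + 1) x * dg (n + 1) t i) (RH (n + 1) r t x u) i"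
      using neq by (auto simp: scl_def RH_def fun_upd_twist intro!: arg_cong2[of _ _ _ _ times] sum.cong)
        (auto simp: fun_eq_iff intro!: arg_cong[of _ _ u])
    finally show ?thesis .
  qed
  then show ?case by auto
qed

text \<open>Every vector agrees on the relevant index range with a rescaled one, so identities in the rescaled
  basis carry over.\<close>

lemma R_explicit':
  assumes "n \<ge> 1" "r \<noteq> t" "x \<noteq> 0"
  shows "R 1 n r t x v = scl (\<lambda>i. pref n x * dg n t i) (RH n r t x (scl (dg_inv n t) v))"
  using R_explicit[OF assms, of "scl (dg_inv n t) v"] R_rescale[of r t 1 n x v] assms(2) by simp

lemma E_explicit:
  assumes "n \<ge> 1" "p \<noteq> t"
  shows "E n p t v = scl (dg n t) (Eh n p t (scl (dg_inv (n + 1) t) v))"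
  using E_scl_dg[OF assms, of "scl (dg_inv (n + 1) t) v"] E_rescale[of p t n v] assms(2) by simp

lemma E_scl:
  assumes "\<And>i a b. g (i(p := a, t := b)) = g i"
  shows "E n p t (scl g v) = scl g (E n p t v)"
  unfolding E_def using assms by (rule op2_scl)

lemma R_fusion_left:
  assumes "n \<ge> 1" "distinct [r, p, t]" "x \<noteq> 0"
  shows "R 1 n r t (x / S) (R 1 1 r p (x * S ^ n) (E n p t v)) = E n p t (R 1 (n + 1) r t x v)"
proof -
  have neq: "r \<noteq> t" "p \<noteq> t" using assms(2) by auto
  show ?thesis
    using R_fusion_left_step[OF R_explicit[OF assms(1) neq(1)] assms, of "scl (dg_inv (n + 1) t) v"]
      R_explicit'[of "n + 1" r t x v] neq assms(3) by (simp only: E_rescale[OF neq(2)]) simp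
qed

text \<open>The prefactor of spin n/2 is now taken at \<open>x * S\<close> instead of
  \<open>x / S\<close>, which compensates exactly for the other scalar in
  \<open>RH_fusion_right\<close>.\<close>

lemma R_fusion_right:
  assumes "n \<ge> 1" "distinct [r, p, t]" "x \<noteq> 0"
  shows "R 1 1 r p (x / S ^ n) (R 1 n r t (x * S) (E n p t v)) = E n p t (R 1 (n + 1) r t x v)"
proof -
  have neq: "r \<noteq> t" "r \<noteq> p" "p \<noteq> t" using assms(2) by auto
  let ?u = "scl (dg_inv (n + 1) t) v"
  have "R 1 1 r p (x / S ^ n) (R 1 n r t (x * S) (E n p t v))
      = R 1 1 r p (x / S ^ n) (scl (\<lambda>i. pref n (x * S) * dg n t i) (RH n r t (x * S) (Eh n p t ?u)))"
    using assms(3) S_nz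
    by (simp only: E_explicit[OF assms(1) neq(3)], subst R_explicit[OF assms(1) neq(1)]) auto
  also have "\<dots> = scl (\<lambda>i. pref n (x * S) * dg n t i) (RH 1 r p (x / S ^ n) (RH n r t (x * S) (Eh n p t ?u)))"
    using assms neq S_nz by (simp add: R_scl R_1_1[simplified])
  also have "\<dots> = scl (\<lambda>i. pref n (x * S) * dg n t i) (scl (\<lambda>_. cfun (x * S\<^sup>2 / S ^ n)) (Eh n p t (RH (n + 1) r t x ?u)))"
    using RH_fusion_right[OF assms(2,3)] by (simp add: scl_def fun_eq_iff)
  also have "\<dots> = scl (\<lambda>i. pref (n + 1) x) (scl (dg n t) (Eh n p t (RH (n + 1) r t x ?u)))"
    using pref_Suc_right[OF assms(1), of x] by (simp add: scl_scl mult_ac del: pref.simps)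
  also have "\<dots> = scl (\<lambda>i. pref (n + 1) x) (E n p t (scl (dg (n + 1) t) (RH (n + 1) r t x ?u)))"
    using assms(1) neq by (subst E_scl_dg) auto
  also have "\<dots> = E n p t (R 1 (n + 1) r t x v)"
    using R_explicit'[of "n + 1" r t x v] neq assms(3) by (simp add: E_scl flip: scl_scl)
  finally show ?thesis .
qed

lemma R_explicit_scl:
  assumes "n \<ge> 1" "p \<noteq> r" "x \<noteq> 0"
  shows "R 1 n p r x (scl (\<lambda>i. c * dg n r i) v) = scl (\<lambda>i. pref n x * (c * dg n r i)) (RH n p r x v)"
proof -
  have "scl (\<lambda>i. c * dg n r i) v = scl (\<lambda>_. c) (scl (dg n r) v)" by (simp add: scl_scl)
  then show ?thesis
    using R_explicit[OF assms, of v] by (simp only: R_scl) (simp add: scl_scl mult_ac)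
qed

lemma R_1_1_scl:
  assumes "\<And>i a b. g (i(p := a, t := b)) = g i" "p \<noteq> t" "x \<noteq> 0"
  shows "R 1 1 p t x (scl g v) = scl g (RH 1 p t x v)"
  by (simp only: R_1_1[OF assms(2,3)] RH_scl[OF assms(1)])

text \<open>Both sides acquire the same scalar and the same diagonal factor at \<open>r\<close>,
  which leaves \<open>RH_YBE1\<close>.\<close>

lemma R_YBE1_half:
  assumes "n \<ge> 1" "distinct [p, t, r]" "x \<noteq> 0" "y \<noteq> 0"
  shows "R 1 1 p t x (R 1 n p r (x * y) (R 1 n t r y v)) = R 1 n t r y (R 1 n p r (x * y) (R 1 1 p t x v))"
proof -
  have neq: "p \<noteq> r" "t \<noteq> r" "x * y \<noteq> 0" using assms by auto
  let ?g = "\<lambda>i. pref n (x * y) * (pref n y * dg n r i)" and ?u = "scl (dg_inv n r) v"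
  have pt: "p \<noteq> t" using assms by auto
  have inv: "scl (dg_inv n r) (RH 1 p t x w) = RH 1 p t x (scl (dg_inv n r) w)" for w
    using assms by (subst RH_scl) auto
  have g: "?g = (\<lambda>i. pref n y * (pref n (x * y) * dg n r i))" by (simp add: mult_ac)
  have "R 1 1 p t x (R 1 n p r (x * y) (R 1 n t r y v)) = scl ?g (RH 1 p t x (RH n p r (x * y) (RH n t r y ?u)))"
    unfolding R_explicit'[OF assms(1) neq(2) assms(4)] R_explicit_scl[OF assms(1) neq(1,3)]
    using assms by (intro R_1_1_scl) auto
  moreover have "R 1 n t r y (R 1 n p r (x * y) (R 1 1 p t x v)) = scl ?g (RH n t r y (RH n p r (x * y) (RH 1 p t x ?u)))"
    unfolding g R_1_1[OF pt assms(3)]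
    by (simp only: R_explicit'[OF assms(1) neq(1,3)] R_explicit_scl[OF assms(1) neq(2) assms(4)] inv)
  ultimately show ?thesis by (simp only: RH_YBE1[OF assms(2-4)])
qed

lemma R_YBE2_half:
  assumes "n \<ge> 1" "distinct [p, t, r]" "x \<noteq> 0" "y \<noteq> 0"
  shows "R 1 n t r y (R 1 1 p t x (R 1 n p r (x / y) v)) = R 1 n p r (x / y) (R 1 1 p t x (R 1 n t r y v))"
proof -
  have neq: "p \<noteq> r" "t \<noteq> r" "x / y \<noteq> 0" using assms by auto
  let ?g = "\<lambda>i. pref n (x / y) * (pref n y * dg n r i)" and ?u = "scl (dg_inv n r) v"
  have half: "R 1 1 p t x (scl (\<lambda>i. c * dg n r i) w) = scl (\<lambda>i. c * dg n r i) (RH 1 p t x w)" for c w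
    using assms by (intro R_1_1_scl) auto
  have g: "?g = (\<lambda>i. pref n y * (pref n (x / y) * dg n r i))" by (simp add: mult_ac)
  have "R 1 n t r y (R 1 1 p t x (R 1 n p r (x / y) v)) = scl ?g (RH n t r y (RH 1 p t x (RH n p r (x / y) ?u)))"
    unfolding g
    by (simp only: R_explicit'[OF assms(1) neq(1,3)] half R_explicit_scl[OF assms(1) neq(2) assms(4)])
  moreover have "R 1 n p r (x / y) (R 1 1 p t x (R 1 n t r y v)) = scl ?g (RH n p r (x / y) (RH 1 p t x (RH n t r y ?u)))"
    by (simp only: R_explicit'[OF assms(1) neq(2) assms(4)] half R_explicit_scl[OF assms(1) neq(1,3)])
  ultimately show ?thesis by (simp only: RH_YBE2[OF assms(2-4)])
qed


subsection \<open>The image of the fusing matrix\<close>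

text \<open>At this point c(x S N/Z) = -c(Z) and c(x S Z/N) = -c(N^2/Z), so each row of
  \<open>ell\<close> sums to 0, while a vector in the image of \<open>Eh\<close> is constant along
  the sum.\<close>

lemma R_E_zero:
  assumes "n \<ge> 1" "p \<noteq> t"
  shows "R 1 n p t (1 / S ^ (n + 1)) (E n p t v) = (\<lambda>_. 0)"
proof
  fix i
  let ?x = "1 / S ^ (n + 1)" and ?u = "scl (dg_inv (n + 1) t) v"
  have x: "?x \<noteq> 0" using S_nz by simp
  have "RH n p t ?x (Eh n p t ?u) i = 0"
  proof (cases "i p < 2 \<and> i t \<le> n")
    case True
    have "RH n p t ?x (Eh n p t ?u) i = (\<Sum>a<2. \<sigma> (ell ?x (S ^ n) (S ^ (2 * i t)) (i p) a) * ?u (i(p := 0, t := i p + i t)))"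
      using True assms(2) by (intro RH_eqI) (auto simp: Eh_def fun_eq_iff intro!: arg_cong[of _ _ ?u])
    also have "\<dots> = \<sigma> (\<Sum>a<2. ell ?x (S ^ n) (S ^ (2 * i t)) (i p) a) * ?u (i(p := 0, t := i p + i t))"
      by (simp add: \<sigma>.hom_sum sum_distrib_right)
    also have "(\<Sum>a<2. ell ?x (S ^ n) (S ^ (2 * i t)) (i p) a) = 0"
      using S_nz by (auto simp: sum_less_2 ell_def cfun_def power2_eq_square inverse_eq_divide)
    finally show ?thesis by simp
  qed (auto simp: RH_def)
  then show "R 1 n p t ?x (E n p t v) i = 0"
    unfolding E_explicit[OF assms] R_explicit[OF assms x] by (simp add: scl_def)
qed


text \<open>For 1 <= k <= n the weight space is a plane, the image of E is the line through
  \<open>(e 0, e 1)\<close>, and the R-matrix has rank 1 with this line as kernel. Instead of an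
  inclusion of kernels, the lemma gives the defect of E F as an explicit multiple of an entry of R
  w, so that it can be used modulo an ideal.\<close>

lemma E_F_complement:
  assumes "n \<ge> 1" "p \<noteq> t" "i p < 2" "i t \<le> n"
  shows "\<exists>c j. w i - E n p t (F n p t w) i = c * R 1 n p t (1 / S ^ (n + 1)) w j"
proof -
  let ?x = "1 / S ^ (n + 1)"
  have x: "?x \<noteq> 0" using S_nz by simp
  define k where "k = i p + i t"
  define e where "e a = \<iota> (dscale n (k - a) / dscale (n + 1) k)" for a
  define f where "f a = \<iota> (fF n a k)" for a
  define W where "W a = w (i(p := a, t := k - a))" for a
  have k: "k \<le> n + 1" using assms by (auto simp: k_def)
  have Wi: "W (i p) = w i" by (simp add: W_def k_def)
  have ei: "E n p t (F n p t w) i = \<sigma> (e (i p)) * (\<Sum>a<2. if a \<le> k \<and> k - a \<le> n then \<sigma> (f a) * W a else 0)"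
    using assms k by (auto simp: E_apply[OF assms(1)] F_apply[OF assms(1)] e_def f_def W_def k_def fun_eq_iff
        intro!: arg_cong2[of _ _ _ _ times] sum.cong arg_cong[of _ _ w])
  have fe: "(\<Sum>a<2. if a \<le> k \<and> k - a \<le> n then f a * e a else 0) = 1"
    using arg_cong[OF fF_dscale[OF assms(1) k], of \<iota>]
    by (simp add: \<iota>.hom_sum if_distrib[of \<iota>] f_def e_def hom_distribs cong: if_cong)
  show ?thesis
  proof (cases "1 \<le> k \<and> k \<le> n")
    case False
    \<comment> \<open>At the two ends the weight space has dimension 1 and E F is the identity on
      it.\<close>
    then have c: "(k = 0 \<and> i p = 0) \<or> (k = n + 1 \<and> i p = 1)" using k assms(3,4) unfolding k_def by linarith
    then have "(\<Sum>a<2. if a \<le> k \<and> k - a \<le> n then h a else 0) = h (i p)" for h :: "nat \<Rightarrow> 'r"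
      using c assms(1) by (auto simp: sum_less_2)
    moreover have "(\<Sum>a<2. if a \<le> k \<and> k - a \<le> n then h a else 0) = h (i p)" for h :: "nat \<Rightarrow> 'b"
      using c assms(1) by (auto simp: sum_less_2)
    ultimately have "E n p t (F n p t w) i = w i"
      using ei fe Wi by (simp add: mult.commute flip: mult.assoc \<sigma>.hom_mult)
    then have "w i - E n p t (F n p t w) i = 0 * R 1 n p t ?x w i" by simp
    then show ?thesis by blast
  next
    case True
    \<comment> \<open>In this row the two coefficients of \<open>RH\<close> are opposite, so the
      entry is a multiple of the determinant of \<open>W\<close> and \<open>e\<close>.\<close>
    let ?j = "i(p := 0, t := k)"
    let ?c = "pref n ?x * \<iota> (dscale n k)"
    have km: "k - Suc 0 \<le> n" using True by linarith
    then have nz: "pref n ?x \<noteq> 0" "dscale n k \<noteq> 0" "dscale n (k - 1) \<noteq> 0" "dscale (n + 1) k \<noteq> 0" "cfun (S ^ (2 * k)) \<noteq> 0"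
      using True pref_nz[of n "n + 1"] dscale_nz[of k n] dscale_nz[of "k - 1" n] dscale_nz[of k "n + 1"]
        cfun_S_power_nz(2)[of "2 * k"] by (simp_all del: One_nat_def)
    have e: "e 0 \<noteq> 0" "e 1 \<noteq> 0" using nz by (auto simp: e_def)
    have R: "R 1 n p t ?x w ?j = \<sigma> (pref n ?x * cfun (S ^ (2 * k)) / e 1) * (\<sigma> (e 0) * W 1 - \<sigma> (e 1) * W 0)"
    proof -
      have "R 1 n p t ?x w ?j = \<sigma> ?c * RH n p t ?x (scl (dg_inv n t) w) ?j"
        unfolding R_explicit'[OF assms(1,2) x] by (simp only: scl_def fun_upd_same)
      also have "RH n p t ?x (scl (dg_inv n t) w) ?j
          = (\<Sum>a<2. \<sigma> (ell ?x (S ^ n) (S ^ (2 * (?j t))) (?j p) a) * (\<sigma> (\<iota> (inverse (dscale n (k - a)))) * W a))"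
        using True assms(2) by (intro RH_eqI) (auto simp: scl_def W_def fun_eq_iff intro!: arg_cong[of _ _ w])
      also have "\<sigma> ?c * \<dots> = \<sigma> ?c * (\<Sum>a<2. \<sigma> (ell ?x (S ^ n) (S ^ (2 * k)) 0 a) * (\<sigma> (\<iota> (inverse (dscale n (k - a)))) * W a))"
        using assms(2) by (simp only: fun_upd_same fun_upd_other[OF assms(2)])
      also have "\<dots> = \<sigma> (?c * - cfun (S ^ (2 * k)) * \<iota> (inverse (dscale n k))) * W 0
          + \<sigma> (?c * cfun (S ^ (2 * k)) * \<iota> (inverse (dscale n (k - 1)))) * W 1"
      proof -
        have "ell ?x (S ^ n) (S ^ (2 * k)) 0 0 = - cfun (S ^ (2 * k))" "ell ?x (S ^ n) (S ^ (2 * k)) 0 1 = cfun (S ^ (2 * k))"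
          using S_nz by (auto simp: ell_def cfun_def inverse_eq_divide)
        then show ?thesis
          by (simp only: sum_less_2 distrib_left diff_zero mult.assoc[symmetric] \<sigma>.hom_mult[symmetric])
      qed
      also have "?c * - cfun (S ^ (2 * k)) * \<iota> (inverse (dscale n k)) = - (pref n ?x * cfun (S ^ (2 * k)) / e 1 * e 1)"
        using nz e by (simp add: \<iota>.hom_inverse)
      also have "?c * cfun (S ^ (2 * k)) * \<iota> (inverse (dscale n (k - 1))) = pref n ?x * cfun (S ^ (2 * k)) / e 1 * e 0"
        using nz by (simp add: e_def \<iota>.hom_inverse \<iota>.hom_mult divide_inverse)
      finally have R: "R 1 n p t ?x w ?j = \<sigma> (- (pref n ?x * cfun (S ^ (2 * k)) / e 1 * e 1)) * W 0
          + \<sigma> (pref n ?x * cfun (S ^ (2 * k)) / e 1 * e 0) * W 1" .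
      have neg: "\<sigma> (- z) = - \<sigma> z" for z
        using \<sigma>.hom_add[of "-z" z] by (simp add: eq_neg_iff_add_eq_0)
      show ?thesis unfolding R neg
        by (simp only: \<sigma>.hom_mult right_diff_distrib mult_minus_left mult.assoc) simp
    qed
    have f1: "f 0 * e 0 + f 1 * e 1 = 1" using fe True km by (simp add: sum_less_2)
    have "\<sigma> (f 0 * e 0 + f 1 * e 1) * y = y" for y by (simp only: f1) simp
    then have y: "\<sigma> (f 0) * (\<sigma> (e 0) * y) + \<sigma> (f 1) * (\<sigma> (e 1) * y) = y" for y
      by (simp add: \<sigma>.hom_add \<sigma>.hom_mult distrib_right mult.assoc)
    have diff: "w i - E n p t (F n p t w) i = W (i p) - \<sigma> (e (i p)) * (\<sigma> (f 0) * W 0 + \<sigma> (f 1) * W 1)"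
      using ei True Wi km by (simp add: sum_less_2)
    \<comment> \<open>Cramer's rule with \<open>f 0 * e 0 + f 1 * e 1 = 1\<close>: the defect is
      \<open>- f 1\<close> or \<open>f 0\<close> times the determinant.\<close>
    obtain c where c: "w i - E n p t (F n p t w) i = c * (\<sigma> (e 0) * W 1 - \<sigma> (e 1) * W 0)"
    proof (cases "i p = 0")
      case True
      have "W 0 - \<sigma> (e 0) * (\<sigma> (f 0) * W 0 + \<sigma> (f 1) * W 1) = (- \<sigma> (f 1)) * (\<sigma> (e 0) * W 1 - \<sigma> (e 1) * W 0)"
        using y[of "W 0"] by (simp add: algebra_simps \<sigma>_commute)
      then show ?thesis using diff True by (intro that[of "- \<sigma> (f 1)"]) simp
    next
      case False
      then have "i p = 1" using assms by linarith
      have "W 1 - \<sigma> (e 1) * (\<sigma> (f 0) * W 0 + \<sigma> (f 1) * W 1) = \<sigma> (f 0) * (\<sigma> (e 0) * W 1 - \<sigma> (e 1) * W 0)"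
        using y[of "W 1"] by (simp add: algebra_simps \<sigma>_commute)
      then show ?thesis using diff \<open>i p = 1\<close> by (intro that[of "\<sigma> (f 0)"]) simp
    qed
    have "\<sigma> (inverse (pref n ?x * cfun (S ^ (2 * k)) / e 1)) * R 1 n p t ?x w ?j = \<sigma> (e 0) * W 1 - \<sigma> (e 1) * W 0"
      unfolding R using nz e by (simp flip: mult.assoc \<sigma>.hom_mult)
    then show ?thesis unfolding c by (intro exI[of _ "c * \<sigma> (inverse (pref n ?x * cfun (S ^ (2 * k)) / e 1))"] exI[of _ ?j])
        (simp only: mult.assoc)
  qed
qed


lemma E_F_cong:
  assumes J: "two_sided_ideal J" and "n \<ge> 1" "p \<noteq> t"
    and w: "\<And>i. \<not> (i p < 2 \<and> i t \<le> n) \<Longrightarrow> w i = 0"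
    and R0: "vec_cong J (R 1 n p t (1 / S ^ (n + 1)) w) (\<lambda>_. 0)"
  shows "vec_cong J (E n p t (F n p t w)) w"
  unfolding vec_cong_def
proof
  fix i
  have "w i - E n p t (F n p t w) i \<in> J"
  proof (cases "i p < 2 \<and> i t \<le> n")
    case True
    then obtain c j where "w i - E n p t (F n p t w) i = c * R 1 n p t (1 / S ^ (n + 1)) w j"
      using E_F_complement[of n p t i w] assms by blast
    then show ?thesis using R0 two_sided_idealD(3)[OF J] by (simp add: vec_cong_def)
  next
    case False
    then have "w i = 0" "E n p t (F n p t w) i = 0" using w assms(2) by (auto simp: E_apply)
    then show ?thesis using two_sided_idealD(1)[OF J] by simp
  qed
  then show "E n p t (F n p t w) i - w i \<in> J" using two_sided_idealD(5)[OF J] by fastforce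
qed

lemma ideal_0: "two_sided_ideal {0 :: 'r}"
  by (auto simp: two_sided_ideal_def)

lemma vec_cong_0_iff: "vec_cong {0} v w \<longleftrightarrow> v = w" for v w :: "(nat \<Rightarrow> nat) \<Rightarrow> 'r"
  by (auto simp: vec_cong_def fun_eq_iff)

lemma op2_zero: "op2 d e p t M (\<lambda>_. 0) = (\<lambda>_. 0 :: 'r)"
  by (simp add: op2_def fun_eq_iff)

lemma R_zero: "R m n p t x (\<lambda>_. 0) = (\<lambda>_. 0)"
  unfolding R_def by (rule op2_zero)

lemma op1_zero: "op1 d p M (\<lambda>_. 0) = (\<lambda>_. 0 :: 'r)"
  by (simp add: op1_def fun_eq_iff)

lemma E_cong:
  assumes "\<And>i. i p = 0 \<Longrightarrow> v i = w i" "p \<noteq> t"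
  shows "E n p t v = E n p t w"
  unfolding E_def using assms by (intro ext op2_cong) auto


subsection \<open>Commuting operators\<close>

text \<open>Entries of a matrix beyond its columns are unspecified, so their centrality is unknown;
  the operator never reads them.\<close>

lemma op2_restrict:
  "op2 d e p t M = op2 d e p t (\<lambda>a b a' b'. if a' < d \<and> b' < e then M a b a' b' else (0 :: 'r))"
  by (auto simp: op2_def fun_eq_iff intro!: sum.cong)

lemma ker2_central:
  assumes "M \<in> carrier_mat (d * e) (d' * e')" "a' < d'" "b' < e'"
  shows "ker2 d e e' (map_mat \<sigma> M) a b a' b' * y = y * ker2 d e e' (map_mat \<sigma> M) a b a' b'"
  using assms digit_less[of a d b e] digit_less[of a' d' b' e'] by (auto simp: ker2_def central)

lemma central_op2_commute:
  assumes "M \<in> carrier_mat (d * e) (d' * e')" "p \<noteq> r" "p \<noteq> z" "t \<noteq> r" "t \<noteq> z"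
  shows "op2 d' e' p t (ker2 d e e' (map_mat \<sigma> M)) (op2 f g r z N v)
       = op2 f g r z N (op2 d' e' p t (ker2 d e e' (map_mat \<sigma> M)) v)"
  unfolding op2_restrict[of d' e' p t "ker2 d e e' (map_mat \<sigma> M)"]
  by (rule op2_op2_commute[OF assms(2-5)]) (simp add: ker2_central[OF assms(1)])

lemma central_op1_commute:
  assumes "M \<in> carrier_mat (d * e) (d' * e')" "p \<noteq> r" "t \<noteq> r"
  shows "op2 d' e' p t (ker2 d e e' (map_mat \<sigma> M)) (op1 f r N v)
       = op1 f r N (op2 d' e' p t (ker2 d e e' (map_mat \<sigma> M)) v)"
  unfolding op2_restrict[of d' e' p t "ker2 d e e' (map_mat \<sigma> M)"] using assms
  by (intro op1_op2_commute[symmetric]) (auto simp: ker2_central[OF assms(1)])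

lemma R_op2_commute:
  "p \<noteq> r \<Longrightarrow> p \<noteq> z \<Longrightarrow> t \<noteq> r \<Longrightarrow> t \<noteq> z \<Longrightarrow> R m n p t x (op2 f g r z N v) = op2 f g r z N (R m n p t x v)"
  unfolding R_def by (rule central_op2_commute[OF R_fused_carrier])

lemma R_op1_commute:
  "p \<noteq> r \<Longrightarrow> t \<noteq> r \<Longrightarrow> R m n p t x (op1 f r N v) = op1 f r N (R m n p t x v)"
  unfolding R_def by (rule central_op1_commute[OF R_fused_carrier])

lemma R_R_commute:
  "p \<noteq> r \<Longrightarrow> p \<noteq> z \<Longrightarrow> t \<noteq> r \<Longrightarrow> t \<noteq> z \<Longrightarrow> R m n p t x (R m' n' r z y v) = R m' n' r z y (R m n p t x v)"
  unfolding R_def[of m' n'] by (rule R_op2_commute)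

lemma E_carrier: "map_mat \<iota> (fuse_E q B n) \<in> carrier_mat (2 * (n + 1)) (1 * (n + 2))"
  using fuse_E_carrier[of q B n] by auto

lemma E_R_commute:
  "p \<noteq> r \<Longrightarrow> p \<noteq> z \<Longrightarrow> t \<noteq> r \<Longrightarrow> t \<noteq> z \<Longrightarrow> E n p t (R m' n' r z y v) = R m' n' r z y (E n p t v)"
  unfolding E_def map_mat_\<sigma>\<iota>[symmetric] R_def[of m' n'] by (rule central_op2_commute[OF E_carrier])

lemma E_op1_commute:
  "p \<noteq> r \<Longrightarrow> t \<noteq> r \<Longrightarrow> E n p t (op1 f r N v) = op1 f r N (E n p t v)"
  unfolding E_def map_mat_\<sigma>\<iota>[symmetric] by (rule central_op1_commute[OF E_carrier])

text \<open>F is a left inverse of E, but it returns only the part with auxiliary coordinate 0. As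
  \<open>f\<close> and \<open>g\<close> do not act on that position, the other parts follow by
  freezing the coordinate.\<close>

lemma E_cancel:
  assumes J: "two_sided_ideal J" and n: "n \<ge> 1" "p \<noteq> t"
    and cong: "\<And>v. vec_cong J (E n p t (f v)) (E n p t (g v))"
    and upd: "\<And>v c. f (\<lambda>i. v (i(p := c))) = (\<lambda>i. f v (i(p := c)))" "\<And>v c. g (\<lambda>i. v (i(p := c))) = (\<lambda>i. g v (i(p := c)))"
    and supp: "\<And>v i. i t > n + 1 \<Longrightarrow> f v i = 0" "\<And>v i. i t > n + 1 \<Longrightarrow> g v i = 0"
  shows "vec_cong J (f v) (g v)"
  unfolding vec_cong_def
proof
  fix i
  show "f v i - g v i \<in> J"
  proof (cases "i t \<le> n + 1")
    case True
    let ?v = "\<lambda>j. v (j(p := i p))" and ?i = "i(p := 0)"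
    have "vec_cong J (F n p t (E n p t (f ?v))) (F n p t (E n p t (g ?v)))"
      unfolding F_def by (intro vec_cong_op2 J cong)
    then have "F n p t (E n p t (f ?v)) ?i - F n p t (E n p t (g ?v)) ?i \<in> J"
      by (simp add: vec_cong_def)
    moreover have "f ?v ?i = f v i" "g ?v ?i = g v i"
      using fun_cong[OF upd(1)[of v "i p"], of ?i] fun_cong[OF upd(2)[of v "i p"], of ?i] by simp_all
    ultimately show ?thesis using True n(2) by (simp add: FE_apply[OF n])
  qed (use supp two_sided_idealD(1)[OF J] in auto)
qed



lemma R_supp: "i p > m \<or> i t > n \<Longrightarrow> R m n p t x v i = 0"
  by (auto simp: R_def op2_def ker2_def)

text \<open>A coordinate on which the operator does not act keeps its value, so vanishing at
  out-of-range values passes through.\<close>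

lemma R_supp_other:
  assumes "z \<noteq> p" "z \<noteq> t" "\<And>j. j z = i z \<Longrightarrow> v j = 0"
  shows "R m n p t x v i = 0"
  using assms by (simp add: R_def op2_def)

subsection \<open>Yang-Baxter equations of the fused R-matrices\<close>

definition YBE1 :: "nat \<Rightarrow> nat \<Rightarrow> bool" where
  "YBE1 m n \<longleftrightarrow> (\<forall>p t r x y v. distinct [p, t, r] \<longrightarrow> x \<noteq> 0 \<longrightarrow> y \<noteq> 0 \<longrightarrow>
     R 1 m p t x (R 1 n p r (x * y) (R m n t r y v)) = R m n t r y (R 1 n p r (x * y) (R 1 m p t x v)))"

definition YBE2 :: "nat \<Rightarrow> nat \<Rightarrow> bool" where
  "YBE2 m n \<longleftrightarrow> (\<forall>p t r x y v. distinct [p, t, r] \<longrightarrow> x \<noteq> 0 \<longrightarrow> y \<noteq> 0 \<longrightarrow>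
     R m n t r y (R 1 m p t x (R 1 n p r (x / y) v)) = R 1 n p r (x / y) (R 1 m p t x (R m n t r y v)))"

text \<open>The third argument is tied to \<open>x\<close> and \<open>y\<close> by an equation, so
  that the rule matches whatever form it has.\<close>

lemma YBE1D: "YBE1 m n \<Longrightarrow> distinct [p, t, r] \<Longrightarrow> x \<noteq> 0 \<Longrightarrow> y \<noteq> 0 \<Longrightarrow> w = x * y \<Longrightarrow>
   R 1 m p t x (R 1 n p r w (R m n t r y v)) = R m n t r y (R 1 n p r w (R 1 m p t x v))"
  unfolding YBE1_def by blast

lemma YBE2D: "YBE2 m n \<Longrightarrow> distinct [p, t, r] \<Longrightarrow> x \<noteq> 0 \<Longrightarrow> y \<noteq> 0 \<Longrightarrow> w = x / y \<Longrightarrow>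
   R m n t r y (R 1 m p t x (R 1 n p r w v)) = R 1 n p r w (R 1 m p t x (R m n t r y v))"
  unfolding YBE2_def by blast

text \<open>The shifted arguments satisfy \<open>x / S ^ m = (1 / S ^ (m + 1)) * (x * S)\<close>, so
  the Yang-Baxter equation brings the degenerate R-matrix next to E, which it annihilates. Hence the
  product preserves the image of E.\<close>

lemma R_fused_fusable:
  assumes Y: "YBE1 m n" and "m \<ge> 1" "distinct [p, t, r]" "x \<noteq> 0"
  shows "E m p t (R (m + 1) n t r x v) = R 1 n p r (x / S ^ m) (R m n t r (x * S) (E m p t v))"
proof -
  define w where "w = R 1 n p r (x / S ^ m) (R m n t r (x * S) (E m p t v))"
  have pt: "p \<noteq> t" using assms(3) by simp
  have "R 1 m p t (1 / S ^ (m + 1)) w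
      = R m n t r (x * S) (R 1 n p r (x / S ^ m) (R 1 m p t (1 / S ^ (m + 1)) (E m p t v)))"
    unfolding w_def using assms S_nz by (intro YBE1D) auto
  also have "\<dots> = (\<lambda>_. 0)"
    by (simp only: R_E_zero[OF assms(2) pt] R_zero)
  finally have "R 1 m p t (1 / S ^ (m + 1)) w = (\<lambda>_. 0)" .
  moreover have "w i = 0" if "\<not> (i p < 2 \<and> i t \<le> m)" for i
    using that assms(3) by (auto simp: w_def R_def op2_def ker2_def)
  ultimately have "E m p t (F m p t w) = w"
    using E_F_cong[OF ideal_0 assms(2) pt, of w] unfolding vec_cong_0_iff by blast
  moreover have "E m p t (R (m + 1) n t r x v) = E m p t (F m p t w)"
    using R_fused_fusion[OF assms(3) _ assms(2), of _ n x v] pt unfolding w_def by (intro E_cong) auto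
  ultimately show ?thesis by (simp add: w_def)
qed

text \<open>The middle factor splits into arguments \<open>y / S ^ m\<close> and
  \<open>y * S\<close>. In the first equation the shifts of \<open>x\<close> have to compensate
  those of \<open>y\<close> in x y, in the second they have to cancel in x / y. This decides between
  \<open>R_fusion_left\<close> and \<open>R_fusion_right\<close>.\<close>

lemma YBE_fusion:
  assumes Y: "YBE1 m n" "YBE2 m n" "YBE1 1 n" "YBE2 1 n" and mn: "m \<ge> 1"
  shows "YBE1 (m + 1) n \<and> YBE2 (m + 1) n"
proof -
  have "R 1 (m + 1) p t x (R 1 n p r (x * y) (R (m + 1) n t r y v)) = R (m + 1) n t r y (R 1 n p r (x * y) (R 1 (m + 1) p t x v))
      \<and> R (m + 1) n t r y (R 1 (m + 1) p t x (R 1 n p r (x / y) v)) = R 1 n p r (x / y) (R 1 (m + 1) p t x (R (m + 1) n t r y v))"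
    if d: "distinct [p, t, r]" and nz: "x \<noteq> 0" "y \<noteq> 0" for p t r x y v
  proof -
    define z where "z = p + t + r + 1"
    have z: "z \<noteq> p" "z \<noteq> t" "z \<noteq> r" "p \<noteq> z" "t \<noteq> z" "r \<noteq> z" by (auto simp: z_def)
    have neq: "p \<noteq> t" "p \<noteq> r" "t \<noteq> r" "t \<noteq> p" "r \<noteq> p" "r \<noteq> t" using d by auto
    have dd: "distinct [p, z, t]" "distinct [z, t, r]" "distinct [p, z, r]" using z neq by auto
    note E_left = R_fusion_left[OF mn dd(1), symmetric]
    note E_right = R_fusion_right[OF mn dd(1), symmetric]
    note E_fused = R_fused_fusable[OF Y(1) mn dd(2)]
    note E_pr = E_R_commute[of z p r t m 1 n, OF z(1,3) neq(4,3)]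
    have nz': "x * y \<noteq> 0" "x / y \<noteq> 0" "x * S ^ m \<noteq> 0" "x / S ^ m \<noteq> 0" "y / S ^ m \<noteq> 0" "y * S \<noteq> 0" "x / S \<noteq> 0" "x * S \<noteq> 0"
      using nz S_nz by auto
    note pt_zr = R_R_commute[of p z r t, OF z(4) neq(2) z(5) neq(3)]
    note pz_tr = R_R_commute[of p t r z, OF neq(1,2) z(2,3)]
    let ?f = "\<lambda>v. R 1 (m + 1) p t x (R 1 n p r (x * y) (R (m + 1) n t r y v))"
    let ?g = "\<lambda>v. R (m + 1) n t r y (R 1 n p r (x * y) (R 1 (m + 1) p t x v))"
    have YBE1: "vec_cong {0} (?f v) (?g v)"
    proof (rule E_cancel[OF ideal_0 mn z(2), where f = ?f and g = ?g])
      fix v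
      have "E m z t (R 1 (m + 1) p t x (R 1 n p r (x * y) (R (m + 1) n t r y v)))
          = R 1 m p t (x / S) (R 1 1 p z (x * S ^ m) (R 1 n p r (x * y) (R 1 n z r (y / S ^ m) (R m n t r (y * S) (E m z t v)))))"
        using nz nz' by (simp only: E_left[OF nz(1)] E_pr E_fused[OF nz(2)])
      also have "\<dots> = R 1 m p t (x / S) (R 1 n z r (y / S ^ m) (R 1 n p r (x * y) (R 1 1 p z (x * S ^ m) (R m n t r (y * S) (E m z t v)))))"
        using nz nz' S_nz dd by (subst YBE1D[OF Y(3)]) auto
      also have "\<dots> = R 1 n z r (y / S ^ m) (R 1 m p t (x / S) (R 1 n p r (x * y) (R m n t r (y * S) (R 1 1 p z (x * S ^ m) (E m z t v)))))"
        by (simp only: pt_zr pz_tr)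
      also have "\<dots> = R 1 n z r (y / S ^ m) (R m n t r (y * S) (R 1 n p r (x * y) (R 1 m p t (x / S) (R 1 1 p z (x * S ^ m) (E m z t v)))))"
        using nz nz' S_nz d by (subst YBE1D[OF Y(1)]) auto
      also have "\<dots> = E m z t (R (m + 1) n t r y (R 1 n p r (x * y) (R 1 (m + 1) p t x v)))"
        using nz nz' by (simp only: E_left[OF nz(1)] E_pr E_fused[OF nz(2)])
      finally show "vec_cong {0} (E m z t (R 1 (m + 1) p t x (R 1 n p r (x * y) (R (m + 1) n t r y v))))
          (E m z t (R (m + 1) n t r y (R 1 n p r (x * y) (R 1 (m + 1) p t x v))))"
        by (simp only: vec_cong_0_iff)
    next
      show "?f (\<lambda>i. v (i(z := c))) = (\<lambda>i. ?f v (i(z := c)))" for v c by (simp only: R_upd[OF z(1,2)] R_upd[OF z(1,3)] R_upd[OF z(2,3)])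
      show "?g (\<lambda>i. v (i(z := c))) = (\<lambda>i. ?g v (i(z := c)))" for v c by (simp only: R_upd[OF z(1,2)] R_upd[OF z(1,3)] R_upd[OF z(2,3)])
      show "?f v i = 0" if "i t > m + 1" for v i using that by (intro R_supp) auto
      show "?g v i = 0" if "i t > m + 1" for v i using that neq by (intro R_supp) auto
    qed
    let ?f = "\<lambda>v. R (m + 1) n t r y (R 1 (m + 1) p t x (R 1 n p r (x / y) v))"
    let ?g = "\<lambda>v. R 1 n p r (x / y) (R 1 (m + 1) p t x (R (m + 1) n t r y v))"
    have YBE2: "vec_cong {0} (?f v) (?g v)"
    proof (rule E_cancel[OF ideal_0 mn z(2), where f = ?f and g = ?g])
      fix v
      have "E m z t (R (m + 1) n t r y (R 1 (m + 1) p t x (R 1 n p r (x / y) v)))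
          = R 1 n z r (y / S ^ m) (R m n t r (y * S) (R 1 1 p z (x / S ^ m) (R 1 m p t (x * S) (R 1 n p r (x / y) (E m z t v)))))"
        using nz nz' by (simp only: E_right[OF nz(1)] E_pr E_fused[OF nz(2)])
      also have "\<dots> = R 1 n z r (y / S ^ m) (R 1 1 p z (x / S ^ m) (R m n t r (y * S) (R 1 m p t (x * S) (R 1 n p r (x / y) (E m z t v)))))"
        by (simp only: pz_tr)
      also have "\<dots> = R 1 n z r (y / S ^ m) (R 1 1 p z (x / S ^ m) (R 1 n p r (x / y) (R 1 m p t (x * S) (R m n t r (y * S) (E m z t v)))))"
        using nz nz' S_nz d by (subst YBE2D[OF Y(2)]) auto
      also have "\<dots> = R 1 n p r (x / y) (R 1 1 p z (x / S ^ m) (R 1 n z r (y / S ^ m) (R 1 m p t (x * S) (R m n t r (y * S) (E m z t v)))))"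
        using nz nz' S_nz dd by (subst YBE2D[OF Y(4)]) auto
      also have "\<dots> = R 1 n p r (x / y) (R 1 1 p z (x / S ^ m) (R 1 m p t (x * S) (R 1 n z r (y / S ^ m) (R m n t r (y * S) (E m z t v)))))"
        by (simp only: pt_zr)
      also have "\<dots> = E m z t (R 1 n p r (x / y) (R 1 (m + 1) p t x (R (m + 1) n t r y v)))"
        using nz nz' by (simp only: E_right[OF nz(1)] E_pr E_fused[OF nz(2)])
      finally show "vec_cong {0} (E m z t (R (m + 1) n t r y (R 1 (m + 1) p t x (R 1 n p r (x / y) v))))
          (E m z t (R 1 n p r (x / y) (R 1 (m + 1) p t x (R (m + 1) n t r y v))))"
        by (simp only: vec_cong_0_iff)
    next
      show "?f (\<lambda>i. v (i(z := c))) = (\<lambda>i. ?f v (i(z := c)))" for v c by (simp only: R_upd[OF z(1,2)] R_upd[OF z(1,3)] R_upd[OF z(2,3)])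
      show "?g (\<lambda>i. v (i(z := c))) = (\<lambda>i. ?g v (i(z := c)))" for v c by (simp only: R_upd[OF z(1,2)] R_upd[OF z(1,3)] R_upd[OF z(2,3)])
      show "?f v i = 0" if "i t > m + 1" for v i using that by (intro R_supp) auto
      show "?g v i = 0" if "i t > m + 1" for v i using that neq by (subst R_supp_other[of t p r]) (simp_all add: R_supp)
    qed
    show ?thesis using YBE1 YBE2 by (simp only: vec_cong_0_iff)
  qed
  then show ?thesis unfolding YBE1_def YBE2_def by blast
qed

lemma YBE:
  assumes "m \<ge> 1" "n \<ge> 1"
  shows "YBE1 m n" "YBE2 m n"
proof -
  have base: "YBE1 1 n" "YBE2 1 n"
    unfolding YBE1_def YBE2_def using R_YBE1_half[OF assms(2)] R_YBE2_half[OF assms(2)] by blast+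
  have "YBE1 m n \<and> YBE2 m n"
    using assms(1)
  proof (induction m rule: nat_induct_at_least)
    case (Suc m)
    then show ?case using YBE_fusion[of m n] base by simp
  qed (use base in simp)
  then show "YBE1 m n" "YBE2 m n" by auto
qed


section \<open>Reflection equations\<close>

definition Kop :: "nat \<Rightarrow> 'r mat \<Rightarrow> nat \<Rightarrow> ((nat \<Rightarrow> nat) \<Rightarrow> 'r) \<Rightarrow> (nat \<Rightarrow> nat) \<Rightarrow> 'r" where
  "Kop n k p = op1 (n + 1) p (ker1 (n + 1) k)"

text \<open>In the following \<open>k n c\<close> stands for the K-operator of spin \<open>n/2\<close> at the point \<open>c u\<close>.\<close>

definition reflection :: "'r set \<Rightarrow> 'b \<Rightarrow> 'b \<Rightarrow> (nat \<Rightarrow> complex \<Rightarrow> 'r mat) \<Rightarrow> (nat \<Rightarrow> complex \<Rightarrow> 'r mat)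
    \<Rightarrow> nat \<Rightarrow> nat \<Rightarrow> bool" where
  "reflection J u1 u2 k1 k2 m n \<longleftrightarrow> (\<forall>c d a b p t v. c \<noteq> 0 \<longrightarrow> d \<noteq> 0 \<longrightarrow> a = u1 * \<iota> c \<longrightarrow> b = u2 * \<iota> d \<longrightarrow> p \<noteq> t \<longrightarrow>
     vec_cong J (R m n p t (a / b) (Kop m (k1 m c) p (R m n p t (a * b) (Kop n (k2 n d) t v))))
       (Kop n (k2 n d) t (R m n p t (a * b) (Kop m (k1 m c) p (R m n p t (a / b) v)))))"

text \<open>The content is that the projection by F, which belongs to the recursion, may be dropped
  behind E. The argument of R is the product of the points \<open>u c / S ^ n\<close> and
  \<open>u c S\<close> of the two K-operators.\<close>

definition fusable :: "'r set \<Rightarrow> 'b \<Rightarrow> (nat \<Rightarrow> complex \<Rightarrow> 'r mat) \<Rightarrow> nat \<Rightarrow> bool" where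
  "fusable J u k n \<longleftrightarrow> (\<forall>c p t v. c \<noteq> 0 \<longrightarrow> p \<noteq> t \<longrightarrow>
     vec_cong J (E n p t (Kop (n + 1) (k (n + 1) c) t v))
       (Kop 1 (k 1 (c / s ^ n)) p (R 1 n p t ((u * \<iota> c)\<^sup>2 * S / S ^ n) (Kop n (k n (c * s)) t (E n p t v)))))"

lemma reflectionD:
  "reflection J u1 u2 k1 k2 m n \<Longrightarrow> c \<noteq> 0 \<Longrightarrow> d \<noteq> 0 \<Longrightarrow> a = u1 * \<iota> c \<Longrightarrow> b = u2 * \<iota> d \<Longrightarrow> p \<noteq> t \<Longrightarrow>
     x = a / b \<Longrightarrow> y = a * b \<Longrightarrow>
     vec_cong J (R m n p t x (Kop m (k1 m c) p (R m n p t y (Kop n (k2 n d) t v))))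
       (Kop n (k2 n d) t (R m n p t y (Kop m (k1 m c) p (R m n p t x v))))"
  unfolding reflection_def by blast

lemma fusableD:
  "fusable J u k n \<Longrightarrow> c \<noteq> 0 \<Longrightarrow> p \<noteq> t \<Longrightarrow> x = (u * \<iota> c)\<^sup>2 * S / S ^ n \<Longrightarrow>
     vec_cong J (E n p t (Kop (n + 1) (k (n + 1) c) t v))
       (Kop 1 (k 1 (c / s ^ n)) p (R 1 n p t x (Kop n (k n (c * s)) t (E n p t v))))"
  unfolding fusable_def by blast

lemma vec_cong_R: "two_sided_ideal J \<Longrightarrow> vec_cong J v w \<Longrightarrow> vec_cong J (R m n p t x v) (R m n p t x w)"
  unfolding R_def by (rule vec_cong_op2)

lemma vec_cong_Kop: "two_sided_ideal J \<Longrightarrow> vec_cong J v w \<Longrightarrow> vec_cong J (Kop n k p v) (Kop n k p w)"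
  unfolding Kop_def by (rule vec_cong_op1)

lemma R_Kop_commute: "p \<noteq> r \<Longrightarrow> t \<noteq> r \<Longrightarrow> R m n p t x (Kop l k r v) = Kop l k r (R m n p t x v)"
  unfolding Kop_def by (rule R_op1_commute)

lemma E_Kop_commute: "p \<noteq> r \<Longrightarrow> t \<noteq> r \<Longrightarrow> E n p t (Kop l k r v) = Kop l k r (E n p t v)"
  unfolding Kop_def by (rule E_op1_commute)

lemma Kop_upd: "z \<noteq> p \<Longrightarrow> Kop n k p (\<lambda>i. v (i(z := c))) = (\<lambda>i. Kop n k p v (i(z := c)))"
  unfolding Kop_def by (rule op1_upd)

lemma Kop_supp: "i p > n \<Longrightarrow> Kop n k p v i = 0"
  by (auto simp: Kop_def op1_def ker1_def)

lemma Kop_supp_other: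
  assumes "z \<noteq> p" "\<And>j. j z = i z \<Longrightarrow> v j = 0"
  shows "Kop n k p v i = 0"
  using assms by (simp add: Kop_def op1_def)

text \<open>Behind E the second factor splits into spin 1/2 at \<open>b1\<close> and spin n/2 at
  \<open>b2\<close>. These pass the K-operator of the first factor one after the other, and
  \<open>R 1 n z t (b1 * b2)\<close>, which the fusion of the K-operator leaves between them, is
  carried through by \<open>Y1\<close> and \<open>Y2\<close>.\<close>

lemma reflection_fusion_right:
  assumes J: "two_sided_ideal J" and n: "n \<ge> 1" and u: "u1 \<noteq> 0" "u2 \<noteq> 0"
    and re: "reflection J u1 u2 k1 k2 1 1" "reflection J u1 u2 k1 k2 1 n"
    and fus: "fusable J u2 k2 n"
  shows "reflection J u1 u2 k1 k2 1 (n + 1)"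
  unfolding reflection_def
proof (intro allI impI)
  fix c d a b v and p t :: nat
  assume cd: "c \<noteq> 0" "d \<noteq> 0" and ab: "a = u1 * \<iota> c" "b = u2 * \<iota> d" and pt: "p \<noteq> t"
  define z where "z = p + t + 1"
  have z: "z \<noteq> p" "z \<noteq> t" "p \<noteq> z" "t \<noteq> z" by (auto simp: z_def)
  have tp: "t \<noteq> p" using pt by simp
  have d: "distinct [p, z, t]" using z pt by auto
  define b1 b2 where "b1 = u2 * \<iota> (d / s ^ n)" and "b2 = u2 * \<iota> (d * s)"
  have b12: "b1 = b / S ^ n" "b2 = b * S"
    by (simp_all add: b1_def b2_def ab S_def divide_inverse \<iota>.hom_mult \<iota>.hom_inverse \<iota>.hom_power mult_ac)
  have nz: "a \<noteq> 0" "b \<noteq> 0" "b1 \<noteq> 0" "b2 \<noteq> 0" "a / b \<noteq> 0" "a * b \<noteq> 0"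
    using u cd S_nz by (auto simp: ab b12)
  have args: "a / b / S = a / b2" "a / b * S ^ n = a / b1" "a * b / S ^ n = a * b1" "a * b * S = a * b2"
      "(u2 * \<iota> d)\<^sup>2 * S / S ^ n = b1 * b2"
    using nz S_nz by (simp_all add: b12 ab power2_eq_square)
  let ?K = "Kop 1 (k1 1 c) p" and ?L = "Kop (n + 1) (k2 (n + 1) d) t"
  let ?L1 = "Kop 1 (k2 1 (d / s ^ n)) z" and ?Ln = "Kop n (k2 n (d * s)) t"
  let ?f = "\<lambda>v. R 1 (n + 1) p t (a / b) (?K (R 1 (n + 1) p t (a * b) (?L v)))"
  let ?g = "\<lambda>v. ?L (R 1 (n + 1) p t (a * b) (?K (R 1 (n + 1) p t (a / b) v)))"
  note E_left = R_fusion_left[OF n d nz(5), symmetric, unfolded args]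
  note E_right = R_fusion_right[OF n d nz(6), symmetric, unfolded args]
  note E_K = E_Kop_commute[of z p t, OF z(1) tp]
  note cong = vec_cong_R[OF J] vec_cong_Kop[OF J] and [trans] = vec_cong_trans[OF J]
  have s_pow: "d / s ^ n \<noteq> 0" "d * s \<noteq> 0" using cd s_nz by auto
  show "vec_cong J (?f v) (?g v)"
  proof (rule E_cancel[OF J n z(2), where f = ?f and g = ?g])
    fix v
    let ?v = "E n z t v"
    \<comment> \<open>The arguments fit since (a / b1) (b1 b2) = a b2; in \<open>Y2\<close> since (a
      b1) / (b1 b2) = a / b2.\<close>
    have Y1: "R 1 1 p z (a / b1) (R 1 n p t (a * b2) (R 1 n z t (b1 * b2) w))
        = R 1 n z t (b1 * b2) (R 1 n p t (a * b2) (R 1 1 p z (a / b1) w))" for w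
      using nz by (intro YBE1D[OF YBE(1)[OF order.refl n] d]) auto
    have Y2: "R 1 n z t (b1 * b2) (R 1 1 p z (a * b1) (R 1 n p t (a / b2) w))
        = R 1 n p t (a / b2) (R 1 1 p z (a * b1) (R 1 n z t (b1 * b2) w))" for w
      using nz by (intro YBE2D[OF YBE(2)[OF order.refl n] d]) auto
    have "vec_cong J (E n z t (?f v))
        (R 1 n p t (a / b2) (R 1 1 p z (a / b1) (?K (R 1 1 p z (a * b1) (?L1 (R 1 n p t (a * b2)
          (R 1 n z t (b1 * b2) (?Ln ?v))))))))"
      unfolding E_left E_K E_right R_Kop_commute[OF z(3,4), symmetric]
      by (intro cong fusableD[OF fus cd(2) z(2)]) (simp add: args)
    also have "vec_cong J \<dots>
        (R 1 n p t (a / b2) (?L1 (R 1 1 p z (a * b1) (?K (R 1 1 p z (a / b1) (R 1 n p t (a * b2)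
          (R 1 n z t (b1 * b2) (?Ln ?v))))))))"
      by (intro cong reflectionD[OF re(1) cd(1) s_pow(1) ab(1) b1_def z(3)]) auto
    also have "\<dots> = ?L1 (R 1 n z t (b1 * b2) (R 1 1 p z (a * b1) (R 1 n p t (a / b2) (?K (R 1 n p t (a * b2)
          (?Ln (R 1 1 p z (a / b1) ?v)))))))"
      by (simp only: Y1 Y2 R_Kop_commute[OF z(3,4)] R_Kop_commute[OF z(1) tp] R_Kop_commute[OF pt z(2), symmetric])
    also have "vec_cong J \<dots> (?L1 (R 1 n z t (b1 * b2) (R 1 1 p z (a * b1) (?Ln (R 1 n p t (a * b2) (?K (R 1 n p t (a / b2)
          (R 1 1 p z (a / b1) ?v))))))))"
      by (intro cong reflectionD[OF re(2) cd(1) s_pow(2) ab(1) b2_def pt]) auto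
    also have "\<dots> = ?L1 (R 1 n z t (b1 * b2) (?Ln (E n z t (R 1 (n + 1) p t (a * b) (?K (R 1 (n + 1) p t (a / b) v))))))"
      by (simp only: E_left E_K E_right R_Kop_commute[OF pt z(2)])
    also have "vec_cong J \<dots> (E n z t (?g v))"
      by (rule vec_cong_sym[OF J], rule fusableD[OF fus cd(2) z(2)]) (simp add: args)
    finally show "vec_cong J (E n z t (?f v)) (E n z t (?g v))" .
  next
    show "?f (\<lambda>i. v (i(z := c))) = (\<lambda>i. ?f v (i(z := c)))" for v c
      by (simp only: R_upd[OF z(1,2)] Kop_upd[OF z(1)] Kop_upd[OF z(2)])
    show "?g (\<lambda>i. v (i(z := c))) = (\<lambda>i. ?g v (i(z := c)))" for v c
      by (simp only: R_upd[OF z(1,2)] Kop_upd[OF z(1)] Kop_upd[OF z(2)])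
    show "?f v i = 0" if "i t > n + 1" for v i using that by (intro R_supp) auto
    show "?g v i = 0" if "i t > n + 1" for v i using that by (intro Kop_supp) auto
  qed
qed


text \<open>The fused argument \<open>a\<close> enters a / b and a b with the same exponent, so both
  R-matrices expand by \<open>R_fused_fusable\<close> in the same order, and \<open>YBE2\<close>
  carries \<open>R 1 m z t (a1 * a2)\<close> past both.\<close>

lemma reflection_fusion_left:
  assumes J: "two_sided_ideal J" and mn: "m \<ge> 1" "n \<ge> 1" and u: "u1 \<noteq> 0" "u2 \<noteq> 0"
    and re: "reflection J u1 u2 k1 k2 1 n" "reflection J u1 u2 k1 k2 m n"
    and fus: "fusable J u1 k1 m"
  shows "reflection J u1 u2 k1 k2 (m + 1) n"
  unfolding reflection_def
proof (intro allI impI)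
  fix c d a b v and t r :: nat
  assume cd: "c \<noteq> 0" "d \<noteq> 0" and ab: "a = u1 * \<iota> c" "b = u2 * \<iota> d" and tr: "t \<noteq> r"
  define z where "z = t + r + 1"
  have z: "z \<noteq> t" "z \<noteq> r" "t \<noteq> z" "r \<noteq> z" by (auto simp: z_def)
  have rt: "r \<noteq> t" using tr by simp
  have d: "distinct [z, t, r]" using z tr by auto
  define a1 a2 where "a1 = u1 * \<iota> (c / s ^ m)" and "a2 = u1 * \<iota> (c * s)"
  have a12: "a1 = a / S ^ m" "a2 = a * S"
    by (simp_all add: a1_def a2_def ab S_def divide_inverse \<iota>.hom_mult \<iota>.hom_inverse \<iota>.hom_power mult_ac)
  have nz: "a \<noteq> 0" "b \<noteq> 0" "a1 \<noteq> 0" "a2 \<noteq> 0" "a / b \<noteq> 0" "a * b \<noteq> 0"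
    using u cd S_nz by (auto simp: ab a12)
  have args: "a / b / S ^ m = a1 / b" "a / b * S = a2 / b" "a * b / S ^ m = a1 * b" "a * b * S = a2 * b"
      "(u1 * \<iota> c)\<^sup>2 * S / S ^ m = a1 * a2"
    using nz S_nz by (simp_all add: a12 ab power2_eq_square mult_ac)
  let ?K = "Kop (m + 1) (k1 (m + 1) c) t" and ?L = "Kop n (k2 n d) r"
  let ?K1 = "Kop 1 (k1 1 (c / s ^ m)) z" and ?Km = "Kop m (k1 m (c * s)) t"
  let ?f = "\<lambda>v. R (m + 1) n t r (a / b) (?K (R (m + 1) n t r (a * b) (?L v)))"
  let ?g = "\<lambda>v. ?L (R (m + 1) n t r (a * b) (?K (R (m + 1) n t r (a / b) v)))"
  note E_R1 = R_fused_fusable[OF YBE(1)[OF mn] mn(1) d nz(5), unfolded args]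
  note E_R2 = R_fused_fusable[OF YBE(1)[OF mn] mn(1) d nz(6), unfolded args]
  note E_L = E_Kop_commute[of z r t, OF z(2) tr]
  note cong = vec_cong_R[OF J] vec_cong_Kop[OF J] and [trans] = vec_cong_trans[OF J]
  have s_pow: "c / s ^ m \<noteq> 0" "c * s \<noteq> 0" using cd s_nz by auto
  have t_z: "R m n t r x (Kop l k z w) = Kop l k z (R m n t r x w)" for x l k w
    by (rule R_Kop_commute[OF z(3,4)])
  have zr_t: "R 1 n z r x (Kop l k t w) = Kop l k t (R 1 n z r x w)" for x l k w
    by (rule R_Kop_commute[OF z(1) rt])
  have zt_r: "R 1 m z t x (Kop l k r w) = Kop l k r (R 1 m z t x w)" for x l k w
    by (rule R_Kop_commute[OF z(2) tr])
  show "vec_cong J (?f v) (?g v)"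
  proof (rule E_cancel[OF J mn(1) z(1), where f = ?f and g = ?g])
    fix v
    let ?v = "E m z t v"
    have Y: "R m n t r (a2 / b) (R 1 m z t (a1 * a2) (R 1 n z r (a1 * b) w))
        = R 1 n z r (a1 * b) (R 1 m z t (a1 * a2) (R m n t r (a2 / b) w))" for w
      using nz by (intro YBE2D[OF YBE(2)[OF mn] d]) auto
    have Y': "R m n t r (a2 * b) (R 1 m z t (a1 * a2) (R 1 n z r (a1 / b) w))
        = R 1 n z r (a1 / b) (R 1 m z t (a1 * a2) (R m n t r (a2 * b) w))" for w
      using nz by (intro YBE2D[OF YBE(2)[OF mn] d]) auto
    have "vec_cong J (E m z t (?f v))
        (R 1 n z r (a1 / b) (R m n t r (a2 / b) (?K1 (R 1 m z t (a1 * a2) (?Km (E m z t (R (m + 1) n t r (a * b) (?L v))))))))"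
      unfolding E_R1
      by (intro cong fusableD[OF fus cd(1) z(1)]) (simp add: args)
    also have "\<dots> = R 1 n z r (a1 / b) (?K1 (R 1 n z r (a1 * b) (R 1 m z t (a1 * a2) (R m n t r (a2 / b) (?Km
        (R m n t r (a2 * b) (?L ?v)))))))"
      by (simp only: E_R2 E_L t_z zr_t[symmetric] Y)
    also have "vec_cong J \<dots> (R 1 n z r (a1 / b) (?K1 (R 1 n z r (a1 * b) (R 1 m z t (a1 * a2) (?L (R m n t r (a2 * b) (?Km
        (R m n t r (a2 / b) ?v))))))))"
      by (intro cong reflectionD[OF re(2) s_pow(2) cd(2) a2_def ab(2) tr]) auto
    also have "\<dots> = R 1 n z r (a1 / b) (?K1 (R 1 n z r (a1 * b) (?L (R 1 m z t (a1 * a2) (R m n t r (a2 * b) (?Km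
        (R m n t r (a2 / b) ?v)))))))"
      by (simp only: zt_r)
    also have "vec_cong J \<dots> (?L (R 1 n z r (a1 * b) (?K1 (R 1 n z r (a1 / b) (R 1 m z t (a1 * a2) (R m n t r (a2 * b) (?Km
        (R m n t r (a2 / b) ?v))))))))"
      by (intro cong reflectionD[OF re(1) s_pow(1) cd(2) a1_def ab(2) z(2)]) auto
    also have "\<dots> = ?L (R 1 n z r (a1 * b) (R m n t r (a2 * b) (?K1 (R 1 m z t (a1 * a2) (?Km
        (E m z t (R (m + 1) n t r (a / b) v)))))))"
      by (simp only: E_R1 t_z zr_t[symmetric] Y'[symmetric])
    also have "vec_cong J \<dots> (?L (R 1 n z r (a1 * b) (R m n t r (a2 * b) (E m z t (?K (R (m + 1) n t r (a / b) v))))))"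
      by (intro cong, rule vec_cong_sym[OF J], rule fusableD[OF fus cd(1) z(1)]) (simp add: args)
    also have "\<dots> = E m z t (?g v)"
      by (simp only: E_L E_R2)
    finally show "vec_cong J (E m z t (?f v)) (E m z t (?g v))" .
  next
    show "?f (\<lambda>i. v (i(z := c))) = (\<lambda>i. ?f v (i(z := c)))" for v c
      by (simp only: R_upd[OF z(1,2)] Kop_upd[OF z(1)] Kop_upd[OF z(2)])
    show "?g (\<lambda>i. v (i(z := c))) = (\<lambda>i. ?g v (i(z := c)))" for v c
      by (simp only: R_upd[OF z(1,2)] Kop_upd[OF z(1)] Kop_upd[OF z(2)])
    show "?f v i = 0" if "i t > m + 1" for v i using that by (intro R_supp) auto
    show "?g v i = 0" if "i t > m + 1" for v i
      using that tr by (subst Kop_supp_other[of t r]) (simp_all add: R_supp)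
  qed
qed

text \<open>The two points \<open>a\<close> and \<open>b\<close> have the degenerate quotient
  \<open>1 / S ^ (n + 1)\<close>. By the reflection equation R(a / b) applied to the product equals
  an expression in which R(a / b) acts directly on E, which is 0, so \<open>E_F_cong\<close>
  applies.\<close>

lemma fusableI:
  assumes J: "two_sided_ideal J" and n: "n \<ge> 1" and u: "u \<noteq> 0"
    and re: "reflection J u u k k 1 n"
    and rec: "\<And>c p t v i. c \<noteq> 0 \<Longrightarrow> p \<noteq> t \<Longrightarrow> i p = 0 \<Longrightarrow> Kop (n + 1) (k (n + 1) c) t v i
      = F n p t (Kop 1 (k 1 (c / s ^ n)) p (R 1 n p t ((u * \<iota> c)\<^sup>2 * S / S ^ n) (Kop n (k n (c * s)) t (E n p t v)))) i"
  shows "fusable J u k n"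
  unfolding fusable_def
proof (intro allI impI)
  fix c :: complex and v and p t :: nat
  assume c: "c \<noteq> 0" and pt: "p \<noteq> t"
  define a b where "a = u * \<iota> (c / s ^ n)" and "b = u * \<iota> (c * s)"
  have s_pow: "c / s ^ n \<noteq> 0" "c * s \<noteq> 0" using c s_nz by auto
  have ab: "a = u * \<iota> c / S ^ n" "b = u * \<iota> c * S"
    by (simp_all add: a_def b_def S_def divide_inverse \<iota>.hom_mult \<iota>.hom_inverse \<iota>.hom_power mult_ac)
  have args: "1 / S ^ (n + 1) = a / b" "(u * \<iota> c)\<^sup>2 * S / S ^ n = a * b"
    using c u S_nz by (simp_all add: ab power2_eq_square)
  let ?K = "Kop 1 (k 1 (c / s ^ n)) p" and ?L = "Kop n (k n (c * s)) t"
  define w where "w = ?K (R 1 n p t (a * b) (?L (E n p t v)))"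
  have "vec_cong J (R 1 n p t (1 / S ^ (n + 1)) w) (?L (R 1 n p t (a * b) (?K (R 1 n p t (a / b) (E n p t v)))))"
    unfolding w_def args(1) by (rule reflectionD[OF re s_pow a_def b_def pt refl refl])
  also have "\<dots> = (\<lambda>_. 0)"
    unfolding R_E_zero[OF n pt, unfolded args(1)] Kop_def op1_zero R_zero ..
  finally have "vec_cong J (E n p t (F n p t w)) w"
  proof (rule E_F_cong[OF J n pt, rotated])
    show "w i = 0" if "\<not> (i p < 2 \<and> i t \<le> n)" for i
    proof (cases "i p < 2")
      case True
      then show ?thesis using that pt unfolding w_def
        by (subst Kop_supp_other[of t p]) (simp_all add: R_supp)
    qed (simp add: w_def Kop_supp)
  qed
  moreover have "E n p t (Kop (n + 1) (k (n + 1) c) t v) = E n p t (F n p t w)"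
    using rec[OF c pt] pt by (intro E_cong) (simp_all add: w_def args)
  ultimately show "vec_cong J (E n p t (Kop (n + 1) (k (n + 1) c) t v))
       (?K (R 1 n p t ((u * \<iota> c)\<^sup>2 * S / S ^ n) (?L (E n p t v))))"
    by (simp add: w_def args)
qed

text \<open>The reflection equation for spins 1/2, n/2 gives fusability at \<open>n\<close>, and
  this is what raises the equation to \<open>n + 1\<close>; so both run in one induction.\<close>

lemma reflection_one_point:
  assumes J: "two_sided_ideal J" and u: "u \<noteq> 0" and base: "reflection J u u k k 1 1"
    and rec: "\<And>n c p t v i. n \<ge> 1 \<Longrightarrow> c \<noteq> 0 \<Longrightarrow> p \<noteq> t \<Longrightarrow> i p = 0 \<Longrightarrow> Kop (n + 1) (k (n + 1) c) t v i
      = F n p t (Kop 1 (k 1 (c / s ^ n)) p (R 1 n p t ((u * \<iota> c)\<^sup>2 * S / S ^ n) (Kop n (k n (c * s)) t (E n p t v)))) i"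
    and n: "n \<ge> 1"
  shows "fusable J u k n"
proof -
  have fus: "fusable J u k n" if "n \<ge> 1" "reflection J u u k k 1 n" for n
    using that by (intro fusableI[OF J _ u]) (use rec in auto)
  have "reflection J u u k k 1 n"
    using n
  proof (induction n rule: nat_induct_at_least)
    case (Suc n)
    then show ?case
      using reflection_fusion_right[OF J Suc.hyps u u base Suc.IH fus[OF Suc.hyps Suc.IH]] by simp
  qed (use base in simp)
  then show ?thesis using fus n by blast
qed

text \<open>Fusability concerns each variable separately and is already available. The second spin
  is raised while the first is 1/2, since raising the first spin uses the equation with spin 1/2 in
  its place.\<close>

lemma reflection_two_points:
  assumes J: "two_sided_ideal J" and u: "u1 \<noteq> 0" "u2 \<noteq> 0" and base: "reflection J u1 u2 k1 k2 1 1"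
    and fus: "\<And>n. n \<ge> 1 \<Longrightarrow> fusable J u1 k1 n" "\<And>n. n \<ge> 1 \<Longrightarrow> fusable J u2 k2 n"
    and mn: "m \<ge> 1" "n \<ge> 1"
  shows "reflection J u1 u2 k1 k2 m n"
proof -
  have re: "reflection J u1 u2 k1 k2 1 n"
    using mn(2)
  proof (induction n rule: nat_induct_at_least)
    case (Suc n)
    then show ?case
      using reflection_fusion_right[OF J Suc.hyps u base Suc.IH fus(2)[OF Suc.hyps]] by simp
  qed (use base in simp)
  show ?thesis
    using mn(1)
  proof (induction m rule: nat_induct_at_least)
    case (Suc m)
    then show ?case
      using reflection_fusion_left[OF J Suc.hyps mn(2) u re Suc.IH fus(1)[OF Suc.hyps]] by simp
  qed (use re in simp)
qed

end

section \<open>Homomorphisms of Laurent series rings\<close>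

text \<open>The bounds need not be sharp, so one range of summation serves a series and its image
  under a homomorphism.\<close>

lemma fls_times_nth_lower_bound:
  fixes f g :: "'a::{comm_monoid_add, mult_zero} fls"
  assumes f: "\<And>i. i < a \<Longrightarrow> fls_nth f i = 0" and g: "\<And>i. i < b \<Longrightarrow> fls_nth g i = 0"
  shows "fls_nth (f * g) n = (\<Sum>i=a..n - b. fls_nth f i * fls_nth g (n - i))"
proof (cases "f = 0 \<or> g = 0")
  case False
  have "a \<le> fls_subdegree f" "b \<le> fls_subdegree g"
    using False f g by (auto intro!: fls_subdegree_geI)
  then have "(\<Sum>i=fls_subdegree f..n - fls_subdegree g. fls_nth f i * fls_nth g (n - i))
      = (\<Sum>i=a..n - b. fls_nth f i * fls_nth g (n - i))"
    by (intro sum.mono_neutral_left) auto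
  then show ?thesis by (simp add: fls_times_nth(2))
qed auto

lemma fls_lower_bound: "\<exists>a. \<forall>i<a. fls_nth f i = 0"
  using fls_eq0_below_subdegree by blast

text \<open>A common source for \<open>fls_map\<close>, \<open>fls_dilate\<close>,
  \<open>rescale\<close> and \<open>rescale2\<close>. The map \<open>\<chi>\<close> is a central
  character of the integers, such as c^-n for the substitution u -> c u.\<close>

lemma fls_coeff_hom:
  fixes h :: "'a::ring_1 fls \<Rightarrow> 'b::ring_1 fls"
  assumes g: "semiring_hom g" and nth: "\<And>f n. fls_nth (h f) n = \<chi> n * g (fls_nth f n)"
    and \<chi>: "\<chi> 0 = 1" "\<And>m n. \<chi> (m + n) = \<chi> m * \<chi> n" "\<And>n y. \<chi> n * y = y * \<chi> n"
  shows "semiring_hom h"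
proof -
  interpret g: semiring_hom g by (rule g)
  show ?thesis
  proof
    show "h 0 = 0" by (rule fls_eqI) (simp add: nth)
    show "h 1 = 1" by (rule fls_eqI) (auto simp: nth \<chi>(1))
    show "h (x + y) = h x + h y" for x y
      by (rule fls_eqI) (simp add: nth g.hom_add distrib_left)
    show "h (x * y) = h x * h y" for x y
    proof (rule fls_eqI)
      fix n
      obtain a b where a: "\<And>i. i < a \<Longrightarrow> fls_nth x i = 0" and b: "\<And>i. i < b \<Longrightarrow> fls_nth y i = 0"
        using fls_lower_bound by metis
      have "\<chi> n * (g u * g v) = \<chi> i * g u * (\<chi> (n - i) * g v)" for i u v
      proof -
        have "\<chi> n = \<chi> i * \<chi> (n - i)" using \<chi>(2)[of i "n - i"] by simp
        then show ?thesis by (simp add: mult.assoc) (metis \<chi>(3) mult.assoc)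
      qed
      then have "fls_nth (h (x * y)) n = (\<Sum>i=a..n - b. fls_nth (h x) i * fls_nth (h y) (n - i))"
        by (simp add: nth fls_times_nth_lower_bound[of a x b y, OF a b] g.hom_sum g.hom_mult sum_distrib_left)
      also have "\<dots> = fls_nth (h x * h y) n"
        by (rule fls_times_nth_lower_bound[symmetric]) (simp_all add: nth a b)
      finally show "fls_nth (h (x * y)) n = fls_nth (h x * h y) n" .
    qed
  qed
qed

lemma fls_map_hom:
  fixes g :: "'a::ring_1 \<Rightarrow> 'b::ring_1"
  assumes "semiring_hom g"
  shows "semiring_hom (fls_map g)"
proof -
  interpret semiring_hom g by fact
  show ?thesis
    by (rule fls_coeff_hom[OF assms, of _ "\<lambda>_. 1"]) (auto simp: fls_nth_fls_map)
qed

lemma fls_const_hom: "semiring_hom (fls_const :: 'a::ring_1 \<Rightarrow> 'a fls)"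
  by unfold_locales (auto simp: fls_plus_const intro: fls_eqI)

lemma fls_central:
  fixes f g :: "'a::ring_1 fls"
  assumes "\<And>i j. fls_nth f i * fls_nth g j = fls_nth g j * fls_nth f i"
  shows "f * g = g * f"
proof (rule fls_eqI)
  fix n
  obtain a b where a: "\<And>i. i < a \<Longrightarrow> fls_nth f i = 0" and b: "\<And>i. i < b \<Longrightarrow> fls_nth g i = 0"
    using fls_lower_bound by metis
  have "(\<Sum>i=a..n - b. fls_nth f i * fls_nth g (n - i)) = (\<Sum>i=b..n - a. fls_nth g i * fls_nth f (n - i))"
    by (rule sum.reindex_bij_witness[of _ "\<lambda>i. n - i" "\<lambda>i. n - i"]) (auto simp: assms)
  then show "fls_nth (f * g) n = fls_nth (g * f) n"
    by (simp add: fls_times_nth_lower_bound[of a f b g, OF a b] fls_times_nth_lower_bound[of b g a f, OF b a])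
qed

lemma field_homI:
  fixes h :: "'a::field \<Rightarrow> 'b::field"
  assumes "semiring_hom h"
  shows "field_hom h"
proof -
  interpret semiring_hom h by fact
  show ?thesis by unfold_locales
qed

lemma field_hom_comp: "field_hom g \<Longrightarrow> field_hom h \<Longrightarrow> field_hom (g \<circ> h)"
proof -
  assume "field_hom g" "field_hom h"
  then interpret g: field_hom g + h: field_hom h .
  show "field_hom (g \<circ> h)"
    by (rule field_homI) (unfold_locales, auto simp: hom_distribs)
qed

lemma semiring_hom_comp: "semiring_hom g \<Longrightarrow> semiring_hom h \<Longrightarrow> semiring_hom (g \<circ> h)"
proof -
  assume "semiring_hom g" "semiring_hom h"
  then interpret g: semiring_hom g + h: semiring_hom h .
  show "semiring_hom (g \<circ> h)"
    by (unfold_locales, auto simp: hom_distribs)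
qed

subsection \<open>Scalars\<close>

lemma scal_hom: "semiring_hom scal"
  by unfold_locales (auto simp: scal_def single_add mult_single)

lemma scal_central: "scal c * y = y * scal c"
proof (induction y rule: update_induct)
  case (update f a b)
  have "Poly_Mapping.update a b f = Poly_Mapping.single a b + f"
    using update.hyps by (intro poly_mapping_eqI)
      (auto simp: lookup_update lookup_add lookup_single when_def in_keys_iff)
  then show ?case using update.IH
    by (simp add: distrib_left distrib_right scal_def mult_single mult.commute)
qed simp

lemma scal_0 [simp]: "scal 0 = 0" by (simp add: scal_def)

lemma scal_series_hom: "semiring_hom scal_series"
  unfolding scal_series_def by (rule fls_map_hom[OF scal_hom])

lemma fls_nth_scal_series: "fls_nth (scal_series f) n = scal (fls_nth f n)"
  by (simp add: scal_series_def fls_nth_fls_map)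

lemma scal_series_central: "scal_series f * y = y * scal_series f"
  by (rule fls_central) (simp add: fls_nth_scal_series scal_central)

lemma scal_series_0 [simp]: "scal_series 0 = 0"
  by (rule fls_eqI) (simp add: fls_nth_scal_series)

lemma fusion_two_variables:
  assumes "q \<noteq> 0" "\<forall>n>0. q ^ n \<noteq> 1" "s\<^sup>2 = q" "root_choice q B"
  shows "fusion (fls_const \<circ> fls_const :: complex \<Rightarrow> complex fls fls) (fls_map scal_series) q s B"
proof (rule fusion.intro)
  show "field_hom (fls_const \<circ> fls_const :: complex \<Rightarrow> complex fls fls)"
    by (intro field_hom_comp field_homI fls_const_hom)
  show "semiring_hom (fls_map scal_series)" by (rule fls_map_hom[OF scal_series_hom])
  show "fls_map scal_series x * y = y * fls_map scal_series x" for x y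
    by (rule fls_central) (simp add: fls_nth_fls_map scal_series_central)
qed (use assms in auto)

subsection \<open>Rescaling\<close>

text \<open>Counterpart of \<open>rescale\<close> on scalar series. As a field homomorphism it
  respects the inverses in \<open>cfun\<close>.\<close>

definition fls_dilate :: "complex \<Rightarrow> complex fls \<Rightarrow> complex fls" where
  "fls_dilate c f = Abs_fls (\<lambda>n. c powi (- n) * fls_nth f n)"

lemma fls_nth_fls_dilate: "fls_nth (fls_dilate c f) n = c powi (- n) * fls_nth f n"
  unfolding fls_dilate_def by (rule nth_Abs_fls_lower_bound[of "fls_subdegree f"]) simp

lemma fls_dilate_hom:
  assumes "c \<noteq> 0"
  shows "field_hom (fls_dilate c)"
proof (rule field_homI, rule fls_coeff_hom[where g = id and \<chi> = "\<lambda>n. c powi (- n)"])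
  show "semiring_hom (id :: complex \<Rightarrow> complex)" by unfold_locales auto
  show "c powi - (m + n) = c powi - m * c powi - n" for m n
    using assms power_int_add[of c "-m" "-n"] by simp
qed (auto simp: fls_nth_fls_dilate)

lemma rescale_hom:
  assumes "c \<noteq> 0"
  shows "semiring_hom (rescale c)"
proof (rule fls_coeff_hom[where g = id and \<chi> = "\<lambda>n. scal (c powi (- n))"])
  interpret scal: semiring_hom scal by (rule scal_hom)
  show "semiring_hom (id :: free_alg \<Rightarrow> free_alg)" by unfold_locales auto
  show "scal (c powi - (m + n)) = scal (c powi - m) * scal (c powi - n)" for m n
    using assms power_int_add[of c "-m" "-n"] by (simp flip: scal.hom_mult)
  show "scal (c powi - 0) = 1" by simp
qed (auto simp: fls_nth_rescale scal_central)

lemma rescale_rescale: "rescale c (rescale d f) = rescale (c * d) f"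
proof (rule fls_eqI)
  interpret scal: semiring_hom scal by (rule scal_hom)
  fix n
  show "fls_nth (rescale c (rescale d f)) n = fls_nth (rescale (c * d) f) n"
    by (simp add: fls_nth_rescale power_int_mult_distrib flip: mult.assoc scal.hom_mult)
qed

lemma rescale_1: "rescale 1 f = f"
proof (rule fls_eqI)
  interpret scal: semiring_hom scal by (rule scal_hom)
  show "fls_nth (rescale 1 f) n = fls_nth f n" for n by (simp add: fls_nth_rescale)
qed

lemma rescale_scal_series: "rescale c (scal_series f) = scal_series (fls_dilate c f)"
proof (rule fls_eqI)
  interpret scal: semiring_hom scal by (rule scal_hom)
  show "fls_nth (rescale c (scal_series f)) n = fls_nth (scal_series (fls_dilate c f)) n" for n
    by (simp add: fls_nth_rescale fls_nth_scal_series fls_nth_fls_dilate scal.hom_mult)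
qed

lemma fls_dilate_const: "fls_dilate c (fls_const z) = fls_const z"
  by (rule fls_eqI) (auto simp: fls_nth_fls_dilate)

lemma fls_dilate_X_inv: "fls_dilate c fls_X_inv = fls_X_inv * fls_const c"
  by (rule fls_eqI) (auto simp: fls_nth_fls_dilate)

subsection \<open>Ideals of coefficients\<close>

text \<open>It stands in for series over the quotient algebra; applied twice, it is an ideal of
  double series.\<close>

definition coeff_ideal :: "'r::ring_1 set \<Rightarrow> 'r fls set" where
  "coeff_ideal I = {f. \<forall>n. fls_nth f n \<in> I}"

lemma two_sided_ideal_coeff:
  assumes I: "two_sided_ideal I"
  shows "two_sided_ideal (coeff_ideal I)"
  unfolding two_sided_ideal_def coeff_ideal_def
  by (auto simp: two_sided_idealD[OF I] fls_times_nth(2) intro!: two_sided_ideal_sum[OF I])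

lemma two_sided_ideal_Aq_ideal: "two_sided_ideal (Aq_ideal q kp km)"
proof -
  interpret ideal "Aq_ideal q kp km" "ring_of_type_algebra :: free_alg ring"
    by (rule ideal_Aq_ideal)
  show ?thesis
    using additive_subgroup.zero_closed[OF ideal.axioms(1)[OF ideal_Aq_ideal]]
      additive_subgroup.a_closed[OF ideal.axioms(1)[OF ideal_Aq_ideal]] I_l_closed I_r_closed
    by (simp add: two_sided_ideal_def ring_of_type_algebra_def)
qed

lemma to_Aq_eq_iff: "to_Aq q kp km a = to_Aq q kp km b \<longleftrightarrow> a - b \<in> Aq_ideal q kp km"
proof -
  interpret ring "ring_of_type_algebra :: free_alg ring" by (rule ring_free_alg)
  have "\<ominus>\<^bsub>ring_of_type_algebra\<^esub> b = - b"
    by (rule minus_equality) (simp_all add: ring_of_type_algebra_def)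
  then have "a \<ominus>\<^bsub>ring_of_type_algebra\<^esub> b = a - b"
    by (simp add: a_minus_def) (simp add: ring_of_type_algebra_def)
  then show ?thesis
    using quotient_eq_iff_same_a_r_cos[OF ideal_Aq_ideal, of a b q kp km]
    by (simp add: to_Aq_def) (simp add: ring_of_type_algebra_def)
qed

section \<open>Setting two variables equal\<close>

text \<open>The substitution \<open>u\<^sub>1 = u\<^sub>2 = u\<close> makes sense for double series whose supports are bounded below
  in both variables simultaneously.\<close>

definition bounded2 :: "'r::ring_1 fls fls \<Rightarrow> bool" where
  "bounded2 f \<longleftrightarrow> (\<exists>N. \<forall>a b. a < N \<or> b < N \<longrightarrow> fls_nth (fls_nth f a) b = 0)"

text \<open>A sum over an infinite set would default to 0; under \<open>bounded2\<close> every
  antidiagonal is finite and the value is the intended one (\<open>diag_nth\<close>).\<close>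

definition diag :: "'r::ring_1 fls fls \<Rightarrow> 'r fls" where
  "diag f = Abs_fls (\<lambda>n. \<Sum>a | fls_nth (fls_nth f a) (n - a) \<noteq> 0. fls_nth (fls_nth f a) (n - a))"

lemma diag_nth:
  fixes f :: "'r::ring_1 fls fls"
  assumes N: "\<And>a b. a < N \<or> b < N \<Longrightarrow> fls_nth (fls_nth f a) b = 0"
  shows "fls_nth (diag f) n = (\<Sum>a=N..n - N. fls_nth (fls_nth f a) (n - a))"
proof -
  have eq: "(\<Sum>a | fls_nth (fls_nth f a) (m - a) \<noteq> 0. fls_nth (fls_nth f a) (m - a))
      = (\<Sum>a=N..m - N. fls_nth (fls_nth f a) (m - a))" for m
  proof (rule sum.mono_neutral_left)
    show "{a. fls_nth (fls_nth f a) (m - a) \<noteq> 0} \<subseteq> {N..m - N}"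
    proof
      fix a assume "a \<in> {a. fls_nth (fls_nth f a) (m - a) \<noteq> 0}"
      then have "\<not> (a < N \<or> m - a < N)" using N by blast
      then show "a \<in> {N..m - N}" by auto
    qed
  qed auto
  show ?thesis unfolding diag_def eq
    by (rule nth_Abs_fls_lower_bound[of "2 * N"]) auto
qed

lemma bounded2_iff_common:
  assumes "bounded2 f" "bounded2 g"
  obtains N where "\<And>a b. a < N \<or> b < N \<Longrightarrow> fls_nth (fls_nth f a) b = 0"
    "\<And>a b. a < N \<or> b < N \<Longrightarrow> fls_nth (fls_nth g a) b = 0"
proof -
  from assms obtain N M where N: "\<forall>a b. a < N \<or> b < N \<longrightarrow> fls_nth (fls_nth f a) b = 0"
    and M: "\<forall>a b. a < M \<or> b < M \<longrightarrow> fls_nth (fls_nth g a) b = 0"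
    by (auto simp: bounded2_def)
  show ?thesis by (rule that[of "min N M"]) (use N M in auto)
qed

lemma bounded2_add: "bounded2 f \<Longrightarrow> bounded2 g \<Longrightarrow> bounded2 (f + g)"
  and diag_add: "bounded2 f \<Longrightarrow> bounded2 g \<Longrightarrow> diag (f + g) = diag f + diag g"
proof -
  assume *: "bounded2 f" "bounded2 g"
  obtain N where N: "\<And>a b. a < N \<or> b < N \<Longrightarrow> fls_nth (fls_nth f a) b = 0"
    "\<And>a b. a < N \<or> b < N \<Longrightarrow> fls_nth (fls_nth g a) b = 0"
    using bounded2_iff_common[OF *] by blast
  then have NN: "\<And>a b. a < N \<or> b < N \<Longrightarrow> fls_nth (fls_nth (f + g) a) b = 0" by simp
  then show "bounded2 (f + g)" unfolding bounded2_def by blast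
  show "diag (f + g) = diag f + diag g"
    by (rule fls_eqI) (simp add: diag_nth[OF NN] diag_nth[OF N(1)] diag_nth[OF N(2)] sum.distrib)
qed

lemma bounded2_diff: "bounded2 f \<Longrightarrow> bounded2 g \<Longrightarrow> bounded2 (f - g)"
  and diag_diff: "bounded2 f \<Longrightarrow> bounded2 g \<Longrightarrow> diag (f - g) = diag f - diag g"
proof -
  assume *: "bounded2 f" "bounded2 g"
  obtain N where N: "\<And>a b. a < N \<or> b < N \<Longrightarrow> fls_nth (fls_nth f a) b = 0"
    "\<And>a b. a < N \<or> b < N \<Longrightarrow> fls_nth (fls_nth g a) b = 0"
    using bounded2_iff_common[OF *] by blast
  then have NN: "\<And>a b. a < N \<or> b < N \<Longrightarrow> fls_nth (fls_nth (f - g) a) b = 0" by simp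
  then show "bounded2 (f - g)" unfolding bounded2_def by blast
  show "diag (f - g) = diag f - diag g"
    by (rule fls_eqI) (simp add: diag_nth[OF NN] diag_nth[OF N(1)] diag_nth[OF N(2)] sum_subtractf)
qed

lemma bounded2_0: "bounded2 (0 :: 'r::ring_1 fls fls)" and diag_0: "diag (0 :: 'r fls fls) = 0"
proof -
  have N: "\<And>a b. a < 0 \<or> b < 0 \<Longrightarrow> fls_nth (fls_nth (0 :: 'r fls fls) a) b = 0" by simp
  then show "bounded2 (0 :: 'r fls fls)" unfolding bounded2_def by blast
  show "diag (0 :: 'r fls fls) = 0" by (rule fls_eqI) (simp add: diag_nth[OF N])
qed

lemma bounded2_mult: "bounded2 f \<Longrightarrow> bounded2 g \<Longrightarrow> bounded2 (f * g)"
  and diag_mult: "bounded2 f \<Longrightarrow> bounded2 g \<Longrightarrow> diag (f * g) = diag f * diag g"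
proof -
  assume *: "bounded2 f" "bounded2 g"
  obtain N where f: "\<And>a b. a < N \<or> b < N \<Longrightarrow> fls_nth (fls_nth f a) b = 0"
    and g: "\<And>a b. a < N \<or> b < N \<Longrightarrow> fls_nth (fls_nth g a) b = 0"
    using bounded2_iff_common[OF *] by blast
  have f0: "fls_nth f a = 0" if "a < N" for a using f that by (intro fls_eqI) auto
  have g0: "fls_nth g a = 0" if "a < N" for a using g that by (intro fls_eqI) auto
  have prod: "fls_nth (fls_nth (f * g) a) b
      = (\<Sum>i=N..a - N. \<Sum>k=N..b - N. fls_nth (fls_nth f i) k * fls_nth (fls_nth g (a - i)) (b - k))" for a b
  proof -
    have "fls_nth (fls_nth f i * fls_nth g j) b = (\<Sum>k=N..b - N. fls_nth (fls_nth f i) k * fls_nth (fls_nth g j) (b - k))" for i j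
      by (rule fls_times_nth_lower_bound) (auto simp: f g)
    then show ?thesis
      by (simp add: fls_times_nth_lower_bound[of N f N g, OF f0 g0] fls_nth_sum)
  qed
  have fg: "fls_nth (fls_nth (f * g) a) b = 0" if "a < 2 * N \<or> b < 2 * N" for a b
    using that by (auto simp: prod)
  then show "bounded2 (f * g)" unfolding bounded2_def by blast
  show "diag (f * g) = diag f * diag g"
  proof (rule fls_eqI)
    fix n
    let ?f = "\<lambda>i k. fls_nth (fls_nth f i) k" and ?g = "\<lambda>i k. fls_nth (fls_nth g i) k"
    have "fls_nth (diag (f * g)) n = (\<Sum>a=2 * N..n - 2 * N. \<Sum>i=N..a - N. \<Sum>k=N..n - a - N. ?f i k * ?g (a - i) (n - a - k))"
      by (simp add: diag_nth[OF fg] prod)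
    also have "\<dots> = (\<Sum>(a, i, k)\<in>Sigma {2 * N..n - 2 * N} (\<lambda>a. {N..a - N} \<times> {N..n - a - N}). ?f i k * ?g (a - i) (n - a - k))"
      by (simp add: sum.Sigma sum.cartesian_product)
    \<comment> \<open>Reindexing by the total degree \<open>m = i + k\<close> of the term from
      \<open>f\<close>, with \<open>j = a - i\<close> for the one from \<open>g\<close>.\<close>
    also have "\<dots> = (\<Sum>(m, i, j)\<in>Sigma {2 * N..n - 2 * N} (\<lambda>m. {N..m - N} \<times> {N..n - m - N}). ?f i (m - i) * ?g j (n - m - j))"
      by (rule sum.reindex_bij_witness[of _ "\<lambda>(m, i, j). (i + j, i, m - i)" "\<lambda>(a, i, k). (i + k, i, a - i)"])
        (auto simp: algebra_simps)
    also have "\<dots> = (\<Sum>m=2 * N..n - 2 * N. (\<Sum>i=N..m - N. ?f i (m - i)) * (\<Sum>j=N..n - m - N. ?g j (n - m - j)))"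
      by (simp add: sum.Sigma sum.cartesian_product sum_product)
    also have "\<dots> = fls_nth (diag f * diag g) n"
      by (subst fls_times_nth_lower_bound[of "2 * N" _ "2 * N"]) (auto simp: diag_nth[OF f] diag_nth[OF g])
    finally show "fls_nth (diag (f * g)) n = fls_nth (diag f * diag g) n" .
  qed
qed

lemma bounded2_sum: "(\<And>i. i \<in> A \<Longrightarrow> bounded2 (f i)) \<Longrightarrow> bounded2 (sum f A)"
  by (induction A rule: infinite_finite_induct) (auto simp: bounded2_0 bounded2_add)

lemma diag_sum: "(\<And>i. i \<in> A \<Longrightarrow> bounded2 (f i)) \<Longrightarrow> diag (sum f A) = (\<Sum>i\<in>A. diag (f i))"
  by (induction A rule: infinite_finite_induct) (auto simp: diag_0 diag_add bounded2_sum)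

lemma bounded2_const: "bounded2 (fls_const f)" and diag_const: "diag (fls_const f) = f"
proof -
  obtain c where "\<And>i. i < c \<Longrightarrow> fls_nth f i = 0" using fls_lower_bound[of f] by blast
  then have N: "\<And>a b. a < min 0 c \<or> b < min 0 c \<Longrightarrow> fls_nth (fls_nth (fls_const f) a) b = 0" by auto
  then show "bounded2 (fls_const f)" unfolding bounded2_def by blast
  show "diag (fls_const f) = f"
  proof (rule fls_eqI)
    fix n
    have "fls_nth (diag (fls_const f)) n = (\<Sum>a=min 0 c..n - min 0 c. if a = 0 then fls_nth f n else 0)"
      by (subst diag_nth[where N = "min 0 c", OF N]) (assumption, intro sum.cong refl, auto)
    also have "\<dots> = fls_nth f n" using N[of 0 n] by (auto simp: min_def split: if_splits)
    finally show "fls_nth (diag (fls_const f)) n = fls_nth f n" .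
  qed
qed

lemma bounded2_map_const: "bounded2 (fls_map fls_const f)" and diag_map_const: "diag (fls_map fls_const f) = f"
proof -
  obtain c where c: "\<And>i. i < c \<Longrightarrow> fls_nth f i = 0" using fls_lower_bound[of f] by blast
  then have N: "\<And>a b. a < min 0 c \<or> b < min 0 c \<Longrightarrow> fls_nth (fls_nth (fls_map fls_const f) a) b = 0"
    by (auto simp: fls_nth_fls_map)
  then show "bounded2 (fls_map fls_const f)" unfolding bounded2_def by blast
  show "diag (fls_map fls_const f) = f"
  proof (rule fls_eqI)
    fix n
    have "fls_nth (diag (fls_map fls_const f)) n = (\<Sum>a=min 0 c..n - min 0 c. if a = n then fls_nth f n else 0)"
      by (subst diag_nth[where N = "min 0 c", OF N]) (assumption, intro sum.cong refl, auto simp: fls_nth_fls_map)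
    also have "\<dots> = fls_nth f n" using c[of n] by (auto simp: min_def)
    finally show "fls_nth (diag (fls_map fls_const f)) n = fls_nth f n" .
  qed
qed

definition mat_bounded2 :: "'r::ring_1 fls fls mat \<Rightarrow> bool" where
  "mat_bounded2 A \<longleftrightarrow> (\<forall>i<dim_row A. \<forall>j<dim_col A. bounded2 (A $$ (i, j)))"

lemma mat_bounded2_mult: "mat_bounded2 A \<Longrightarrow> mat_bounded2 B \<Longrightarrow> dim_col A = dim_row B \<Longrightarrow> mat_bounded2 (A * B)"
  by (auto simp: mat_bounded2_def scalar_prod_def intro!: bounded2_sum bounded2_mult)

lemma map_diag_mult:
  "mat_bounded2 A \<Longrightarrow> mat_bounded2 B \<Longrightarrow> dim_col A = dim_row B \<Longrightarrow> map_mat diag (A * B) = map_mat diag A * map_mat diag B"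
  by (intro eq_matI) (auto simp: mat_bounded2_def scalar_prod_def diag_mult bounded2_mult intro!: trans[OF diag_sum] sum.cong)

section \<open>The defining relations\<close>

definition reflection_diff :: "nat \<Rightarrow> nat \<Rightarrow> 'r::ring_1 mat \<Rightarrow> 'r mat \<Rightarrow> 'r mat \<Rightarrow> 'r mat \<Rightarrow> 'r mat" where
  "reflection_diff m n RA RB KA KB =
     RA * (KA \<otimes>\<^sub>m 1\<^sub>m (n + 1)) * RB * (1\<^sub>m (m + 1) \<otimes>\<^sub>m KB) - (1\<^sub>m (m + 1) \<otimes>\<^sub>m KB) * RB * (KA \<otimes>\<^sub>m 1\<^sub>m (n + 1)) * RA"

lemma semiring_hom_diff:
  fixes h :: "'a::ring_1 \<Rightarrow> 'b::ring_1"
  assumes "semiring_hom h"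
  shows "h (a - b) = h a - h b"
proof -
  interpret semiring_hom h by fact
  show ?thesis using hom_add[of "a - b" b] by (simp add: algebra_simps)
qed

lemma map_reflection_diff:
  fixes h :: "'a::ring_1 \<Rightarrow> 'b::ring_1"
  assumes h: "semiring_hom h"
    and RA: "RA \<in> carrier_mat ((m + 1) * (n + 1)) ((m + 1) * (n + 1))" and RB: "RB \<in> carrier_mat ((m + 1) * (n + 1)) ((m + 1) * (n + 1))"
    and KA: "KA \<in> carrier_mat (m + 1) (m + 1)" and KB: "KB \<in> carrier_mat (n + 1) (n + 1)"
  shows "map_mat h (reflection_diff m n RA RB KA KB)
    = reflection_diff m n (map_mat h RA) (map_mat h RB) (map_mat h KA) (map_mat h KB)"
proof -
  interpret semiring_hom h by fact
  let ?N = "(m + 1) * (n + 1)"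
  have K: "KA \<otimes>\<^sub>m 1\<^sub>m (n + 1) \<in> carrier_mat ?N ?N" "1\<^sub>m (m + 1) \<otimes>\<^sub>m KB \<in> carrier_mat ?N ?N"
    using KA KB by auto
  have minus: "map_mat h (A - B) = map_mat h A - map_mat h B" if "A \<in> carrier_mat ?N ?N" "B \<in> carrier_mat ?N ?N" for A B
    using that by (intro eq_matI) (auto simp: semiring_hom_diff[OF h])
  have prod4: "map_mat h (A * B * C * D) = map_mat h A * map_mat h B * map_mat h C * map_mat h D"
    if "A \<in> carrier_mat ?N ?N" "B \<in> carrier_mat ?N ?N" "C \<in> carrier_mat ?N ?N" "D \<in> carrier_mat ?N ?N" for A B C D
    by (simp only: mat_hom_mult[OF that(1,2)] mat_hom_mult[OF mult_carrier_mat[OF that(1,2)] that(3)]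
        mat_hom_mult[OF mult_carrier_mat[OF mult_carrier_mat[OF that(1,2)] that(3)] that(4)])
  have tensor: "map_mat h (KA \<otimes>\<^sub>m 1\<^sub>m (n + 1)) = map_mat h KA \<otimes>\<^sub>m 1\<^sub>m (n + 1)"
      "map_mat h (1\<^sub>m (m + 1) \<otimes>\<^sub>m KB) = 1\<^sub>m (m + 1) \<otimes>\<^sub>m map_mat h KB"
    by (simp_all only: map_mat_tensor[OF h] mat_hom_one)
  show ?thesis
    unfolding reflection_diff_def tensor[symmetric] prod4[OF RA K(1) RB K(2), symmetric] prod4[OF K(2) RB K(1) RA, symmetric]
    by (rule minus; rule mult_carrier_mat[OF mult_carrier_mat[OF mult_carrier_mat]]; (rule RA RB K)+)
qed

lemma mat_bounded2_tensor: "mat_bounded2 A \<Longrightarrow> mat_bounded2 B \<Longrightarrow> mat_bounded2 (A \<otimes>\<^sub>m B)"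
  and map_diag_tensor: "mat_bounded2 A \<Longrightarrow> mat_bounded2 B \<Longrightarrow> map_mat diag (A \<otimes>\<^sub>m B) = map_mat diag A \<otimes>\<^sub>m map_mat diag B"
proof -
  assume *: "mat_bounded2 A" "mat_bounded2 B"
  have "r div b < a" "r mod b < b" if "r < a * b" for r a b :: nat
    using that by (auto simp: less_mult_imp_div_less) (metis mod_less_divisor mult_is_0 neq0_conv not_less0)
  then show "mat_bounded2 (A \<otimes>\<^sub>m B)" "map_mat diag (A \<otimes>\<^sub>m B) = map_mat diag A \<otimes>\<^sub>m map_mat diag B"
    using * by (auto simp: mat_bounded2_def tensor_mat_def bounded2_mult diag_mult intro!: eq_matI)
qed

lemma mat_bounded2_one: "mat_bounded2 (1\<^sub>m n)" and map_diag_one: "map_mat diag (1\<^sub>m n :: 'r::ring_1 fls fls mat) = 1\<^sub>m n"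
  using bounded2_const[of "1 :: 'r fls"] diag_const[of "1 :: 'r fls"] bounded2_const[of 1]
  by (auto simp: mat_bounded2_def bounded2_0 diag_0 intro!: eq_matI)

lemma diag_reflection_diff:
  assumes RA: "RA \<in> carrier_mat ((m + 1) * (n + 1)) ((m + 1) * (n + 1))" and RB: "RB \<in> carrier_mat ((m + 1) * (n + 1)) ((m + 1) * (n + 1))"
    and KA: "KA \<in> carrier_mat (m + 1) (m + 1)" and KB: "KB \<in> carrier_mat (n + 1) (n + 1)"
    and bounded: "mat_bounded2 RA" "mat_bounded2 RB" "mat_bounded2 KA" "mat_bounded2 KB"
  shows "map_mat diag (reflection_diff m n RA RB KA KB)
    = reflection_diff m n (map_mat diag RA) (map_mat diag RB) (map_mat diag KA) (map_mat diag KB)"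
    and "mat_bounded2 (reflection_diff m n RA RB KA KB)"
proof -
  let ?N = "(m + 1) * (n + 1)"
  let ?A = "KA \<otimes>\<^sub>m 1\<^sub>m (n + 1)" and ?B = "1\<^sub>m (m + 1) \<otimes>\<^sub>m KB"
  have K: "?A \<in> carrier_mat ?N ?N" "?B \<in> carrier_mat ?N ?N"
    using KA KB by auto
  have Kb: "mat_bounded2 ?A" "mat_bounded2 ?B"
    using bounded by (auto intro!: mat_bounded2_tensor mat_bounded2_one)
  have dims: "dim_row RA = ?N" "dim_col RA = ?N" "dim_row RB = ?N" "dim_col RB = ?N"
      "dim_row ?A = ?N" "dim_col ?A = ?N" "dim_row ?B = ?N" "dim_col ?B = ?N"
    using RA RB K by (auto simp del: dim_tensor_mat)
  let ?L = "RA * ?A * RB * ?B" and ?R = "?B * RB * ?A * RA"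
  have b: "mat_bounded2 ?L" "mat_bounded2 ?R"
    using dims bounded Kb by (auto intro!: mat_bounded2_mult simp del: dim_tensor_mat)
  have d: "map_mat diag ?L = map_mat diag RA * map_mat diag ?A * map_mat diag RB * map_mat diag ?B"
      "map_mat diag ?R = map_mat diag ?B * map_mat diag RB * map_mat diag ?A * map_mat diag RA"
    using dims bounded Kb by (simp_all add: map_diag_mult mat_bounded2_mult del: dim_tensor_mat)
  have "map_mat diag (?L - ?R) = map_mat diag ?L - map_mat diag ?R"
    using b dims by (intro eq_matI) (auto simp: mat_bounded2_def diag_diff simp del: dim_tensor_mat)
  then show "map_mat diag (reflection_diff m n RA RB KA KB)
    = reflection_diff m n (map_mat diag RA) (map_mat diag RB) (map_mat diag KA) (map_mat diag KB)"
    unfolding reflection_diff_def d using bounded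
    by (simp only: map_diag_tensor mat_bounded2_one map_diag_one)
  show "mat_bounded2 (reflection_diff m n RA RB KA KB)"
    unfolding reflection_diff_def using b dims by (auto simp: mat_bounded2_def bounded2_diff simp del: dim_tensor_mat)
qed

section \<open>The spin 1/2 R-matrix in two variables\<close>

lemma map_mat_R_fund:
  assumes "h (f (cfun (x * \<iota> q))) = f' (cfun (x' * \<iota>' q))" "h (f (cfun x)) = f' (cfun x')"
    "h (f (\<iota> (cfun q))) = f' (\<iota>' (cfun q))" "h (f 0) = f' 0"
  shows "map_mat h (map_mat f (R_fund \<iota> q x)) = map_mat f' (R_fund \<iota>' q x')"
  using assms by (intro eq_matI) (auto simp: R_fund_def mat_of_rows_list_def numeral_eq_Suc less_Suc_eq)

definition R2 :: "complex \<Rightarrow> complex fls fls \<Rightarrow> free_alg fls fls mat" where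
  "R2 q z = map_mat (fls_map scal_series) (R_fund (fls_const \<circ> fls_const) q z)"

lemma R2_carrier: "R2 q z \<in> carrier_mat ((1 + 1) * (1 + 1)) ((1 + 1) * (1 + 1))"
  by (auto simp: R2_def R_fund_def mat_of_rows_list_def)

lemma field_hom_inverse: "field_hom h \<Longrightarrow> h (inverse x) = inverse (h x)"
proof -
  assume "field_hom h"
  then interpret field_hom h .
  show ?thesis by (rule hom_inverse)
qed

lemma scal_map_const: "fls_map scal_series (fls_map fls_const x) = fls_map fls_const (scal_series x)"
  by (rule fls_eqI) (simp add: fls_nth_fls_map fls_nth_scal_series, rule fls_eqI, simp add: fls_nth_scal_series)

lemma scal_const: "fls_map scal_series (fls_const y) = fls_const (scal_series y)"
  by (rule fls_eqI) (simp add: fls_nth_fls_map)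

text \<open>Both terms of c(x y) separate into a series in the first variable times one in the
  second. Boundedness, rescaling and the diagonal are then computed factor by factor.\<close>

lemma scal_cfun:
  "fls_map scal_series (cfun (fls_map fls_const x * fls_const y))
    = fls_map fls_const (scal_series x) * fls_const (scal_series y)
      - fls_map fls_const (scal_series (inverse x)) * fls_const (scal_series (inverse y))"
proof -
  interpret S: semiring_hom "fls_map scal_series" by (rule fls_map_hom[OF scal_series_hom])
  have h: "field_hom (fls_const :: complex fls \<Rightarrow> _)" "field_hom (fls_map fls_const :: complex fls \<Rightarrow> complex fls fls)"
    by (intro field_homI fls_map_hom fls_const_hom)+
  show ?thesis
    by (simp add: cfun_def semiring_hom_diff[OF S.semiring_hom_axioms] S.hom_mult scal_map_const scal_const
        flip: field_hom_inverse[OF h(1)] field_hom_inverse[OF h(2)])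
qed

context fusion
begin

subsection \<open>From matrices to operators\<close>

abbreviation MR :: "nat \<Rightarrow> nat \<Rightarrow> 'b \<Rightarrow> 'r mat" where
  "MR m n x \<equiv> map_mat \<sigma> (R_fused \<iota> q s B m n x)"

lemma MR_carrier: "MR m n x \<in> carrier_mat ((m + 1) * (n + 1)) ((m + 1) * (n + 1))"
  using R_fused_carrier by auto

lemma flat2_R:
  "p \<noteq> t \<Longrightarrow> flat2 (m + 1) (n + 1) p t i w v \<Longrightarrow> flat2 (m + 1) (n + 1) p t i (mat_action (MR m n x) w) (R m n p t x v)"
  unfolding R_def by (rule flat2_mat[OF MR_carrier])

lemma flat2_Kop_left:
  "KA \<in> carrier_mat (m + 1) (m + 1) \<Longrightarrow> p \<noteq> t \<Longrightarrow> flat2 (m + 1) e p t i w v \<Longrightarrow>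
     flat2 (m + 1) e p t i (mat_action (KA \<otimes>\<^sub>m 1\<^sub>m e) w) (Kop m KA p v)"
  unfolding Kop_def by (rule flat2_tensor_left)

lemma flat2_Kop_right:
  "KB \<in> carrier_mat (n + 1) (n + 1) \<Longrightarrow> p \<noteq> t \<Longrightarrow> flat2 d (n + 1) p t i w v \<Longrightarrow>
     flat2 d (n + 1) p t i (mat_action (1\<^sub>m d \<otimes>\<^sub>m KB) w) (Kop n KB t v)"
  unfolding Kop_def by (rule flat2_tensor_right)

lemma reflection_diff_action:
  assumes KA: "KA \<in> carrier_mat (m + 1) (m + 1)" and KB: "KB \<in> carrier_mat (n + 1) (n + 1)" and pt: "p \<noteq> t"
    and w: "flat2 (m + 1) (n + 1) p t i w v" and i: "i p \<le> m" "i t \<le> n"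
  shows "mat_action (reflection_diff m n (MR m n x) (MR m n y) KA KB) w (i p * (n + 1) + i t)
    = R m n p t x (Kop m KA p (R m n p t y (Kop n KB t v))) i - Kop n KB t (R m n p t y (Kop m KA p (R m n p t x v))) i"
proof -
  let ?N = "(m + 1) * (n + 1)"
  let ?A = "KA \<otimes>\<^sub>m 1\<^sub>m (n + 1)" and ?B = "1\<^sub>m (m + 1) \<otimes>\<^sub>m KB"
  let ?L = "MR m n x * ?A * MR m n y * ?B" and ?R = "?B * MR m n y * ?A * MR m n x"
  have carr: "?A \<in> carrier_mat ?N ?N" "?B \<in> carrier_mat ?N ?N"
    using KA KB by auto
  have dims: "dim_row (MR m n z) = ?N" "dim_col (MR m n z) = ?N" "dim_row ?A = ?N" "dim_col ?A = ?N"
      "dim_row ?B = ?N" "dim_col ?B = ?N" for z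
    using MR_carrier[of m n z] carr by (simp_all only: carrier_matD)
  have r: "i p * (n + 1) + i t < ?N" using i by (intro digit_less) auto
  have fl: "flat2 (m + 1) (n + 1) p t i (mat_action (MR m n x) (mat_action ?A (mat_action (MR m n y) (mat_action ?B w))))
      (R m n p t x (Kop m KA p (R m n p t y (Kop n KB t v))))"
      "flat2 (m + 1) (n + 1) p t i (mat_action ?B (mat_action (MR m n y) (mat_action ?A (mat_action (MR m n x) w))))
      (Kop n KB t (R m n p t y (Kop m KA p (R m n p t x v))))"
    by (intro flat2_R flat2_Kop_left flat2_Kop_right pt KA KB w)+
  have LR: "mat_action ?L w (i p * (n + 1) + i t) = R m n p t x (Kop m KA p (R m n p t y (Kop n KB t v))) i"
      "mat_action ?R w (i p * (n + 1) + i t) = Kop n KB t (R m n p t y (Kop m KA p (R m n p t x v))) i"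
    using fl i r dims pt by (simp_all add: mat_action_mult flat2_def less_Suc_eq_le fun_upd_triv del: dim_tensor_mat mult_Suc mult_Suc_right)
  have "mat_action (?L - ?R) w (i p * (n + 1) + i t) = mat_action ?L w (i p * (n + 1) + i t) - mat_action ?R w (i p * (n + 1) + i t)"
    using r dims by (simp add: mat_action_def left_diff_distrib sum_subtractf del: dim_tensor_mat mult_Suc mult_Suc_right)
  then show ?thesis by (simp only: reflection_diff_def LR)
qed

text \<open>A matrix with entries in a two-sided ideal sends every vector into the ideal, and basis
  vectors recover the entries. The defining relations enter through one direction, the final matrix
  identity leaves through the other.\<close>

lemma reflection_iff_mat:
  assumes J: "two_sided_ideal J"
    and k: "\<And>c. k1 m c \<in> carrier_mat (m + 1) (m + 1)" "\<And>d. k2 n d \<in> carrier_mat (n + 1) (n + 1)"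
  shows "reflection J u1 u2 k1 k2 m n \<longleftrightarrow> (\<forall>c d a b. c \<noteq> 0 \<longrightarrow> d \<noteq> 0 \<longrightarrow> a = u1 * \<iota> c \<longrightarrow> b = u2 * \<iota> d \<longrightarrow>
     (\<forall>i<(m + 1) * (n + 1). \<forall>j<(m + 1) * (n + 1).
        reflection_diff m n (MR m n (a / b)) (MR m n (a * b)) (k1 m c) (k2 n d) $$ (i, j) \<in> J))"
    (is "_ \<longleftrightarrow> ?mat")
proof
  let ?N = "(m + 1) * (n + 1)"
  have dims: "dim_col (reflection_diff m n (MR m n x) (MR m n y) (k1 m c) (k2 n d)) = ?N" for x y c d
    using MR_carrier[of m n x] by (simp add: reflection_diff_def)
  show "reflection J u1 u2 k1 k2 m n" if mat: ?mat
    unfolding reflection_def vec_cong_def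
  proof (intro allI impI)
    fix c d a b v i and p t :: nat
    assume *: "c \<noteq> 0" "d \<noteq> 0" "a = u1 * \<iota> c" "b = u2 * \<iota> d" "p \<noteq> t"
    let ?D = "reflection_diff m n (MR m n (a / b)) (MR m n (a * b)) (k1 m c) (k2 n d)"
    let ?X = "R m n p t (a / b) (Kop m (k1 m c) p (R m n p t (a * b) (Kop n (k2 n d) t v)))"
    let ?Y = "Kop n (k2 n d) t (R m n p t (a * b) (Kop m (k1 m c) p (R m n p t (a / b) v)))"
    show "?X i - ?Y i \<in> J"
    proof (cases "i p \<le> m \<and> i t \<le> n")
      case True
      obtain w where w: "flat2 (m + 1) (n + 1) p t i w v" using flat2_exists by blast
      have "i p * (n + 1) + i t < ?N" using True by (intro digit_less) auto
      then have "?D $$ (i p * (n + 1) + i t, j) \<in> J" if "j < ?N" for j using mat * that by blast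
      then have "mat_action ?D w (i p * (n + 1) + i t) \<in> J"
        unfolding mat_action_def dims by (intro two_sided_ideal_sum[OF J] two_sided_idealD(4)[OF J]) auto
      then show ?thesis using reflection_diff_action[OF k *(5) w, of "a / b" "a * b"] True by simp
    next
      case False
      have "?X i = 0" using False by (intro R_supp) auto
      moreover have "?Y i = 0"
      proof (cases "i t \<le> n")
        case True
        then show ?thesis using False *(5) by (subst Kop_supp_other[of p t]) (simp_all add: R_supp)
      qed (simp add: Kop_supp)
      ultimately show ?thesis by (simp add: two_sided_idealD[OF J])
    qed
  qed
  show ?mat if refl: "reflection J u1 u2 k1 k2 m n"
  proof (intro allI impI)
    fix c d a b i j
    assume *: "c \<noteq> 0" "d \<noteq> 0" "a = u1 * \<iota> c" "b = u2 * \<iota> d" "i < ?N" "j < ?N"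
    let ?D = "reflection_diff m n (MR m n (a / b)) (MR m n (a * b)) (k1 m c) (k2 n d)"
    \<comment> \<open>The basis vector with number \<open>j\<close>, read on positions 0 and
      1.\<close>
    define v where "v l = (if l 0 * (n + 1) + l (Suc 0) = j then 1 else 0 :: 'r)" for l :: "nat \<Rightarrow> nat"
    define w where "w l = (if l = j then 1 else 0 :: 'r)" for l :: nat
    define l where "l = (\<lambda>_. 0 :: nat)(0 := i div (n + 1), Suc 0 := i mod (n + 1))"
    have w: "flat2 (m + 1) (n + 1) 0 (Suc 0) l w v" by (simp add: flat2_def v_def w_def)
    have l: "l 0 \<le> m" "l (Suc 0) \<le> n" "l 0 * (n + 1) + l (Suc 0) = i"
      using *(5) less_mult_imp_div_less[of i "m + 1" "n + 1"] by (auto simp: l_def less_Suc_eq_le simp del: mult_Suc_right)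
    have "mat_action ?D w i \<in> J"
      using reflection_diff_action[OF k _ w l(1,2), of "a / b" "a * b" c d] reflectionD[OF refl *(1-4), of 0 "Suc 0"]
      unfolding l(3) vec_cong_def by simp
    moreover have "mat_action ?D w i = ?D $$ (i, j)"
      unfolding mat_action_def dims w_def using *(6) by (simp add: if_distrib[of "\<lambda>x. _ * x"] cong: if_cong)
    ultimately show "?D $$ (i, j) \<in> J" by simp
  qed
qed

lemma Kop_fusion:
  assumes K: "K = map_mat (\<sigma> \<circ> \<iota>) (fuse_F q B n) * (KA \<otimes>\<^sub>m 1\<^sub>m (n + 1)) * MR 1 n x * (1\<^sub>m 2 \<otimes>\<^sub>m KB)
      * map_mat (\<sigma> \<circ> \<iota>) (fuse_E q B n)"
    and KA: "KA \<in> carrier_mat 2 2" and KB: "KB \<in> carrier_mat (n + 1) (n + 1)" and pt: "p \<noteq> t" "i p = 0"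
  shows "Kop (n + 1) K t v i = F n p t (Kop 1 KA p (R 1 n p t x (Kop n KB t (E n p t v)))) i"
proof (cases "i t \<le> n + 1")
  case True
  let ?F = "map_mat (\<sigma> \<circ> \<iota>) (fuse_F q B n)" and ?E = "map_mat (\<sigma> \<circ> \<iota>) (fuse_E q B n)"
  let ?A = "KA \<otimes>\<^sub>m 1\<^sub>m (n + 1)" and ?B = "1\<^sub>m 2 \<otimes>\<^sub>m KB"
  obtain w where w: "flat2 1 (n + 2) p t i w v" using flat2_exists by blast
  have F: "?F \<in> carrier_mat (1 * (n + 2)) (2 * (n + 1))" and E: "?E \<in> carrier_mat (2 * (n + 1)) (1 * (n + 2))"
    using fuse_F_carrier[of q B n] fuse_E_carrier[of q B n] by auto
  have dims: "dim_row ?F = n + 2" "dim_col ?F = 2 * (n + 1)" "dim_row ?A = 2 * (n + 1)" "dim_col ?A = 2 * (n + 1)"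
      "dim_row (MR 1 n x) = 2 * (n + 1)" "dim_col (MR 1 n x) = 2 * (n + 1)"
      "dim_row ?B = 2 * (n + 1)" "dim_col ?B = 2 * (n + 1)" "dim_row ?E = 2 * (n + 1)" "dim_col ?E = n + 2"
    using F E KA KB R_half_carrier[of \<iota> q s B n x] by (auto simp: carrier_matD)
  have "flat2 1 (n + 2) p t i (mat_action ?F (mat_action ?A (mat_action (MR 1 n x) (mat_action ?B (mat_action ?E w)))))
      (F n p t (Kop 1 KA p (R 1 n p t x (Kop n KB t (E n p t v)))))"
    unfolding F_def E_def using KA KB pt(1) w
    by (intro flat2_mat[OF F] flat2_Kop_left[where m = 1, simplified one_add_one] flat2_R[where m = 1, simplified one_add_one]
        flat2_Kop_right flat2_mat[OF E]) simp_all
  then have "F n p t (Kop 1 KA p (R 1 n p t x (Kop n KB t (E n p t v)))) i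
      = mat_action ?F (mat_action ?A (mat_action (MR 1 n x) (mat_action ?B (mat_action ?E w)))) (i t)"
    using True pt by (simp add: flat2_def fun_upd_idem)
  also have "\<dots> = mat_action K w (i t)"
    unfolding K using True dims by (simp add: mat_action_mult del: dim_tensor_mat)
  also have "\<dots> = Kop (n + 1) K t v i"
    using True w pt dims by (simp add: mat_action_def K Kop_def op1_def ker1_def flat2_def fun_upd_idem)
  finally show ?thesis by simp
next
  case False
  then show ?thesis by (auto simp: Kop_def F_def op1_def op2_def ker1_def ker2_def)
qed

end

subsection \<open>Rescaling and specializing the defining relations\<close>

text \<open>The substitution u1 -> c u1, u2 -> d u2.\<close>

definition rescale2 :: "complex \<Rightarrow> complex \<Rightarrow> free_alg fls fls \<Rightarrow> free_alg fls fls" where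
  "rescale2 c d f = Abs_fls (\<lambda>a. fls_const (scal (c powi (- a))) * rescale d (fls_nth f a))"

lemma scal_1 [simp]: "scal 1 = 1" by (simp add: scal_def)

lemma rescale_0: "rescale d 0 = 0"
  by (rule fls_eqI) (simp add: fls_nth_rescale)

lemma fls_nth_rescale2: "fls_nth (rescale2 c d f) a = fls_const (scal (c powi (- a))) * rescale d (fls_nth f a)"
  unfolding rescale2_def by (rule nth_Abs_fls_lower_bound[of "fls_subdegree f"]) (simp add: rescale_0)

lemma rescale2_hom:
  assumes "c \<noteq> 0" "d \<noteq> 0"
  shows "semiring_hom (rescale2 c d)"
proof (rule fls_coeff_hom[OF rescale_hom[OF assms(2)], where \<chi> = "\<lambda>a. fls_const (scal (c powi (- a)))"])
  interpret scal: semiring_hom scal by (rule scal_hom)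
  show "fls_const (scal (c powi - (m + n))) = fls_const (scal (c powi - m)) * fls_const (scal (c powi - n))" for m n
    using assms power_int_add[of c "-m" "-n"] by (simp flip: scal.hom_mult)
  show "fls_const (scal (c powi - n)) * y = y * fls_const (scal (c powi - n))" for n y
    by (rule fls_central) (simp add: scal_central)
  show "fls_const (scal (c powi - 0)) = 1" by simp
qed (rule fls_nth_rescale2)

lemma rescale_const: "rescale d (fls_const z) = fls_const z"
  by (rule fls_eqI) (simp add: fls_nth_rescale)

lemma rescale2_var1: "rescale2 c d (fls_map fls_const f) = fls_map fls_const (rescale c f)"
  by (rule fls_eqI) (simp add: fls_nth_rescale2 fls_nth_fls_map rescale_const fls_nth_rescale)

lemma rescale2_var2: "rescale2 c d (fls_const f) = fls_const (rescale d f)"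
  by (rule fls_eqI) (simp add: fls_nth_rescale2 rescale_0)

lemma scal_cfun_const:
  "fls_map scal_series (cfun (fls_map fls_const x * fls_const y * (fls_const \<circ> fls_const) z))
    = fls_map scal_series (cfun (fls_map fls_const x * fls_const (y * fls_const z)))"
  by (simp add: mult.assoc fls_const_mult_const[symmetric] del: fls_const_mult_const)

lemma fls_map_0: "f 0 = 0 \<Longrightarrow> fls_map f 0 = 0"
  by (rule fls_eqI) (simp add: fls_nth_fls_map)

lemma R2_rescale2:
  assumes "c \<noteq> 0" "d \<noteq> 0"
  shows "map_mat (rescale2 c d) (R2 q (fls_map fls_const x * fls_const y))
    = R2 q (fls_map fls_const (fls_dilate c x) * fls_const (fls_dilate d y))"
proof -
  interpret h: semiring_hom "rescale2 c d" by (rule rescale2_hom[OF assms])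
  interpret dc: field_hom "fls_dilate c" by (rule fls_dilate_hom[OF assms(1)])
  interpret dd: field_hom "fls_dilate d" by (rule fls_dilate_hom[OF assms(2)])
  have cf: "rescale2 c d (fls_map scal_series (cfun (fls_map fls_const x * fls_const y)))
      = fls_map scal_series (cfun (fls_map fls_const (fls_dilate c x) * fls_const (fls_dilate d y)))" for y
    by (simp add: scal_cfun semiring_hom_diff[OF h.semiring_hom_axioms] h.hom_mult rescale2_var1 rescale2_var2
        rescale_scal_series dc.hom_inverse dd.hom_inverse)
  show ?thesis
    unfolding R2_def
    by (rule map_mat_R_fund)
      (simp_all only: scal_cfun_const cf dd.hom_mult fls_dilate_const, simp_all add: scal_const h.hom_zero rescale2_var2
        rescale_scal_series fls_dilate_const fls_map_0)
qed

lemma diag_scal_cfun: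
  "diag (fls_map scal_series (cfun (fls_map fls_const x * fls_const y))) = scal_series (cfun (x * y))"
  "bounded2 (fls_map scal_series (cfun (fls_map fls_const x * fls_const y)))"
proof -
  interpret S: semiring_hom scal_series by (rule scal_series_hom)
  show "diag (fls_map scal_series (cfun (fls_map fls_const x * fls_const y))) = scal_series (cfun (x * y))"
    unfolding scal_cfun
    by (simp add: diag_diff diag_mult bounded2_mult bounded2_const bounded2_map_const diag_const diag_map_const
        cfun_def semiring_hom_diff[OF scal_series_hom] S.hom_mult)
  show "bounded2 (fls_map scal_series (cfun (fls_map fls_const x * fls_const y)))"
    by (simp add: scal_cfun bounded2_diff bounded2_mult bounded2_const bounded2_map_const)
qed

lemma diag_R2:
  "map_mat diag (R2 q (fls_map fls_const x * fls_const y)) = map_mat scal_series (R_fund fls_const q (x * y))"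
  unfolding R2_def
  by (rule map_mat_R_fund)
    (simp_all only: scal_cfun_const diag_scal_cfun, simp_all add: mult.assoc scal_const diag_const fls_map_0 diag_0)

lemma mat_bounded2_R2: "mat_bounded2 (R2 q (fls_map fls_const x * fls_const y))"
proof -
  have "bounded2 (fls_map scal_series (cfun (fls_map fls_const x * fls_const y * (fls_const \<circ> fls_const) q)))"
    unfolding scal_cfun_const by (rule diag_scal_cfun)
  moreover have "bounded2 (fls_map scal_series ((fls_const \<circ> fls_const) (cfun q)))"
    by (simp add: scal_const bounded2_const)
  ultimately show ?thesis
    using diag_scal_cfun(2)[of x y]
    by (auto simp: mat_bounded2_def R2_def R_fund_def mat_of_rows_list_def numeral_eq_Suc less_Suc_eq fls_map_0 bounded2_0)
qed

lemma R2_var1: "map_mat (fls_map fls_const) (map_mat scal_series (R_fund fls_const q z)) = R2 q (fls_map fls_const z)"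
proof -
  interpret h: field_hom "fls_map fls_const :: complex fls \<Rightarrow> complex fls fls"
    by (intro field_homI fls_map_hom fls_const_hom)
  have const: "fls_map fls_const (fls_const w) = fls_const (fls_const w)" for w :: complex
    by (rule fls_eqI) (simp add: fls_nth_fls_map)
  show ?thesis
    unfolding R2_def
    by (rule map_mat_R_fund) (simp_all add: cfun_def h.hom_minus h.hom_mult h.hom_inverse const fls_map_0 flip: scal_map_const)
qed

lemma R2_var2: "map_mat fls_const (map_mat scal_series (R_fund fls_const q z)) = R2 q (fls_const z)"
proof -
  interpret h: field_hom "fls_const :: complex fls \<Rightarrow> complex fls fls"
    by (intro field_homI fls_map_hom fls_const_hom)
  show ?thesis
    unfolding R2_def
    by (rule map_mat_R_fund) (simp_all add: cfun_def h.hom_minus h.hom_mult h.hom_inverse fls_map_0 flip: scal_const del: fls_const_mult_const)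
qed

lemma K_fund_carrier: "K_fund q kp km \<in> carrier_mat 2 2"
  by (auto simp: K_fund_def Let_def mat_of_rows_list_def)

lemma K_fused_carrier: "K_fused q s B kp km n \<in> carrier_mat (n + 1) (n + 1)"
proof (induction q s B kp km n rule: K_fused.induct)
  case (3 q s B kp km n)
  show ?case by (auto simp: fuse_F_def fuse_E_def Let_def intro!: carrier_matI)
qed (use K_fund_carrier in \<open>auto simp: numeral_2_eq_2\<close>)

abbreviation Aq_coeffs :: "complex \<Rightarrow> complex \<Rightarrow> complex \<Rightarrow> free_alg fls set" where
  "Aq_coeffs q kp km \<equiv> coeff_ideal (Aq_ideal q kp km)"

lemma dim_reflection_diff:
  assumes "RA \<in> carrier_mat 4 4" "KB \<in> carrier_mat (1 + 1) (1 + 1)"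
  shows "dim_row (reflection_diff 1 1 RA RB KA KB) = 4" "dim_col (reflection_diff 1 1 RA RB KA KB) = 4"
  using assms by (auto simp: reflection_diff_def)

lemma R2_carrier': "R2 q z \<in> carrier_mat 4 4"
  by (auto simp: R2_def R_fund_def mat_of_rows_list_def)

lemma map_mat_index: "i < dim_row A \<Longrightarrow> j < dim_col A \<Longrightarrow> map_mat f A $$ (i, j) = f (A $$ (i, j))"
  by simp

lemma var_monomials:
  "var1 * fls_const (fls_const c) = fls_map fls_const (fls_X_inv * fls_const c)"
  "var2 * fls_const (fls_const c) = fls_const (fls_X_inv * fls_const c)"
proof -
  interpret h: field_hom "fls_map fls_const :: complex fls \<Rightarrow> complex fls fls"
    by (intro field_homI fls_map_hom fls_const_hom)
  have const: "fls_map fls_const (fls_const w) = fls_const (fls_const w)" for w :: complex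
    by (rule fls_eqI) (simp add: fls_nth_fls_map)
  have "fls_map fls_const fls_X_inv = (fls_X_inv :: complex fls fls)"
    by (rule fls_eqI) (simp add: fls_nth_fls_map)
  then show "var1 * fls_const (fls_const c) = fls_map fls_const (fls_X_inv * fls_const c)"
    by (simp add: var1_def h.hom_mult const)
  show "var2 * fls_const (fls_const c) = fls_const (fls_X_inv * fls_const c)"
    by (simp add: var2_def)
qed

lemma defining_relations:
  assumes "i < 4" "j < 4"
  shows "reflection_diff 1 1 (R2 q (var1 / var2)) (R2 q (var1 * var2)) (in_var1 (K_fund q kp km)) (in_var2 (K_fund q kp km)) $$ (i, j)
    \<in> coeff_ideal (Aq_coeffs q kp km)"
proof -
  have sub: "Aq_relators q kp km \<subseteq> Aq_ideal q kp km"
    unfolding Aq_ideal_def by (rule ring.genideal_self[OF ring_free_alg]) (simp add: ring_of_type_algebra_def)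
  show ?thesis
    unfolding coeff_ideal_def mem_Collect_eq
  proof (intro allI, rule subsetD[OF sub])
    fix a b
    show "fls_nth (fls_nth (reflection_diff 1 1 (R2 q (var1 / var2)) (R2 q (var1 * var2)) (in_var1 (K_fund q kp km))
        (in_var2 (K_fund q kp km)) $$ (i, j)) a) b \<in> Aq_relators q kp km"
      unfolding Aq_relators_def Let_def reflection_diff_def R2_def one_add_one using assms by blast
  qed
qed

lemma K_maps_carrier: "in_var1 (map_mat (rescale c) (K_fund q kp km)) \<in> carrier_mat (1 + 1) (1 + 1)"
  "in_var2 (map_mat (rescale d) (K_fund q kp km)) \<in> carrier_mat (1 + 1) (1 + 1)"
  "map_mat (rescale d) (K_fund q kp km) \<in> carrier_mat (1 + 1) (1 + 1)"
  using K_fund_carrier[of q kp km] by (auto simp: in_var1_def in_var2_def)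

text \<open>The arguments \<open>a / b\<close> and \<open>a b\<close> of the R-matrices, for \<open>a = c u\<^sub>1\<close> and \<open>b = d u\<^sub>2\<close>.\<close>

lemma rescaled_relations:
  fixes q kp km c d :: complex
  defines "K \<equiv> K_fund q kp km" and "x \<equiv> fls_X_inv * fls_const c" and "y \<equiv> fls_X_inv * fls_const d"
  assumes cd: "c \<noteq> 0" "d \<noteq> 0" and ij: "i < 4" "j < 4"
  shows "reflection_diff 1 1 (R2 q (fls_map fls_const x * fls_const (inverse y))) (R2 q (fls_map fls_const x * fls_const y))
      (in_var1 (map_mat (rescale c) K)) (in_var2 (map_mat (rescale d) K)) $$ (i, j) \<in> coeff_ideal (Aq_coeffs q kp km)"
proof -
  let ?J = "coeff_ideal (Aq_coeffs q kp km)"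
  have J: "two_sided_ideal (Aq_ideal q kp km)" "two_sided_ideal (Aq_coeffs q kp km)"
    by (intro two_sided_ideal_coeff two_sided_ideal_Aq_ideal)+
  have pres: "rescale2 c d f \<in> ?J" if "f \<in> ?J" for f
    using that by (auto simp: coeff_ideal_def fls_nth_rescale2 fls_nth_rescale fls_times_nth(2) two_sided_idealD[OF J(1)]
        intro!: two_sided_ideal_sum[OF J(1)])
  interpret dd: field_hom "fls_dilate d" by (rule fls_dilate_hom[OF cd(2)])
  interpret h: field_hom "fls_const :: complex fls \<Rightarrow> complex fls fls"
    by (intro field_homI fls_const_hom)
  have vars: "var1 / var2 = fls_map fls_const fls_X_inv * fls_const (inverse fls_X_inv)"
      "var1 * var2 = fls_map fls_const fls_X_inv * fls_const fls_X_inv"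
    using var_monomials[of 1] by (simp_all add: divide_inverse h.hom_inverse var2_def)
  have K: "map_mat (rescale2 c d) (in_var1 K) = in_var1 (map_mat (rescale c) K)"
      "map_mat (rescale2 c d) (in_var2 K) = in_var2 (map_mat (rescale d) K)"
    by (auto simp: in_var1_def in_var2_def rescale2_var1 rescale2_var2 intro!: eq_matI)
  have carr: "in_var1 K \<in> carrier_mat (1 + 1) (1 + 1)" "in_var2 K \<in> carrier_mat (1 + 1) (1 + 1)"
    using K_fund_carrier[of q kp km] by (auto simp: in_var1_def in_var2_def K_def)
  let ?D = "reflection_diff 1 1 (R2 q (var1 / var2)) (R2 q (var1 * var2)) (in_var1 K) (in_var2 K)"
  have dims: "dim_row ?D = 4" "dim_col ?D = 4"
    using dim_reflection_diff[OF R2_carrier' carr(2)] by auto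
  have "map_mat (rescale2 c d) ?D
      = reflection_diff 1 1 (R2 q (fls_map fls_const x * fls_const (inverse y))) (R2 q (fls_map fls_const x * fls_const y))
          (in_var1 (map_mat (rescale c) K)) (in_var2 (map_mat (rescale d) K))"
    unfolding map_reflection_diff[OF rescale2_hom[OF cd] R2_carrier R2_carrier carr] K
    by (simp add: vars R2_rescale2[OF cd] dd.hom_inverse fls_dilate_X_inv x_def y_def)
  then show ?thesis
    using pres[OF defining_relations[OF ij, of q kp km]] dims ij map_mat_index[of i ?D j "rescale2 c d"] by (simp add: K_def)
qed

text \<open>The diagonal of the rescaled relations relates K(c u) and K(d u) for one variable u.
  Then \<open>h\<close> and \<open>\<phi>\<close> put u back as u1 or as u2, since both K-operators
  of the final equation have to be fused inside the ring of double series.\<close>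

lemma specialized_relations:
  fixes q kp km c d :: complex and h :: "free_alg fls \<Rightarrow> free_alg fls fls" and \<phi> :: "complex fls \<Rightarrow> complex fls fls"
  defines "K \<equiv> K_fund q kp km" and "x \<equiv> fls_X_inv * fls_const c" and "y \<equiv> fls_X_inv * fls_const d"
  assumes cd: "c \<noteq> 0" "d \<noteq> 0" and ij: "i < 4" "j < 4"
    and h: "h = fls_map fls_const \<and> \<phi> = fls_map fls_const \<or> h = fls_const \<and> \<phi> = fls_const"
  shows "reflection_diff 1 1 (R2 q (\<phi> (x * inverse y))) (R2 q (\<phi> (x * y)))
      (map_mat h (map_mat (rescale c) K)) (map_mat h (map_mat (rescale d) K)) $$ (i, j) \<in> coeff_ideal (Aq_coeffs q kp km)"
proof -
  let ?J = "coeff_ideal (Aq_coeffs q kp km)"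
  have J: "two_sided_ideal (Aq_ideal q kp km)" "two_sided_ideal (Aq_coeffs q kp km)"
    by (intro two_sided_ideal_coeff two_sided_ideal_Aq_ideal)+
  let ?D = "reflection_diff 1 1 (R2 q (fls_map fls_const x * fls_const (inverse y))) (R2 q (fls_map fls_const x * fls_const y))
      (in_var1 (map_mat (rescale c) K)) (in_var2 (map_mat (rescale d) K))"
  have bK: "mat_bounded2 (in_var1 M)" "mat_bounded2 (in_var2 M)" "map_mat diag (in_var1 M) = M" "map_mat diag (in_var2 M) = M" for M
    by (auto simp: mat_bounded2_def in_var1_def in_var2_def bounded2_const bounded2_map_const diag_const diag_map_const intro!: eq_matI)
  note carr = R2_carrier[of q] K_maps_carrier[of _ q kp km, folded K_def]
  note dg = diag_reflection_diff[OF carr(1,1,2,3) mat_bounded2_R2 mat_bounded2_R2 bK(1,2)]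
  have dims: "dim_row ?D = 4" "dim_col ?D = 4"
    using dim_reflection_diff[OF R2_carrier' carr(3)] by auto
  \<comment> \<open>Every coefficient of the diagonal is a finite sum of coefficients from the
    ideal.\<close>
  have diag_J: "diag f \<in> Aq_coeffs q kp km" if f: "f \<in> ?J" "bounded2 f" for f
  proof -
    obtain N where N: "\<And>a b. a < N \<or> b < N \<Longrightarrow> fls_nth (fls_nth f a) b = 0"
      using f(2) by (auto simp: bounded2_def)
    have "fls_nth (diag f) n = (\<Sum>a=N..n - N. fls_nth (fls_nth f a) (n - a))" for n
      by (rule diag_nth) (rule N)
    then show ?thesis using f(1) by (auto simp: coeff_ideal_def intro!: two_sided_ideal_sum[OF J(1)])
  qed
  have h_J: "h f \<in> ?J" if "f \<in> Aq_coeffs q kp km" for f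
    using h that two_sided_idealD(1)[OF J(1)] by (auto simp: coeff_ideal_def fls_nth_fls_map)
  have hom: "semiring_hom h" using h by (auto intro: fls_map_hom fls_const_hom)
  have hR: "map_mat h (map_mat scal_series (R_fund fls_const q z)) = R2 q (\<phi> z)" for z
    using h R2_var1 R2_var2 by auto
  have R1_carrier: "map_mat scal_series (R_fund fls_const q z) \<in> carrier_mat ((1 + 1) * (1 + 1)) ((1 + 1) * (1 + 1))" for z
    by (auto simp: R_fund_def mat_of_rows_list_def)
  have "map_mat h (map_mat diag ?D) = reflection_diff 1 1 (R2 q (\<phi> (x * inverse y))) (R2 q (\<phi> (x * y)))
      (map_mat h (map_mat (rescale c) K)) (map_mat h (map_mat (rescale d) K))"
    unfolding dg(1) bK(3,4) diag_R2
    by (subst map_reflection_diff[OF hom R1_carrier R1_carrier carr(4) carr(4)]) (simp only: hR)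
  moreover have "map_mat h (map_mat diag ?D) $$ (i, j) = h (diag (?D $$ (i, j)))"
    using ij dims by simp
  moreover have "?D $$ (i, j) \<in> ?J"
    unfolding x_def y_def K_def by (rule rescaled_relations[OF cd ij])
  moreover have "mat_bounded2 ?D" by (rule dg(2))
  then have "bounded2 (?D $$ (i, j))"
    using ij dims by (simp only: mat_bounded2_def)
  ultimately show ?thesis using h_J[OF diag_J] by simp
qed

section \<open>The fused K-operators\<close>

lemma map_mat_comp: "map_mat f (map_mat g A) = map_mat (f \<circ> g) A"
  by (intro eq_matI) auto

lemma R_fund_natural:
  assumes "field_hom h" "\<And>z. h (\<iota> z) = \<iota>' z"
  shows "map_mat h (R_fund \<iota> q x) = R_fund \<iota>' q (h x)"
proof -
  interpret field_hom h by fact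
  show ?thesis
    by (intro eq_matI) (auto simp: R_fund_def mat_of_rows_list_def numeral_eq_Suc less_Suc_eq cfun_def hom_distribs assms(2))
qed

text \<open>The recursion for K-operators uses R-matrices over series in one variable; here they
  become R-matrices over another field, such as that of double series.\<close>

lemma R_half_natural:
  assumes h: "field_hom h" "\<And>z. h (\<iota> z) = \<iota>' z" and n: "n \<ge> 1"
  shows "map_mat h (R_half \<iota> q s B n x) = R_half \<iota>' q s B n (h x)"
  using n
proof (induction n arbitrary: x rule: nat_induct_at_least)
  case base
  show ?case using R_fund_natural[OF h] by simp
next
  case (Suc n)
  then obtain m where m: "n = Suc m" by (cases n) auto
  interpret field_hom h by (rule h)
  have hom: "semiring_hom h" by unfold_locales
  let ?M = "2 * 2 * (n + 1)"
  have carr: "1\<^sub>m 2 \<otimes>\<^sub>m map_mat \<iota> (fuse_F q B n) \<in> carrier_mat (2 * (n + 2)) ?M"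
      "act13 2 2 (n + 1) M \<in> carrier_mat ?M ?M"
      "R_fund \<iota> q y \<otimes>\<^sub>m 1\<^sub>m (n + 1) \<in> carrier_mat ?M ?M"
      "1\<^sub>m 2 \<otimes>\<^sub>m map_mat \<iota> (fuse_E q B n) \<in> carrier_mat ?M (2 * (n + 2))" for y M
    using fuse_F_carrier[of q B n] fuse_E_carrier[of q B n] R_fund_carrier[of \<iota> q y] by (auto simp: act13_def)
  have \<iota>: "map_mat h (map_mat \<iota> A) = map_mat \<iota>' A" for A
    by (intro eq_matI) (auto simp: h(2))
  have "R_half \<iota> q s B (Suc n) x = (1\<^sub>m 2 \<otimes>\<^sub>m map_mat \<iota> (fuse_F q B n)) * act13 2 2 (n + 1) (R_half \<iota> q s B n (x * \<iota> (inverse s)))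
     * (R_fund \<iota> q (x * \<iota> (s ^ n)) \<otimes>\<^sub>m 1\<^sub>m (n + 1)) * (1\<^sub>m 2 \<otimes>\<^sub>m map_mat \<iota> (fuse_E q B n))"
    by (simp add: m)
  also have "map_mat h \<dots> = (1\<^sub>m 2 \<otimes>\<^sub>m map_mat \<iota>' (fuse_F q B n)) * act13 2 2 (n + 1) (R_half \<iota>' q s B n (h (x * \<iota> (inverse s))))
     * (R_fund \<iota>' q (h (x * \<iota> (s ^ n))) \<otimes>\<^sub>m 1\<^sub>m (n + 1)) * (1\<^sub>m 2 \<otimes>\<^sub>m map_mat \<iota>' (fuse_E q B n))"
    by (simp only: mat_hom_mult[OF mult_carrier_mat[OF mult_carrier_mat[OF carr(1,2)] carr(3)] carr(4)]
        mat_hom_mult[OF mult_carrier_mat[OF carr(1,2)] carr(3)] mat_hom_mult[OF carr(1,2)]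
        map_mat_tensor[OF hom] mat_hom_one \<iota> map_mat_act13[OF hom R_half_carrier] R_fund_natural[OF h] Suc.IH)
  also have "\<dots> = R_half \<iota>' q s B (Suc n) (h x)"
    by (simp add: m hom_mult h(2))
  finally show ?case .
qed

text \<open>The recursion at the point c u. The argument of R turns into the product of c u / s^n
  and c u s, the points of the two K-operators.\<close>

lemma K_fused_step:
  fixes h :: "free_alg fls \<Rightarrow> 'r::ring_1" and \<phi> :: "complex fls \<Rightarrow> 'b::field"
  assumes h: "semiring_hom h" and \<phi>: "field_hom \<phi>" "\<And>z. \<phi> (fls_const z) = \<iota> z"
    and h\<phi>: "\<And>f. h (scal_series f) = \<sigma> (\<phi> f)" and c: "c \<noteq> 0" and n: "n \<ge> 1" and s: "s \<noteq> 0"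
  shows "map_mat h (map_mat (rescale c) (K_fused q s B kp km (n + 1)))
    = map_mat (\<sigma> \<circ> \<iota>) (fuse_F q B n) * (map_mat h (map_mat (rescale (c / s ^ n)) (K_fused q s B kp km 1)) \<otimes>\<^sub>m 1\<^sub>m (n + 1))
      * map_mat \<sigma> (R_fused \<iota> q s B 1 n ((\<phi> fls_X_inv * \<iota> c)\<^sup>2 * \<iota> s / \<iota> s ^ n))
      * (1\<^sub>m 2 \<otimes>\<^sub>m map_mat h (map_mat (rescale (c * s)) (K_fused q s B kp km n)))
      * map_mat (\<sigma> \<circ> \<iota>) (fuse_E q B n)"
proof -
  from n obtain m where m: "n = Suc m" by (cases n) auto
  define hc where "hc = h \<circ> rescale c"
  have hom: "semiring_hom hc"
    unfolding hc_def by (intro semiring_hom_comp h rescale_hom c)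
  interpret semiring_hom hc by (rule hom)
  interpret \<phi>: field_hom \<phi> by (rule \<phi>)
  interpret dl: field_hom "fls_dilate c" by (rule fls_dilate_hom[OF c])
  let ?N = "2 * (n + 1)"
  let ?F = "map_mat (scal_series \<circ> fls_const) (fuse_F q B n)" and ?E = "map_mat (scal_series \<circ> fls_const) (fuse_E q B n)"
  let ?x = "fls_X_inv ^ 2 * fls_const (inverse s ^ m) :: complex fls"
  let ?K1 = "map_mat (rescale (inverse s ^ n)) (K_fund q kp km)" and ?Kn = "map_mat (rescale s) (K_fused q s B kp km n)"
  let ?R = "map_mat scal_series (R_half fls_const q s B n ?x)"
  have carr: "?F \<in> carrier_mat (n + 2) ?N" "?K1 \<otimes>\<^sub>m 1\<^sub>m (n + 1) \<in> carrier_mat ?N ?N" "?R \<in> carrier_mat ?N ?N"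
      "1\<^sub>m 2 \<otimes>\<^sub>m ?Kn \<in> carrier_mat ?N ?N" "?E \<in> carrier_mat ?N (n + 2)"
    using fuse_F_carrier[of q B n] fuse_E_carrier[of q B n] R_half_carrier[of fls_const q s B n ?x]
      K_fund_carrier[of q kp km] K_fused_carrier[of q s B kp km n] by auto
  have hs: "hc (scal_series f) = \<sigma> ((\<phi> \<circ> fls_dilate c) f)" for f
    by (simp add: hc_def rescale_scal_series h\<phi>)
  have const: "map_mat hc (map_mat (scal_series \<circ> fls_const) A) = map_mat (\<sigma> \<circ> \<iota>) A" for A
    by (intro eq_matI) (auto simp: hs fls_dilate_const \<phi>(2))
  have R: "map_mat hc ?R = map_mat \<sigma> (R_half \<iota> q s B n ((\<phi> \<circ> fls_dilate c) ?x))"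
  proof -
    have "map_mat hc ?R = map_mat \<sigma> (map_mat (\<phi> \<circ> fls_dilate c) (R_half fls_const q s B n ?x))"
      by (intro eq_matI) (auto simp: hs)
    also have "map_mat (\<phi> \<circ> fls_dilate c) (R_half fls_const q s B n ?x) = R_half \<iota> q s B n ((\<phi> \<circ> fls_dilate c) ?x)"
      by (rule R_half_natural[OF field_hom_comp[OF \<phi>(1) fls_dilate_hom[OF c]] _ n]) (simp add: fls_dilate_const \<phi>(2))
    finally show ?thesis .
  qed
  \<comment> \<open>The index shift \<open>n = m + 1\<close> turns s^-m into s / s^n.\<close>
  have \<iota>s: "\<iota> (inverse s ^ m) = \<iota> s / \<iota> s ^ n"
  proof -
    have "\<phi> (fls_const (inverse s ^ m)) = inverse (\<phi> (fls_const s)) ^ m"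
      using s by (simp add: fls_const_power \<phi>.hom_power \<phi>.hom_inverse[symmetric] fls_inverse_const)
    moreover have "\<phi> (fls_const s) \<noteq> 0" using s by simp
    ultimately show ?thesis by (simp add: \<phi>(2) m power_inverse field_simps)
  qed
  have x: "(\<phi> \<circ> fls_dilate c) ?x = (\<phi> fls_X_inv * \<iota> c)\<^sup>2 * \<iota> s / \<iota> s ^ n"
    by (simp add: dl.hom_mult dl.hom_power \<phi>.hom_mult \<phi>.hom_power fls_dilate_X_inv fls_dilate_const \<phi>(2) \<iota>s)
  have K: "map_mat hc ?K1 = map_mat h (map_mat (rescale (c / s ^ n)) (K_fused q s B kp km 1))"
      "map_mat hc ?Kn = map_mat h (map_mat (rescale (c * s)) (K_fused q s B kp km n))"
    by (auto simp: hc_def rescale_rescale divide_inverse power_inverse intro!: eq_matI)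
  have "K_fused q s B kp km (n + 1) = ?F * (?K1 \<otimes>\<^sub>m 1\<^sub>m (n + 1)) * ?R * (1\<^sub>m 2 \<otimes>\<^sub>m ?Kn) * ?E"
    by (simp add: m)
  then have "map_mat h (map_mat (rescale c) (K_fused q s B kp km (n + 1)))
      = map_mat hc (?F * (?K1 \<otimes>\<^sub>m 1\<^sub>m (n + 1)) * ?R * (1\<^sub>m 2 \<otimes>\<^sub>m ?Kn) * ?E)"
    by (simp only: map_mat_comp hc_def)
  also have "\<dots> = map_mat hc ?F * map_mat hc (?K1 \<otimes>\<^sub>m 1\<^sub>m (n + 1)) * map_mat hc ?R * map_mat hc (1\<^sub>m 2 \<otimes>\<^sub>m ?Kn) * map_mat hc ?E"
    by (simp only: mat_hom_mult[OF mult_carrier_mat[OF mult_carrier_mat[OF mult_carrier_mat[OF carr(1,2)] carr(3)] carr(4)] carr(5)]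
        mat_hom_mult[OF mult_carrier_mat[OF mult_carrier_mat[OF carr(1,2)] carr(3)] carr(4)]
        mat_hom_mult[OF mult_carrier_mat[OF carr(1,2)] carr(3)] mat_hom_mult[OF carr(1,2)])
  finally show ?thesis
    by (simp only: const R x K map_mat_tensor[OF hom] mat_hom_one R_fused.simps One_nat_def)
qed

lemma reflection_relations:
  assumes q: "q \<noteq> 0" "\<forall>n>0. q ^ n \<noteq> 1" "s\<^sup>2 = q" "root_choice q B"
    and mn: "m \<ge> 1" "n \<ge> 1" and ij: "i < (m + 1) * (n + 1)" "j < (m + 1) * (n + 1)"
  shows "reflection_diff m n (R_at q s B m n (var1 / var2)) (R_at q s B m n (var1 * var2))
    (in_var1 (K_fused q s B kp km m)) (in_var2 (K_fused q s B kp km n)) $$ (i, j) \<in> coeff_ideal (Aq_coeffs q kp km)"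
proof -
  let ?\<iota> = "fls_const \<circ> fls_const :: complex \<Rightarrow> complex fls fls"
  interpret fusion ?\<iota> "fls_map scal_series" q s B
    by (rule fusion_two_variables) fact+
  let ?J = "coeff_ideal (Aq_coeffs q kp km)"
  have J: "two_sided_ideal ?J"
    by (intro two_sided_ideal_coeff two_sided_ideal_Aq_ideal)
  define k1 where "k1 n c = in_var1 (map_mat (rescale c) (K_fused q s B kp km n))" for n c
  define k2 where "k2 n c = in_var2 (map_mat (rescale c) (K_fused q s B kp km n))" for n c
  have k_carrier: "k1 n c \<in> carrier_mat (n + 1) (n + 1)" "k2 n c \<in> carrier_mat (n + 1) (n + 1)" for n c
    using K_fused_carrier[of q s B kp km n] by (auto simp: k1_def k2_def in_var1_def in_var2_def)
  have k_1: "k1 1 c = map_mat (fls_map fls_const) (map_mat (rescale c) (K_fund q kp km))"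
      "k2 1 c = map_mat fls_const (map_mat (rescale c) (K_fund q kp km))" for c
    by (simp_all add: k1_def k2_def in_var1_def in_var2_def)
  have MR_1: "MR 1 1 x = R2 q x" for x by (simp add: R2_def)
  have u: "var1 \<noteq> 0" "var2 \<noteq> 0" by (auto simp: var1_def var2_def)
  interpret v2: field_hom "fls_const :: complex fls \<Rightarrow> complex fls fls"
    by (intro field_homI fls_const_hom)
  have const: "fls_map fls_const (fls_const z) = ?\<iota> z" for z
    by (rule fls_eqI) (simp add: fls_nth_fls_map)
  have var: "var1 * ?\<iota> c = fls_map fls_const (fls_X_inv * fls_const c)" "var2 * ?\<iota> c = fls_const (fls_X_inv * fls_const c)" for c
    using var_monomials by simp_all
  have var': "var1 = fls_map fls_const fls_X_inv" "var2 = fls_const fls_X_inv"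
    using var_monomials[of 1] by simp_all
  have N: "(1 + 1) * (1 + 1) = (4 :: nat)" by simp
  have base: "reflection ?J var1 var2 k1 k2 1 1"
    unfolding reflection_iff_mat[of ?J k1 1 k2 1, OF J k_carrier] MR_1 N k_1
  proof (intro allI impI)
    fix c d a b and i j :: nat
    assume *: "c \<noteq> 0" "d \<noteq> 0" "a = var1 * ?\<iota> c" "b = var2 * ?\<iota> d" "i < 4" "j < 4"
    have args: "a / b = fls_map fls_const (fls_X_inv * fls_const c) * fls_const (inverse (fls_X_inv * fls_const d))"
        "a * b = fls_map fls_const (fls_X_inv * fls_const c) * fls_const (fls_X_inv * fls_const d)"
      by (simp_all only: *(3,4) var divide_inverse v2.hom_inverse)
    show "reflection_diff 1 1 (R2 q (a / b)) (R2 q (a * b)) (map_mat (fls_map fls_const) (map_mat (rescale c) (K_fund q kp km)))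
        (map_mat fls_const (map_mat (rescale d) (K_fund q kp km))) $$ (i, j) \<in> ?J"
      using rescaled_relations[OF *(1,2,5,6), of q kp km] by (simp only: args in_var1_def in_var2_def)
  qed
  \<comment> \<open>The same argument serves both variables, with the relations specialised to u1 or
    to u2.\<close>
  have fus: "fusable ?J (\<phi> fls_X_inv) k l"
    if h: "h = fls_map fls_const \<and> \<phi> = fls_map fls_const \<or> h = fls_const \<and> \<phi> = fls_const"
      and k: "\<And>l c. k l c = map_mat h (map_mat (rescale c) (K_fused q s B kp km l))" and l: "l \<ge> 1" for h \<phi> k l
  proof -
    have hom: "semiring_hom h" and "field_hom \<phi>" and \<phi>: "\<And>z. \<phi> (fls_const z) = ?\<iota> z"
      and h\<phi>: "\<And>f. h (scal_series f) = fls_map scal_series (\<phi> f)"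
      using h const by (auto simp: scal_map_const scal_const intro!: fls_map_hom fls_const_hom field_homI)
    interpret \<phi>: field_hom \<phi> by fact
    have kc: "k n c \<in> carrier_mat (n + 1) (n + 1)" for n c
      using K_fused_carrier[of q s B kp km n] by (auto simp: k)
    have k_1: "k 1 c = map_mat h (map_mat (rescale c) (K_fund q kp km))" for c by (simp add: k)
    have refl: "reflection ?J (\<phi> fls_X_inv) (\<phi> fls_X_inv) k k 1 1"
      unfolding reflection_iff_mat[of ?J k 1 k 1, OF J kc kc] MR_1 N k_1
    proof (intro allI impI)
      fix c d a b and i j :: nat
      assume *: "c \<noteq> 0" "d \<noteq> 0" "a = \<phi> fls_X_inv * ?\<iota> c" "b = \<phi> fls_X_inv * ?\<iota> d" "i < 4" "j < 4"
      have ab: "a = \<phi> (fls_X_inv * fls_const c)" "b = \<phi> (fls_X_inv * fls_const d)"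
        by (simp_all only: *(3,4) \<phi>.hom_mult \<phi>)
      have args: "a / b = \<phi> (fls_X_inv * fls_const c * inverse (fls_X_inv * fls_const d))"
          "a * b = \<phi> (fls_X_inv * fls_const c * (fls_X_inv * fls_const d))"
        by (simp_all only: ab divide_inverse \<phi>.hom_inverse \<phi>.hom_mult)
      show "reflection_diff 1 1 (R2 q (a / b)) (R2 q (a * b)) (map_mat h (map_mat (rescale c) (K_fund q kp km)))
          (map_mat h (map_mat (rescale d) (K_fund q kp km))) $$ (i, j) \<in> ?J"
        unfolding args by (rule specialized_relations[OF *(1,2,5,6) h])
    qed
    show ?thesis
    proof (rule reflection_one_point[OF J _ refl _ l])
      show "\<phi> fls_X_inv \<noteq> 0" by simp
      fix c :: complex and v and n p t :: nat and i :: "nat \<Rightarrow> nat"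
      assume *: "n \<ge> 1" "c \<noteq> 0" "p \<noteq> t" "i p = 0"
      have "k (n + 1) c = map_mat (fls_map scal_series \<circ> ?\<iota>) (fuse_F q B n) * (k 1 (c / s ^ n) \<otimes>\<^sub>m 1\<^sub>m (n + 1))
        * MR 1 n ((\<phi> fls_X_inv * ?\<iota> c)\<^sup>2 * S / S ^ n) * (1\<^sub>m 2 \<otimes>\<^sub>m k n (c * s)) * map_mat (fls_map scal_series \<circ> ?\<iota>) (fuse_E q B n)"
        unfolding k S_def by (rule K_fused_step[OF hom \<phi>.field_hom_axioms \<phi> h\<phi> *(2,1) s_nz])
      then show "Kop (n + 1) (k (n + 1) c) t v i = F n p t (Kop 1 (k 1 (c / s ^ n)) p
          (R 1 n p t ((\<phi> fls_X_inv * ?\<iota> c)\<^sup>2 * S / S ^ n) (Kop n (k n (c * s)) t (E n p t v)))) i"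
        using kc[of 1] kc[of n] *(3,4) by (intro Kop_fusion) (simp_all only: one_add_one not_False_eq_True)
    qed
  qed
  have fus1: "fusable ?J var1 k1 l" if "l \<ge> 1" for l
    unfolding var'(1) by (rule fus[OF disjI1 _ that]) (simp_all add: k1_def in_var1_def)
  have fus2: "fusable ?J var2 k2 l" if "l \<ge> 1" for l
    unfolding var'(2) by (rule fus[OF disjI2 _ that]) (simp_all add: k2_def in_var2_def)
  have re: "reflection ?J var1 var2 k1 k2 m n"
    by (rule reflection_two_points[OF J u base fus1 fus2 mn])
  have "reflection_diff m n (MR m n (var1 / var2)) (MR m n (var1 * var2)) (k1 m 1) (k2 n 1) $$ (i, j) \<in> ?J"
    \<comment> \<open>The member \<open>c = d = 1\<close> of the family; rescaling by 1 is the
      identity.\<close>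
    by (rule re[unfolded reflection_iff_mat[of ?J k1 m k2 n, OF J k_carrier], rule_format, of 1 1]) (use ij in simp_all)
  moreover have "map_mat (rescale 1) A = A" for A
    by (intro eq_matI) (auto simp: rescale_1)
  ultimately show ?thesis by (simp add: k1_def k2_def R_at_def)
qed

theorem theorem5p7:
  fixes q s kp km :: complex
    and B :: "nat \<Rightarrow> nat \<Rightarrow> complex"
    and n1 n2 :: nat
  assumes "q \<noteq> 0"
    and "\<forall>n>0. q ^ n \<noteq> 1"
    and "s\<^sup>2 = q"
    and "kp \<noteq> 0"
    and "km \<noteq> 0"
    and "root_choice q B"
    and "n1 \<ge> 1"
    and "n2 \<ge> 1"
  defines "R \<equiv> R_at q s B n1 n2"
    and "K1 \<equiv> in_var1 (K_fused q s B kp km n1) \<otimes>\<^sub>m 1\<^sub>m (n2 + 1)"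
    and "K2 \<equiv> 1\<^sub>m (n1 + 1) \<otimes>\<^sub>m in_var2 (K_fused q s B kp km n2)"
  shows "over_Aq q kp km (R (var1 / var2) * K1 * R (var1 * var2) * K2)
       = over_Aq q kp km (K2 * R (var1 * var2) * K1 * R (var1 / var2))"
proof -
  let ?A = "R (var1 / var2) * K1 * R (var1 * var2) * K2" and ?B = "K2 * R (var1 * var2) * K1 * R (var1 / var2)"
  let ?N = "(n1 + 1) * (n2 + 1)"
  have R: "R x \<in> carrier_mat ?N ?N" for x
    using R_fused_carrier by (auto simp: R_def R_at_def)
  have K: "K1 \<in> carrier_mat ?N ?N" "K2 \<in> carrier_mat ?N ?N"
    unfolding K1_def K2_def in_var1_def in_var2_def
    by (rule tensor_mat_carrier; use K_fused_carrier[of q s B kp km] in simp)+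
  have dims: "dim_row ?A = ?N" "dim_col ?A = ?N" "dim_row ?B = ?N" "dim_col ?B = ?N"
    using R K by auto
  show ?thesis
  proof (rule eq_matI)
    fix i j
    assume "i < dim_row (over_Aq q kp km ?B)" "j < dim_col (over_Aq q kp km ?B)"
    then have ij: "i < ?N" "j < ?N" using dims by (simp_all only: over_Aq_def index_map_mat)
    \<comment> \<open>Cosets coincide when the difference lies in the ideal, so the claim is
      membership of all coefficients of the difference.\<close>
    have "(?A - ?B) $$ (i, j) \<in> coeff_ideal (Aq_coeffs q kp km)"
      using reflection_relations[OF assms(1-3,6-8) ij, of kp km] unfolding reflection_diff_def R_def K1_def K2_def .
    then show "over_Aq q kp km ?A $$ (i, j) = over_Aq q kp km ?B $$ (i, j)"
      using ij dims by (simp add: over_Aq_def coeff_ideal_def to_Aq_eq_iff fun_eq_iff)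
  qed (simp_all only: over_Aq_def index_map_mat dims)
qed

end
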